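(* Let $V$ be an $n$-dimensional vector space over a field $k$. For $\sigma\in\mathcal{OPD}(V)'$, write $\sigma=\sigma_0\cup\sigma_1$, where $\sigma_0$ is the set of ordered partial decompositions in $\sigma$ that span a proper subspace of $V$, and $\sigma_1$ is the set of full ordered decompositions in $\sigma$. Set $$\phi(\sigma)=\begin{cases}\{\langle s\rangle : s\in\sigma_0\} & \text{if }\sigma_1=\emptyset,\\ \max\sigma_1 & \text{if }\sigma_1\neq\emptyset,\end{cases}$$ where $\langle s\rangle$ is the subspace spanned by the members of $s$. Then $\phi$ is a $\mathrm{GL}(V)$-equivariant poset map $\phi:\mathcal{OPD}(V)'\to\mathcal{OPD}(\Delta(V))$ such that for all $H\le\mathrm{GL}(V)$ the induced map $\phi_H:(\mathcal{OPD}(V)')^H\to\mathcal{OPD}(\Delta(V))^H$ is a homotopy equivalence. The analogous conclusions hold for the corresponding map $\mathcal{PD}(V)'\to\mathcal{PD}(\Delta(V))$ (given by the same formula with partial decompositions and full decompositions in place of ordered ones).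
   Context: $X'$ denotes the poset of finite non-empty chains of a poset $X$ ordered by inclusion; $X^H$ is the subposet of $H$-fixed elements; homotopy notions for posets refer to order complexes. A partial decomposition of $V$ is a set $\{S_1,\dots,S_r\}$ of non-zero proper subspaces of $V$ in internal direct sum, i.e. $\langle S_1,\dots,S_r\rangle\cong S_1\oplus\cdots\oplus S_r$. $\mathcal{PD}(V)$ is the poset of non-empty partial decompositions (excluding $\{V\}$) with order $d_1\le d_2$ iff every $S\in d_1$ is contained in some $T\in d_2$. A full decomposition is a partial decomposition with $V\cong S_1\oplus\cdots\oplus S_r$; $\mathcal D(V)\subseteq\mathcal{PD}(V)$ is the subposet of full decompositions. $\mathcal{OPD}(V)$ is the poset of tuples $(S_1,\dots,S_r)$ of distinct subspaces with $\{S_1,\dots,S_r\}\in\mathcal{PD}(V)$, with $(S_1,\dots,S_r)\le(W_1,\dots,W_t)$ iff for all $1\le i\le j\le r$ there are $1\le p\le l\le t$ with $S_i\le W_p$ and $S_j\le W_l$. $\mathcal{OD}(V)\subseteq\mathcal{OPD}(V)$ is the subposet of tuples whose underlying set lies in $\mathcal D(V)$ (full ordered decompositions). $\Delta(V)$ is the order complex of the poset of non-zero proper subspaces of $V$; $\mathcal X(\Delta(V))$ is the poset of its non-empty simplices (chains of subspaces) ordered by inclusion. A collection of subspaces has a common basis if there is a basis $B$ of $V$ such that $B\cap W$ is a basis of $W$ for every $W$ in the collection. $\mathcal{OPD}(\Delta(V))$ (resp. $\mathcal{PD}(\Delta(V))$) is the poset on the disjoint union of $\mathcal X(\Delta(V))$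 and $\mathcal{OD}(V)$ (resp. $\mathcal D(V)$), keeping the orders on each part, and with $\sigma\prec d$ for $\sigma\in\mathcal X(\Delta(V))$ and $d\in\mathcal{OD}(V)$ (resp. $d\in\mathcal D(V)$) iff the set of subspaces appearing in at least one of $\sigma$ and $d$ has a common basis. *)

theory Defs
  imports "HOL-Analysis.Analysis" "HOL-Algebra.Group"
begin

section \<open>Posets and their order complexes\<close>

text \<open>
  A poset is given by a carrier set and an order relation that only matters on the carrier.
\<close>

definition is_poset :: "'x set \<Rightarrow> ('x \<Rightarrow> 'x \<Rightarrow> bool) \<Rightarrow> bool" where
  "is_poset A leq \<longleftrightarrow> reflp_on A leq \<and> antisymp_on A leq \<and> transp_on A leq"

definition poset_map ::
    "'x set \<Rightarrow> ('x \<Rightarrow> 'x \<Rightarrow> bool) \<Rightarrow> 'y set \<Rightarrow> ('y \<Rightarrow> 'y \<Rightarrow> bool) \<Rightarrow> ('x \<Rightarrow> 'y) \<Rightarrow> bool" where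
  "poset_map A leA B leB f \<longleftrightarrow> f \<in> A \<rightarrow> B \<and> monotone_on A leA leB f"

definition finite_chains :: "'x set \<Rightarrow> ('x \<Rightarrow> 'x \<Rightarrow> bool) \<Rightarrow> 'x set set" where
  "finite_chains A leq = {C. C \<subseteq> A \<and> finite C \<and> C \<noteq> {} \<and> totalp_on C leq}"

definition geometric_simplex :: "'x set \<Rightarrow> ('x \<Rightarrow> real) set" where
  "geometric_simplex C = {t. (\<forall>x. 0 \<le> t x) \<and> (\<forall>x. x \<notin> C \<longrightarrow> t x = 0) \<and> sum t C = 1}"

text \<open>
  Points of the realization are barycentric coordinate functions. The complexes below may be
  infinite and not locally finite, so the space carries the weak (coherent) topology determined by
  its closed simplices, not the subspace topology of the function space; on a single
  simplex the function space topology is the Euclidean one.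
\<close>

definition realization :: "'x set set \<Rightarrow> ('x \<Rightarrow> real) topology" where
  "realization K = topology (\<lambda>U. U \<subseteq> (\<Union>C\<in>K. geometric_simplex C) \<and>
     (\<forall>C\<in>K. openin (top_of_set (geometric_simplex C)) (U \<inter> geometric_simplex C)))"

lemma openin_realization:
  "openin (realization K) U \<longleftrightarrow> U \<subseteq> (\<Union>C\<in>K. geometric_simplex C) \<and>
     (\<forall>C\<in>K. openin (top_of_set (geometric_simplex C)) (U \<inter> geometric_simplex C))"
proof -
  have "istopology (\<lambda>U. U \<subseteq> (\<Union>C\<in>K. geometric_simplex C) \<and>
     (\<forall>C\<in>K. openin (top_of_set (geometric_simplex C)) (U \<inter> geometric_simplex C)))"
    (is "istopology ?P")
    unfolding istopology_def
  proof (rule conjI; intro allI impI)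
    fix S T assume S: "?P S" and T: "?P T"
    have "openin (top_of_set (geometric_simplex C)) (S \<inter> T \<inter> geometric_simplex C)" if "C \<in> K" for C
    proof -
      have "S \<inter> T \<inter> geometric_simplex C = (S \<inter> geometric_simplex C) \<inter> (T \<inter> geometric_simplex C)"
        by blast
      then show ?thesis using S T that by (auto intro: openin_Int)
    qed
    then show "?P (S \<inter> T)" using S by blast
  next
    fix \<K> assume K: "\<forall>U\<in>\<K>. ?P U"
    have "openin (top_of_set (geometric_simplex C)) (\<Union>\<K> \<inter> geometric_simplex C)" if "C \<in> K" for C
    proof -
      have "\<Union>\<K> \<inter> geometric_simplex C = (\<Union>U\<in>\<K>. U \<inter> geometric_simplex C)"
        by blast
      moreover have "openin (top_of_set (geometric_simplex C))
          (\<Union>U\<in>\<K>. U \<inter> geometric_simplex C)"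
        using K that by (intro openin_Union) blast
      ultimately show ?thesis by simp
    qed
    then show "?P (\<Union>\<K>)" using K by blast
  qed
  then show ?thesis by (simp add: realization_def)
qed

text \<open>The simplicial map induced by a vertex map: coordinates are added up along fibres.\<close>

definition realization_map :: "('x \<Rightarrow> 'y) \<Rightarrow> ('x \<Rightarrow> real) \<Rightarrow> ('y \<Rightarrow> real)" where
  "realization_map f t = (\<lambda>y. \<Sum>x | t x \<noteq> 0 \<and> f x = y. t x)"

definition homotopy_equivalence_map :: "'p topology \<Rightarrow> 'q topology \<Rightarrow> ('p \<Rightarrow> 'q) \<Rightarrow> bool" where
  "homotopy_equivalence_map X Y f \<longleftrightarrow> continuous_map X Y f \<and>
     (\<exists>g. continuous_map Y X g \<and>
          homotopic_with (\<lambda>_. True) X X (g \<circ> f) id \<and>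
          homotopic_with (\<lambda>_. True) Y Y (f \<circ> g) id)"

definition poset_homotopy_equivalence ::
    "'x set \<Rightarrow> ('x \<Rightarrow> 'x \<Rightarrow> bool) \<Rightarrow> 'y set \<Rightarrow> ('y \<Rightarrow> 'y \<Rightarrow> bool) \<Rightarrow> ('x \<Rightarrow> 'y) \<Rightarrow> bool" where
  "poset_homotopy_equivalence A leA B leB f \<longleftrightarrow> poset_map A leA B leB f \<and>
     homotopy_equivalence_map (realization (finite_chains A leA)) (realization (finite_chains B leB))
       (realization_map f)"


section \<open>Group actions\<close>

text \<open>The vector space is the whole type \<open>'b\<close> with scalar multiplication \<open>smul\<close>.\<close>

definition GL :: "('a::field \<Rightarrow> 'b::ab_group_add \<Rightarrow> 'b) \<Rightarrow> ('b \<Rightarrow> 'b) monoid" where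
  "GL smul = \<lparr>carrier = {g. Vector_Spaces.linear smul smul g \<and> bij g}, mult = (\<circ>), one = id\<rparr>"

definition fixed_points :: "'g set \<Rightarrow> ('g \<Rightarrow> 'x \<Rightarrow> 'x) \<Rightarrow> 'x set \<Rightarrow> 'x set" where
  "fixed_points H act A = {x \<in> A. \<forall>h\<in>H. act h x = x}"

definition equivariant_on ::
    "'g set \<Rightarrow> ('g \<Rightarrow> 'x \<Rightarrow> 'x) \<Rightarrow> ('g \<Rightarrow> 'y \<Rightarrow> 'y) \<Rightarrow> 'x set \<Rightarrow> ('x \<Rightarrow> 'y) \<Rightarrow> bool" where
  "equivariant_on G actA actB A f \<longleftrightarrow> (\<forall>g\<in>G. \<forall>x\<in>A. f (actA g x) = actB g (f x))"


section \<open>Partial decompositions\<close>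

definition proper_subspaces :: "('a::field \<Rightarrow> 'b::ab_group_add \<Rightarrow> 'b) \<Rightarrow> 'b set set" where
  "proper_subspaces smul = {S. module.subspace smul S \<and> S \<noteq> {0} \<and> S \<noteq> UNIV}"

text \<open>The summation map from the external direct sum of the members onto their span is bijective.\<close>

definition internal_direct_sum :: "('a::field \<Rightarrow> 'b::ab_group_add \<Rightarrow> 'b) \<Rightarrow> 'b set set \<Rightarrow> bool" where
  "internal_direct_sum smul d \<longleftrightarrow>
     bij_betw (\<lambda>v. \<Sum>S\<in>d. v S) (\<Pi>\<^sub>E S\<in>d. S) (module.span smul (\<Union>d))"

definition PD :: "('a::field \<Rightarrow> 'b::ab_group_add \<Rightarrow> 'b) \<Rightarrow> 'b set set set" where
  "PD smul = {d. finite d \<and> d \<noteq> {} \<and> d \<subseteq> proper_subspaces smul \<and> internal_direct_sum smul d}"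

definition FD :: "('a::field \<Rightarrow> 'b::ab_group_add \<Rightarrow> 'b) \<Rightarrow> 'b set set set" where
  "FD smul = {d \<in> PD smul. module.span smul (\<Union>d) = UNIV}"

definition pd_le :: "'b set set \<Rightarrow> 'b set set \<Rightarrow> bool" where
  "pd_le d1 d2 \<longleftrightarrow> (\<forall>S\<in>d1. \<exists>T\<in>d2. S \<subseteq> T)"

definition OPD :: "('a::field \<Rightarrow> 'b::ab_group_add \<Rightarrow> 'b) \<Rightarrow> 'b set list set" where
  "OPD smul = {s. distinct s \<and> set s \<in> PD smul}"

definition OFD :: "('a::field \<Rightarrow> 'b::ab_group_add \<Rightarrow> 'b) \<Rightarrow> 'b set list set" where
  "OFD smul = {s \<in> OPD smul. set s \<in> FD smul}"

definition opd_le :: "'b set list \<Rightarrow> 'b set list \<Rightarrow> bool" where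
  "opd_le s w \<longleftrightarrow> (\<forall>i j. i \<le> j \<and> j < length s \<longrightarrow>
     (\<exists>p l. p \<le> l \<and> l < length w \<and> s ! i \<subseteq> w ! p \<and> s ! j \<subseteq> w ! l))"


section \<open>Gluing with the chains of subspaces\<close>

definition X_Delta :: "('a::field \<Rightarrow> 'b::ab_group_add \<Rightarrow> 'b) \<Rightarrow> 'b set set set" where
  "X_Delta smul = finite_chains (proper_subspaces smul) (\<subseteq>)"

definition is_basis_of :: "('a::field \<Rightarrow> 'b::ab_group_add \<Rightarrow> 'b) \<Rightarrow> 'b set \<Rightarrow> 'b set \<Rightarrow> bool" where
  "is_basis_of smul B W \<longleftrightarrow> \<not> module.dependent smul B \<and> module.span smul B = W"

definition has_common_basis :: "('a::field \<Rightarrow> 'b::ab_group_add \<Rightarrow> 'b) \<Rightarrow> 'b set set \<Rightarrow> bool" where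
  "has_common_basis smul \<W> \<longleftrightarrow>
     (\<exists>B. is_basis_of smul B UNIV \<and> (\<forall>W\<in>\<W>. is_basis_of smul (B \<inter> W) W))"

text \<open>
  The ordered and the unordered constructions differ only in how a decomposition \<open>d\<close> is
  represented; \<open>parts d\<close> is its set of members, so \<open>parts\<close> is \<open>set\<close> for tuples (lists) and
  \<open>id\<close> for sets.
\<close>

fun glued_le ::
    "('a::field \<Rightarrow> 'b::ab_group_add \<Rightarrow> 'b) \<Rightarrow> ('d \<Rightarrow> 'b set set) \<Rightarrow> ('d \<Rightarrow> 'd \<Rightarrow> bool)
      \<Rightarrow> 'b set set + 'd \<Rightarrow> 'b set set + 'd \<Rightarrow> bool" where
  "glued_le smul parts leq (Inl \<sigma>) (Inl \<tau>) \<longleftrightarrow> \<sigma> \<subseteq> \<tau>"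
| "glued_le smul parts leq (Inl \<sigma>) (Inr d) \<longleftrightarrow> has_common_basis smul (\<sigma> \<union> parts d)"
| "glued_le smul parts leq (Inr d) (Inl \<sigma>) \<longleftrightarrow> False"
| "glued_le smul parts leq (Inr d) (Inr e) \<longleftrightarrow> leq d e"

definition PD_Delta ::
    "('a::field \<Rightarrow> 'b::ab_group_add \<Rightarrow> 'b) \<Rightarrow> ('b set set + 'b set set) set" where
  "PD_Delta smul = X_Delta smul <+> FD smul"

definition pd_delta_le ::
    "('a::field \<Rightarrow> 'b::ab_group_add \<Rightarrow> 'b) \<Rightarrow> 'b set set + 'b set set \<Rightarrow> 'b set set + 'b set set \<Rightarrow> bool" where
  "pd_delta_le smul = glued_le smul id pd_le"

definition OPD_Delta ::
    "('a::field \<Rightarrow> 'b::ab_group_add \<Rightarrow> 'b) \<Rightarrow> ('b set set + 'b set list) set" where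
  "OPD_Delta smul = X_Delta smul <+> OFD smul"

definition opd_delta_le ::
    "('a::field \<Rightarrow> 'b::ab_group_add \<Rightarrow> 'b) \<Rightarrow> 'b set set + 'b set list \<Rightarrow> 'b set set + 'b set list \<Rightarrow> bool" where
  "opd_delta_le smul = glued_le smul set opd_le"


section \<open>The actions of the general linear group and the comparison map\<close>

definition act_PD :: "('b \<Rightarrow> 'b) \<Rightarrow> 'b set set \<Rightarrow> 'b set set" where
  "act_PD g d = (\<lambda>S. g ` S) ` d"

definition act_OPD :: "('b \<Rightarrow> 'b) \<Rightarrow> 'b set list \<Rightarrow> 'b set list" where
  "act_OPD g s = map (\<lambda>S. g ` S) s"

definition act_PD_chain :: "('b \<Rightarrow> 'b) \<Rightarrow> 'b set set set \<Rightarrow> 'b set set set" where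
  "act_PD_chain g \<sigma> = act_PD g ` \<sigma>"

definition act_OPD_chain :: "('b \<Rightarrow> 'b) \<Rightarrow> 'b set list set \<Rightarrow> 'b set list set" where
  "act_OPD_chain g \<sigma> = act_OPD g ` \<sigma>"

definition act_PD_Delta :: "('b \<Rightarrow> 'b) \<Rightarrow> 'b set set + 'b set set \<Rightarrow> 'b set set + 'b set set" where
  "act_PD_Delta g = map_sum (\<lambda>\<sigma>. (\<lambda>S. g ` S) ` \<sigma>) (act_PD g)"

definition act_OPD_Delta :: "('b \<Rightarrow> 'b) \<Rightarrow> 'b set set + 'b set list \<Rightarrow> 'b set set + 'b set list" where
  "act_OPD_Delta g = map_sum (\<lambda>\<sigma>. (\<lambda>S. g ` S) ` \<sigma>) (act_OPD g)"

definition phi ::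
    "('a::field \<Rightarrow> 'b::ab_group_add \<Rightarrow> 'b) \<Rightarrow> ('d \<Rightarrow> 'b set set) \<Rightarrow> ('d \<Rightarrow> 'd \<Rightarrow> bool)
      \<Rightarrow> 'd set \<Rightarrow> 'b set set + 'd" where
  "phi smul parts leq \<sigma> =
    (let spn = (\<lambda>s. module.span smul (\<Union>(parts s)));
         \<sigma>0 = {s \<in> \<sigma>. spn s \<noteq> UNIV};
         \<sigma>1 = {s \<in> \<sigma>. spn s = UNIV}
     in if \<sigma>1 = {} then Inl (spn ` \<sigma>0)
        else Inr (THE m. m \<in> \<sigma>1 \<and> (\<forall>s\<in>\<sigma>1. leq s m)))"

definition phi_PD :: "('a::field \<Rightarrow> 'b::ab_group_add \<Rightarrow> 'b) \<Rightarrow> 'b set set set \<Rightarrow> 'b set set + 'b set set" where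
  "phi_PD smul = phi smul id pd_le"

definition phi_OPD :: "('a::field \<Rightarrow> 'b::ab_group_add \<Rightarrow> 'b) \<Rightarrow> 'b set list set \<Rightarrow> 'b set set + 'b set list" where
  "phi_OPD smul = phi smul set opd_le"


section \<open>The relations above are partial orders\<close>

lemma is_poset_subset: "is_poset A (\<subseteq>)"
  by (auto simp: is_poset_def intro!: reflp_onI antisymp_onI transp_onI)

lemma group_GL:
  assumes "vector_space smul"
  shows "group (GL smul)"
proof -
  interpret vector_space smul by fact
  interpret vector_space_pair smul smul by unfold_locales
  show ?thesis
  proof (rule groupI)
    fix g assume "g \<in> carrier (GL smul)"
    then have g: "Vector_Spaces.linear smul smul g" "bij g" by (auto simp: GL_def)
    have lg: "g (x + y) = g x + g y" "g (smul c x) = smul c (g x)" for x y c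
      using g(1) by (simp_all add: Vector_Spaces.linear_iff)
    have "Vector_Spaces.linear smul smul (inv_into UNIV g)"
    proof (unfold Vector_Spaces.linear_iff, intro conjI allI, rule assms, rule assms)
      show "inv_into UNIV g (x + y) = inv_into UNIV g x + inv_into UNIV g y" for x y
        by (metis g bij_inv_eq_iff lg(1))
      show "inv_into UNIV g (smul c x) = smul c (inv_into UNIV g x)" for c x
        by (metis g bij_inv_eq_iff lg(2))
    qed
    then show "\<exists>h\<in>carrier (GL smul). h \<otimes>\<^bsub>GL smul\<^esub> g = \<one>\<^bsub>GL smul\<^esub>"
      using g by (intro bexI[of _ "inv_into UNIV g"]) (auto simp: GL_def bij_imp_bij_inv bij_is_inj)
  qed (auto simp: GL_def linear_id intro: bij_comp Vector_Spaces.linear_compose)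
qed

context
  fixes smul :: "'a::field \<Rightarrow> 'b::ab_group_add \<Rightarrow> 'b"
  assumes vs: "vector_space smul"
begin

interpretation vector_space smul by (fact vs)

lemma PD_D:
  assumes "d \<in> PD smul"
  shows "finite d" "S \<in> d \<Longrightarrow> subspace S" "S \<in> d \<Longrightarrow> S \<noteq> {0}" "S \<in> d \<Longrightarrow> S \<noteq> UNIV"
    "internal_direct_sum smul d"
  using assms by (auto simp: PD_def proper_subspaces_def)

lemma PD_unique:
  assumes "d \<in> PD smul" "\<And>S. S \<in> d \<Longrightarrow> v S \<in> S" "\<And>S. S \<in> d \<Longrightarrow> w S \<in> S"
    "(\<Sum>S\<in>d. v S) = (\<Sum>S\<in>d. w S)" "S \<in> d"
  shows "v S = w S"
proof -
  have "inj_on (\<lambda>v. \<Sum>S\<in>d. v S) (\<Pi>\<^sub>E S\<in>d. S)"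
    using PD_D(5)[OF assms(1)] by (simp add: internal_direct_sum_def bij_betw_def)
  moreover have "(\<Sum>S\<in>d. restrict v d S) = (\<Sum>S\<in>d. restrict w d S)"
    using assms(4) by simp
  moreover have "restrict v d \<in> (\<Pi>\<^sub>E S\<in>d. S)" "restrict w d \<in> (\<Pi>\<^sub>E S\<in>d. S)"
    using assms(2,3) by auto
  ultimately have "restrict v d = restrict w d"
    by (rule inj_onD)
  then show ?thesis using assms(5) by (metis restrict_apply')
qed

lemma PD_disjoint:
  assumes d: "d \<in> PD smul" and ST: "S \<in> d" "T \<in> d" "x \<in> S" "x \<in> T" "x \<noteq> 0"
  shows "S = T"
proof (rule ccontr)
  assume ne: "S \<noteq> T"
  have "(if S = S then x else 0) = (if S = T then x else 0)"
  proof (rule PD_unique[OF d, where v = "\<lambda>R. if R = S then x else 0"])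
    show "(\<Sum>R\<in>d. if R = S then x else 0) = (\<Sum>R\<in>d. if R = T then x else 0)"
      using ST PD_D(1)[OF d] by simp
  qed (use ST PD_D(2)[OF d] in \<open>auto simp: subspace_0\<close>)
  then show False using ne ST by simp
qed

lemma PD_subset_eq:
  assumes d: "d \<in> PD smul" and ST: "S \<in> d" "T \<in> d" "S \<subseteq> T"
  shows "S = T"
proof -
  obtain x where "x \<in> S" "x \<noteq> 0"
    using PD_D(2,3)[OF d ST(1)] subspace_0 by blast
  then show ?thesis using PD_disjoint[OF d] ST by blast
qed

lemma pd_le_antisym:
  assumes "d \<in> PD smul" "e \<in> PD smul" "pd_le d e" "pd_le e d"
  shows "d = e"
proof -
  have "d \<subseteq> e" if dPD: "d \<in> PD smul" and de: "pd_le d e" and ed: "pd_le e d" for d e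
  proof
    fix S assume S: "S \<in> d"
    then obtain T where T: "T \<in> e" "S \<subseteq> T" using de unfolding pd_le_def by blast
    then obtain S' where S': "S' \<in> d" "T \<subseteq> S'" using ed unfolding pd_le_def by blast
    then have "S = S'" using PD_subset_eq[OF dPD] S T by blast
    then show "S \<in> e" using S' T by auto
  qed
  then show ?thesis using assms by blast
qed

lemma pd_le_refl: "pd_le d d"
  unfolding pd_le_def by (meson order.refl)

lemma pd_le_trans: "pd_le c d \<Longrightarrow> pd_le d e \<Longrightarrow> pd_le c e"
  unfolding pd_le_def by (meson order.trans)

lemma is_poset_PD: "is_poset (PD smul) pd_le"
  unfolding is_poset_def
proof (intro conjI)
  show "reflp_on (PD smul) pd_le"
    by (rule reflp_onI) (rule pd_le_refl)
  show "antisymp_on (PD smul) pd_le"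
    by (rule antisymp_onI) (rule pd_le_antisym)
  show "transp_on (PD smul) pd_le"
    by (rule transp_onI) (rule pd_le_trans, assumption+)
qed

lemma opd_le_imp_pd_le: "opd_le s w \<Longrightarrow> pd_le (set s) (set w)"
  unfolding pd_le_def
proof
  fix S assume le: "opd_le s w" and "S \<in> set s"
  then obtain i where i: "i < length s" "s ! i = S" by (auto simp: in_set_conv_nth)
  obtain p l where "p \<le> l" "l < length w" "s ! i \<subseteq> w ! p"
    using le[unfolded opd_le_def, rule_format, of i i] i(1) by blast
  then show "\<exists>T\<in>set w. S \<subseteq> T" using i(2) nth_mem[of p w] by auto
qed

lemma opd_le_antisym:
  assumes s: "s \<in> OPD smul" and w: "w \<in> OPD smul" and le: "opd_le s w" "opd_le w s"
  shows "s = w"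
proof -
  have sw: "set s = set w"
    using pd_le_antisym opd_le_imp_pd_le assms by (auto simp: OPD_def)
  have dist: "distinct s" "distinct w" and dw: "set w \<in> PD smul"
    using s w by (auto simp: OPD_def)
  define f where "f = the_inv_into {..<length w} ((!) w)"
  have inj: "inj_on ((!) w) {..<length w}"
    using dist by (simp add: inj_on_nth)
  have f: "f (w ! p) = p" if "p < length w" for p
    unfolding f_def using that inj by (simp add: the_inv_into_f_f)
  have wf: "f S < length w" "w ! f S = S" if "S \<in> set w" for S
    using that f by (auto simp: in_set_conv_nth)
  have injf: "inj_on f (set w)"
    by (metis inj_onI wf(2))
  have mfe: "map f s = map f w"
  proof (rule sorted_distinct_set_unique)
    show "sorted (map f s)"
      unfolding sorted_iff_nth_mono_less
    proof (intro allI impI)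
      fix i j assume ij: "i < j" "j < length (map f s)"
      then obtain p l where pl: "p \<le> l" "l < length w" "s ! i \<subseteq> w ! p" "s ! j \<subseteq> w ! l"
        using le(1)[unfolded opd_le_def, rule_format, of i j] ij by (metis length_map less_imp_le)
      have si: "s ! i \<in> set w" "s ! j \<in> set w"
        using ij sw nth_mem[of i s] nth_mem[of j s] by simp_all
      have "s ! i = w ! p" "s ! j = w ! l"
        using PD_subset_eq[OF dw si(1) _ pl(3)] PD_subset_eq[OF dw si(2) _ pl(4)] pl(1,2) by simp_all
      then show "map f s ! i \<le> map f s ! j"
        using ij pl(1,2) f by simp
    qed
    have "map f w = [0..<length w]"
      by (rule nth_equalityI) (auto simp: f)
    then show "sorted (map f w)" "distinct (map f w)" by simp_all
    show "distinct (map f s)" using dist injf sw by (simp add: distinct_map)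
    show "set (map f s) = set (map f w)" using sw by simp
  qed
  have "inj_on f (set s \<union> set w)"
    unfolding sw Un_absorb by (rule injf)
  with mfe show ?thesis by (rule map_inj_on)
qed

lemma opd_le_refl: "opd_le s s"
  unfolding opd_le_def
proof (intro allI impI)
  fix i j assume "i \<le> j \<and> j < length s"
  then show "\<exists>p l. p \<le> l \<and> l < length s \<and> s ! i \<subseteq> s ! p \<and> s ! j \<subseteq> s ! l"
    by (intro exI[of _ i] exI[of _ j]) simp
qed

lemma opd_le_trans:
  assumes "opd_le s w" "opd_le w u"
  shows "opd_le s u"
  unfolding opd_le_def
proof (intro allI impI)
  fix i j assume "i \<le> j \<and> j < length s"
  then obtain p l where 1: "p \<le> l \<and> l < length w" "s ! i \<subseteq> w ! p" "s ! j \<subseteq> w ! l"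
    using assms(1) unfolding opd_le_def by blast
  then obtain q m where "q \<le> m" "m < length u" "w ! p \<subseteq> u ! q" "w ! l \<subseteq> u ! m"
    using assms(2) unfolding opd_le_def by blast
  then show "\<exists>q m. q \<le> m \<and> m < length u \<and> s ! i \<subseteq> u ! q \<and> s ! j \<subseteq> u ! m"
    using 1(2,3) order.trans[of "s ! i" "w ! p" "u ! q"] order.trans[of "s ! j" "w ! l" "u ! m"] by auto
qed

lemma is_poset_OPD: "is_poset (OPD smul) opd_le"
  unfolding is_poset_def
proof (intro conjI)
  show "reflp_on (OPD smul) opd_le"
    by (rule reflp_onI) (rule opd_le_refl)
  show "antisymp_on (OPD smul) opd_le"
    by (rule antisymp_onI) (rule opd_le_antisym)
  show "transp_on (OPD smul) opd_le"
    by (rule transp_onI) (rule opd_le_trans, assumption+)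
qed

lemma FD_le_span:
  assumes d: "d \<in> FD smul" and e: "e \<in> PD smul" and le: "pd_le d e" and T: "T \<in> e"
  shows "T \<subseteq> span (\<Union>{S \<in> d. S \<subseteq> T})"
proof
  fix x assume x: "x \<in> T"
  have dPD: "d \<in> PD smul" and "x \<in> span (\<Union>d)" using d by (auto simp: FD_def)
  then obtain v where v: "v \<in> (\<Pi>\<^sub>E S\<in>d. S)" "x = (\<Sum>S\<in>d. v S)"
    using PD_D(5)[OF dPD] by (auto simp: internal_direct_sum_def bij_betw_def)
  obtain c where c: "\<And>S. S \<in> d \<Longrightarrow> c S \<in> e \<and> S \<subseteq> c S"
    using le unfolding pd_le_def by metis
  define y where "y R = (\<Sum>S | S \<in> d \<and> c S = R. v S)" for R
  have "(\<Sum>R\<in>e. y R) = x"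
    unfolding y_def v(2) using c by (intro sum.group PD_D(1)[OF dPD] PD_D(1)[OF e]) auto
  also have "x = (\<Sum>R\<in>e. if R = T then x else 0)"
    using T PD_D(1)[OF e] by simp
  finally have sums: "(\<Sum>R\<in>e. y R) = (\<Sum>R\<in>e. if R = T then x else 0)" .
  have "y R \<in> R" if "R \<in> e" for R
    unfolding y_def using c v by (intro subspace_sum PD_D(2)[OF e that]) (auto dest: PiE_mem)
  moreover have "(if R = T then x else 0) \<in> R" if "R \<in> e" for R
    using x PD_D(2)[OF e that] by (auto simp: subspace_0)
  ultimately have "y T = (if T = T then x else 0)"
    using PD_unique[OF e _ _ sums T] by blast
  then have "x = (\<Sum>S | S \<in> d \<and> c S = T. v S)" by (simp add: y_def)
  also have "\<dots> \<in> span (\<Union>{S \<in> d. S \<subseteq> T})"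
  proof (intro span_sum span_base)
    fix S assume "S \<in> {S \<in> d. c S = T}"
    then have "S \<in> d" "S \<subseteq> T" "v S \<in> S" using c v by (auto dest: PiE_mem)
    then show "v S \<in> \<Union>{S \<in> d. S \<subseteq> T}" by blast
  qed
  finally show "x \<in> span (\<Union>{S \<in> d. S \<subseteq> T})" .
qed

lemma common_basis_mono:
  assumes d: "d \<in> FD smul" and e: "e \<in> PD smul" and le: "pd_le d e"
    and cb: "has_common_basis smul (\<sigma> \<union> d)"
  shows "has_common_basis smul (\<sigma> \<union> e)"
proof -
  obtain B where B: "is_basis_of smul B UNIV" "\<And>W. W \<in> \<sigma> \<union> d \<Longrightarrow> is_basis_of smul (B \<inter> W) W"
    using cb by (auto simp: has_common_basis_def)
  have "is_basis_of smul (B \<inter> T) T" if T: "T \<in> e" for T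
    unfolding is_basis_of_def
  proof (intro conjI equalityI)
    show "independent (B \<inter> T)"
      using B(1) by (meson independent_mono inf_le1 is_basis_of_def)
    show "span (B \<inter> T) \<subseteq> T"
      using PD_D(2)[OF e T] by (simp add: span_minimal)
    have "\<Union>{S \<in> d. S \<subseteq> T} \<subseteq> span (B \<inter> T)"
    proof
      fix x assume "x \<in> \<Union>{S \<in> d. S \<subseteq> T}"
      then obtain S where S: "S \<in> d" "S \<subseteq> T" "x \<in> S" by blast
      then have "x \<in> span (B \<inter> S)" using B(2) by (auto simp: is_basis_of_def)
      then show "x \<in> span (B \<inter> T)"
        using S span_mono by (metis Int_mono order.refl subsetD)
    qed
    then show "T \<subseteq> span (B \<inter> T)"
      using FD_le_span[OF d e le T] by (meson order.trans span_minimal subspace_span)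
  qed
  then show ?thesis using B unfolding has_common_basis_def by blast
qed

lemma is_poset_PD_Delta: "is_poset (PD_Delta smul) (pd_delta_le smul)"
  unfolding is_poset_def pd_delta_le_def PD_Delta_def
proof (intro conjI reflp_onI antisymp_onI transp_onI)
  let ?A = "X_Delta smul <+> FD smul" and ?le = "glued_le smul id pd_le"
  fix x y z
  show "?le x x" by (cases x) (simp_all add: pd_le_refl)
  assume *: "x \<in> ?A" "y \<in> ?A" "?le x y"
  show "x = y" if "?le y x"
    using * that pd_le_antisym by (cases x; cases y) (auto simp: FD_def)
  assume "z \<in> ?A" "?le y z"
  with * show "?le x z"
  proof (cases x; cases y; cases z)
    fix \<sigma> \<tau> d assume "x = Inl \<sigma>" "y = Inl \<tau>" "z = Inr d"
    then show ?thesis using * \<open>?le y z\<close> by (auto simp: has_common_basis_def)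
  next
    fix \<sigma> d e assume "x = Inl \<sigma>" "y = Inr d" "z = Inr e"
    then show ?thesis using * \<open>?le y z\<close> \<open>z \<in> ?A\<close>
      by (auto simp: FD_def intro: common_basis_mono)
  next
    fix d e f assume "x = Inr d" "y = Inr e" "z = Inr f"
    then show ?thesis using * \<open>?le y z\<close> by (auto intro: pd_le_trans)
  qed auto
qed

lemma is_poset_OPD_Delta: "is_poset (OPD_Delta smul) (opd_delta_le smul)"
  unfolding is_poset_def opd_delta_le_def OPD_Delta_def
proof (intro conjI reflp_onI antisymp_onI transp_onI)
  let ?A = "X_Delta smul <+> OFD smul" and ?le = "glued_le smul set opd_le"
  fix x y z
  show "?le x x" by (cases x) (simp_all add: opd_le_refl)
  assume *: "x \<in> ?A" "y \<in> ?A" "?le x y"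
  show "x = y" if "?le y x"
    using * that opd_le_antisym by (cases x; cases y) (auto simp: OFD_def)
  assume "z \<in> ?A" "?le y z"
  with * show "?le x z"
  proof (cases x; cases y; cases z)
    fix \<sigma> \<tau> d assume "x = Inl \<sigma>" "y = Inl \<tau>" "z = Inr d"
    then show ?thesis using * \<open>?le y z\<close> by (auto simp: has_common_basis_def)
  next
    fix \<sigma> d e assume "x = Inl \<sigma>" "y = Inr d" "z = Inr e"
    then show ?thesis using * \<open>?le y z\<close> \<open>z \<in> ?A\<close>
      by (auto simp: OFD_def FD_def intro: common_basis_mono opd_le_imp_pd_le)
  next
    fix d e f assume "x = Inr d" "y = Inr e" "z = Inr f"
    then show ?thesis using * \<open>?le y z\<close> by (auto intro: opd_le_trans)
  qed auto
qed

end

end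

theory Submission
  imports Defs
begin

text \<open>
  The map \<open>\<phi>\<close> is shown to satisfy the hypothesis of Quillen's fibre lemma on the fixed points of any
  group \<open>H\<close> of linear automorphisms: for every \<open>z\<close> in the target, the poset of all chains
  \<open>\<sigma>\<close> with \<open>\<phi> \<sigma> \<le> z\<close> is contractible.

  An automorphism that stabilises a finite chain fixes it pointwise, so the \<open>H\<close>-fixed chains are the
  chains of \<open>H\<close>-fixed decompositions. Moreover \<open>\<phi> \<sigma> \<le> z\<close> is a condition on the single members of
  \<open>\<sigma>\<close> (\<open>phi_le_iff\<close>): a chain of subspaces together with a full decomposition \<open>d\<close> has a common
  basis iff each subspace \<open>W\<close> of the chain is the sum of its intersections with the members of \<open>d\<close>. Hence the
  fibre over \<open>z\<close> is the poset of all finite chains of a subposet \<open>R\<close>, and its realization is the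
  barycentric subdivision of that of \<open>R\<close>. It remains to contract \<open>R\<close>. If \<open>z\<close> is a chain of
  subspaces, then its largest member, viewed as a decomposition with one part, is the greatest
  element of \<open>R\<close>. If \<open>z\<close> is a full decomposition \<open>d\<close>, then cutting the span of \<open>s\<close> with the
  members of \<open>d\<close> gives a poset map \<open>r\<close> from \<open>R\<close> to itself with values below \<open>d\<close>, and a poset map
  \<open>G\<close> with \<open>s \<le> G s \<ge> r s \<le> d\<close> connects the identity with the constant map \<open>d\<close>.

  The topological part establishes the homotopy theory of posets for realizations with the weak
  topology. Comparable poset maps induce homotopic maps (\<open>order_homotopy\<close>). If a contractible space is
  attached to each vertex, monotonically, then maps that send every simplex into the space of its
  greatest vertex exist (\<open>carrier_extension\<close>) and any two of them are homotopic
  (\<open>carried_maps_homotopic\<close>). With the realized fibres as these spaces, this gives the homotopy inverse and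
  both homotopies in \<open>quillen_fibre_lemma\<close>.

  Tuples and sets are treated simultaneously in the locale \<open>decomposition_poset\<close>.
\<close>

section \<open>Continuity on geometric realizations\<close>

lemma closed_geometric_simplex: "closed (geometric_simplex C)"
proof -
  have "geometric_simplex C =
      (\<Inter>x. {t. 0 \<le> t x}) \<inter> (\<Inter>x\<in>-C. {t. t x = 0}) \<inter> {t. sum t C = 1}"
    by (auto simp: geometric_simplex_def)
  moreover have "closed {t::'a \<Rightarrow> real. 0 \<le> t x}" for x
    by (intro closed_Collect_le continuous_intros) simp
  moreover have "closed {t::'a \<Rightarrow> real. t x = 0}" for x
    by (intro closed_Collect_eq continuous_intros) simp
  moreover have "closed {t::'a \<Rightarrow> real. sum t C = 1}"
    by (intro closed_Collect_eq continuous_intros) simp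
  ultimately show ?thesis by (auto intro!: closed_Int closed_INT)
qed

lemma geometric_simplex_le_1: "finite C \<Longrightarrow> t \<in> geometric_simplex C \<Longrightarrow> t x \<le> 1"
  by (cases "x \<in> C") (auto simp: geometric_simplex_def dest: member_le_sum[of x C t])

lemma compact_geometric_simplex:
  assumes "finite C"
  shows "compact (geometric_simplex C)"
proof -
  define J where "J x = (if x \<in> C then {0..1::real} else {0})" for x
  have "compactin (product_topology (\<lambda>_::'a. euclidean) UNIV) (PiE UNIV J)"
    unfolding compactin_PiE by (auto simp: J_def)
  then have "compact (PiE UNIV J)"
    by (simp add: euclidean_product_topology)
  moreover have "geometric_simplex C = geometric_simplex C \<inter> PiE UNIV J"
    using geometric_simplex_le_1[OF assms]
    by (fastforce simp: J_def PiE_def geometric_simplex_def)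
  ultimately show ?thesis
    using closed_geometric_simplex closed_Int_compact by metis
qed

lemma Hausdorff_geometric_simplex: "Hausdorff_space (top_of_set (geometric_simplex C))"
proof -
  have "Hausdorff_space (product_topology (\<lambda>_::'a. euclideanreal) UNIV)"
    by (simp add: Hausdorff_space_product_topology)
  then show ?thesis
    by (simp add: euclidean_product_topology Hausdorff_space_subtopology)
qed

lemma topspace_realization: "topspace (realization K) = (\<Union>C\<in>K. geometric_simplex C)"
proof -
  have "openin (realization K) (\<Union>C\<in>K. geometric_simplex C)"
  proof -
    have "(\<Union>C\<in>K. geometric_simplex C) \<inter> geometric_simplex C = geometric_simplex C" if "C \<in> K" for C
      using that by blast
    then show ?thesis by (simp add: openin_realization)
  qed
  moreover have "topspace (realization K) \<subseteq> (\<Union>C\<in>K. geometric_simplex C)"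
    using openin_realization[of K "topspace (realization K)"] openin_topspace[of "realization K"] by simp
  ultimately show ?thesis
    by (intro equalityI openin_subset)
qed

lemma closed_Int_simplex:
  assumes D: "closedin (realization K) D" and C: "C \<in> K"
  shows "closed (D \<inter> geometric_simplex C)"
proof -
  have "openin (realization K) (topspace (realization K) - D)"
    using D by (simp add: closedin_def)
  then have "openin (top_of_set (geometric_simplex C)) ((topspace (realization K) - D) \<inter> geometric_simplex C)"
    using C openin_realization by blast
  moreover have "D \<inter> geometric_simplex C
      = geometric_simplex C - (topspace (realization K) - D) \<inter> geometric_simplex C"
    using C by (auto simp: topspace_realization)
  ultimately have "closedin (top_of_set (geometric_simplex C)) (D \<inter> geometric_simplex C)"
    by (metis closedin_diff closedin_topspace topspace_euclidean_subtopology)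
  then show ?thesis
    using closed_geometric_simplex closedin_closed_trans by blast
qed

text \<open>
  The weak topology makes it hard to map into a realization; the criterion used here is that on
  finitely many simplices it does not differ from the topology of coordinatewise convergence.
\<close>

lemma continuous_map_into_realization:
  assumes L: "finite L" "L \<subseteq> K"
    and im: "\<And>z. z \<in> topspace Z \<Longrightarrow> \<exists>C\<in>L. f z \<in> geometric_simplex C"
    and cont: "continuous_map Z euclidean f"
  shows "continuous_map Z (realization K) f"
  unfolding continuous_map_closedin
proof (intro conjI allI impI)
  show "f \<in> topspace Z \<rightarrow> topspace (realization K)"
    using im L(2) by (fastforce simp: topspace_realization)
  fix D assume D: "closedin (realization K) D"
  have "{z \<in> topspace Z. f z \<in> D} = (\<Union>C\<in>L. {z \<in> topspace Z. f z \<in> D \<inter> geometric_simplex C})"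
    using im by blast
  moreover have "closedin Z {z \<in> topspace Z. f z \<in> D \<inter> geometric_simplex C}" if "C \<in> L" for C
    using closed_Int_simplex[OF D] L(2) that
    by (intro closedin_continuous_map_preimage[OF cont]) auto
  ultimately show "closedin Z {z \<in> topspace Z. f z \<in> D}"
    using L(1) by (auto intro!: closedin_Union)
qed

lemma continuous_map_from_realization:
  assumes "\<And>C. C \<in> K \<Longrightarrow> continuous_map (top_of_set (geometric_simplex C)) Y f"
  shows "continuous_map (realization K) Y f"
  unfolding continuous_map_def
proof (intro conjI allI impI)
  show "f \<in> topspace (realization K) \<rightarrow> topspace Y"
    using assms by (fastforce simp: topspace_realization continuous_map_def)
  fix U assume "openin Y U"
  then have "openin (top_of_set (geometric_simplex C)) {t \<in> geometric_simplex C. f t \<in> U}" if "C \<in> K" for C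
    using openin_continuous_map_preimage[OF assms[OF that]] by simp
  moreover have "{t \<in> topspace (realization K). f t \<in> U} \<inter> geometric_simplex C
      = {t \<in> geometric_simplex C. f t \<in> U}" if "C \<in> K" for C
    using that by (auto simp: topspace_realization)
  ultimately show "openin (realization K) {t \<in> topspace (realization K). f t \<in> U}"
    by (auto simp: openin_realization topspace_realization)
qed

text \<open>
  The unit interval is compact, so the product with it carries again the weak topology: if \<open>J\<close> is a
  compact neighbourhood of the parameter \<open>s\<close> on which \<open>F (\<cdot>, t)\<close> stays in \<open>U\<close>, then by the tube lemma the
  points \<open>u\<close> with \<open>F (J \<times> {u}) \<subseteq> U\<close> form a relatively open subset of each simplex.
\<close>

lemma continuous_map_from_cylinder:
  assumes F: "\<And>C. C \<in> K \<Longrightarrow>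
      continuous_map (prod_topology (top_of_set {0..1::real}) (top_of_set (geometric_simplex C))) Y F"
  shows "continuous_map (prod_topology (top_of_set {0..1::real}) (realization K)) Y F"
  unfolding continuous_map_def
proof (intro conjI allI impI)
  let ?I = "top_of_set {0..1::real}"
  show "F \<in> topspace (prod_topology ?I (realization K)) \<rightarrow> topspace Y"
    using F by (fastforce simp: topspace_realization continuous_map_def)
  fix U assume U: "openin Y U"
  let ?W = "{p \<in> topspace (prod_topology ?I (realization K)). F p \<in> U}"
  have W_C: "openin (prod_topology ?I (top_of_set (geometric_simplex C)))
      {p \<in> {0..1} \<times> geometric_simplex C. F p \<in> U}" if "C \<in> K" for C
    using openin_continuous_map_preimage[OF F[OF that] U] by simp
  show "openin (prod_topology ?I (realization K)) ?W"
    unfolding openin_prod_topology_alt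
  proof (intro allI impI)
    fix s t assume st: "(s, t) \<in> ?W"
    then obtain C0 where C0: "C0 \<in> K" "t \<in> geometric_simplex C0" and s: "s \<in> {0..1}"
      by (auto simp: topspace_realization)
    have "openin ?I {r \<in> {0..1}. F (r, t) \<in> U}"
    proof -
      have "continuous_map ?I (prod_topology ?I (top_of_set (geometric_simplex C0))) (\<lambda>r. (r, t))"
        using C0 by (intro continuous_map_pairedI) auto
      from openin_continuous_map_preimage[OF this W_C[OF C0(1)]]
      show ?thesis using C0 by (simp cong: conj_cong)
    qed
    then obtain e where e: "e > 0" "\<And>r. r \<in> {0..1} \<Longrightarrow> dist r s < e \<Longrightarrow> F (r, t) \<in> U"
      using s st unfolding openin_euclidean_subtopology_iff by blast
    define J where "J = {0..1} \<inter> cball s (e/2)"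
    have Jt: "F (r, t) \<in> U" if "r \<in> J" for r
      using e that by (auto simp: J_def dist_commute)
    have "compact J" "J \<subseteq> {0..1}" by (auto simp: J_def)
    define V where "V = {u \<in> topspace (realization K). \<forall>r\<in>J. F (r, u) \<in> U}"
    have "openin (realization K) V"
      unfolding openin_realization
    proof (intro conjI ballI)
      show "V \<subseteq> (\<Union>C\<in>K. geometric_simplex C)" by (auto simp: V_def topspace_realization)
      fix C assume C: "C \<in> K"
      let ?S = "top_of_set (geometric_simplex C)"
      let ?M = "{p \<in> J \<times> geometric_simplex C. F p \<in> U}"
      obtain T where T: "open T"
        "{p \<in> {0..1} \<times> geometric_simplex C. F p \<in> U} = {0..1} \<times> geometric_simplex C \<inter> T"
        using W_C[OF C] by (auto simp: openin_open)
      have "p \<in> ?M \<longleftrightarrow> p \<in> J \<times> geometric_simplex C \<inter> T" for p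
        using T(2) \<open>J \<subseteq> {0..1}\<close> by (cases p) (fastforce simp: set_eq_iff)
      then have "?M = J \<times> geometric_simplex C \<inter> T" by blast
      then have "J \<times> geometric_simplex C - ?M = (J \<times> geometric_simplex C) \<inter> - T" by blast
      then have "closedin (top_of_set (J \<times> geometric_simplex C)) (J \<times> geometric_simplex C - ?M)"
        using \<open>open T\<close> by (metis closed_Compl closedin_closed_Int)
      then have "closedin (prod_topology (top_of_set J) ?S) (J \<times> geometric_simplex C - ?M)"
        by simp
      moreover have "closed_map (prod_topology (top_of_set J) ?S) ?S snd"
        using \<open>compact J\<close>
        by (intro Abstract_Topological_Spaces.closed_map_snd)
          (simp add: compact_space_subtopology compactin_euclidean_iff)
      ultimately have "closedin ?S (snd ` (J \<times> geometric_simplex C - ?M))"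
        by (simp add: closed_map_def)
      moreover have "V \<inter> geometric_simplex C
          = geometric_simplex C - snd ` (J \<times> geometric_simplex C - ?M)"
        using C by (auto simp: V_def topspace_realization image_iff Bex_def Ball_def)
      ultimately show "openin ?S (V \<inter> geometric_simplex C)"
        by (simp add: openin_diff)
    qed
    moreover have "openin ?I ({0..1} \<inter> ball s (e/2))" by blast
    moreover have "s \<in> {0..1} \<inter> ball s (e/2)" "t \<in> V"
      using s e(1) C0 Jt by (auto simp: V_def topspace_realization)
    moreover have "({0..1} \<inter> ball s (e/2)) \<times> V \<subseteq> ?W"
      by (auto simp: V_def J_def)
    ultimately show "\<exists>U' V'. openin ?I U' \<and> openin (realization K) V' \<and> s \<in> U' \<and> t \<in> V' \<and> U' \<times> V' \<subseteq> ?W"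
      by blast
  qed
qed

section \<open>Chains in posets\<close>

lemma is_poset_subset_carrier: "is_poset A leq \<Longrightarrow> B \<subseteq> A \<Longrightarrow> is_poset B leq"
  unfolding is_poset_def by (meson reflp_on_subset antisymp_on_subset transp_on_subset)

lemma poset_refl: "is_poset A leq \<Longrightarrow> x \<in> A \<Longrightarrow> leq x x"
  by (simp add: is_poset_def reflp_on_def)

lemma poset_antisym: "is_poset A leq \<Longrightarrow> x \<in> A \<Longrightarrow> y \<in> A \<Longrightarrow> leq x y \<Longrightarrow> leq y x \<Longrightarrow> x = y"
  by (simp add: is_poset_def antisymp_on_def)

lemma poset_trans:
  "is_poset A leq \<Longrightarrow> x \<in> A \<Longrightarrow> y \<in> A \<Longrightarrow> z \<in> A \<Longrightarrow> leq x y \<Longrightarrow> leq y z \<Longrightarrow> leq x z"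
  unfolding is_poset_def transp_on_def by blast

lemma finite_chainsD:
  assumes "C \<in> finite_chains A leq"
  shows "C \<subseteq> A" "finite C" "C \<noteq> {}"
    and "x \<in> C \<Longrightarrow> y \<in> C \<Longrightarrow> x \<noteq> y \<Longrightarrow> leq x y \<or> leq y x"
  using assms by (auto simp: finite_chains_def totalp_on_def)

lemma finite_chains_total:
  "is_poset A leq \<Longrightarrow> C \<in> finite_chains A leq \<Longrightarrow> x \<in> C \<Longrightarrow> y \<in> C \<Longrightarrow> leq x y \<or> leq y x"
  by (metis finite_chainsD(1,4) poset_refl subsetD)

lemma finite_chains_mono: "A \<subseteq> B \<Longrightarrow> finite_chains A leq \<subseteq> finite_chains B leq"
  by (auto simp: finite_chains_def)

lemma finite_chains_nonempty_subset:
  "C \<in> finite_chains A leq \<Longrightarrow> D \<subseteq> C \<Longrightarrow> D \<noteq> {} \<Longrightarrow> D \<in> finite_chains A leq"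
  by (auto simp: finite_chains_def totalp_on_def intro: finite_subset)

lemma finite_chains_has_least:
  assumes A: "is_poset A leq" and C: "C \<in> finite_chains A leq"
  shows "\<exists>m\<in>C. \<forall>x\<in>C. leq m x"
proof -
  have "finite C" "C \<noteq> {}" using C finite_chainsD by blast+
  then have "C \<in> finite_chains A leq \<Longrightarrow> \<exists>m\<in>C. \<forall>x\<in>C. leq m x"
  proof (induction C rule: finite_ne_induct)
    case (singleton x)
    then show ?case using poset_refl[OF A] finite_chainsD(1) by fastforce
  next
    case (insert x F)
    then have F: "F \<in> finite_chains A leq"
      using finite_chains_nonempty_subset by (metis subset_insertI)
    then obtain m where m: "m \<in> F" "\<forall>y\<in>F. leq m y" using insert by blast
    have xA: "insert x F \<subseteq> A" using insert.prems finite_chainsD(1) by blast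
    consider "leq x m" | "leq m x"
      using finite_chains_total[OF A insert.prems, of x m] m by blast
    then show ?case
    proof cases
      case 1
      then have "leq x y" if "y \<in> insert x F" for y
        using that m xA poset_refl[OF A] poset_trans[OF A, of x m y] by blast
      then show ?thesis by blast
    next
      case 2
      then show ?thesis using m by blast
    qed
  qed
  then show ?thesis using C by blast
qed

lemma is_poset_dual:
  assumes "is_poset A leq"
  shows "is_poset A (\<lambda>x y. leq y x)"
  unfolding is_poset_def
proof (intro conjI)
  show "reflp_on A (\<lambda>x y. leq y x)" using poset_refl[OF assms] by (rule reflp_onI)
  show "antisymp_on A (\<lambda>x y. leq y x)" using poset_antisym[OF assms] by (intro antisymp_onI)
  show "transp_on A (\<lambda>x y. leq y x)" using poset_trans[OF assms] by (intro transp_onI)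
qed

lemma finite_chains_dual: "finite_chains A (\<lambda>x y. leq y x) = finite_chains A leq"
proof -
  have "totalp_on C (\<lambda>x y. leq y x) \<longleftrightarrow> totalp_on C leq" for C
    unfolding totalp_on_def by metis
  then show ?thesis
    unfolding finite_chains_def by (intro Collect_cong conj_cong refl)
qed

lemma finite_chains_has_greatest:
  assumes "is_poset A leq" "C \<in> finite_chains A leq"
  shows "\<exists>m\<in>C. \<forall>x\<in>C. leq x m"
  using finite_chains_has_least[OF is_poset_dual[OF assms(1)]] assms(2)
  by (simp add: finite_chains_dual[of A leq])

lemma finite_chains_image:
  assumes A: "is_poset A leA" and f: "poset_map A leA B leB f" and C: "C \<in> finite_chains A leA"
  shows "f ` C \<in> finite_chains B leB"
proof -
  have "leB (f x) (f y) \<or> leB (f y) (f x)" if "x \<in> C" "y \<in> C" for x y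
    using finite_chains_total[OF A C that] f that finite_chainsD(1)[OF C]
    unfolding poset_map_def monotone_on_def by blast
  then show ?thesis
    using f finite_chainsD(1-3)[OF C] by (auto simp: finite_chains_def totalp_on_def poset_map_def)
qed

section \<open>Comparable poset maps are homotopic\<close>

lemma continuous_map_simplex_inclusion:
  assumes "C \<in> K" shows "continuous_map (top_of_set (geometric_simplex C)) (realization K) (\<lambda>t. t)"
  by (rule continuous_map_into_realization[of "{C}"]) (use assms in auto)

lemma support_subset: "t \<in> geometric_simplex C \<Longrightarrow> {x. t x \<noteq> 0} \<subseteq> C"
  by (auto simp: geometric_simplex_def)

lemma realization_map_on_simplex:
  assumes "finite C" "t \<in> geometric_simplex C"
  shows "realization_map f t y = (\<Sum>x\<in>C. if f x = y then t x else 0)"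
proof -
  have "(\<Sum>x\<in>C. if f x = y then t x else 0) = (\<Sum>x\<in>{x. t x \<noteq> 0 \<and> f x = y}. t x)"
    using assms support_subset[OF assms(2)]
    by (intro sum.mono_neutral_cong_right) auto
  then show ?thesis by (simp add: realization_map_def)
qed

text \<open>
  The homotopy between \<open>|f|\<close> and \<open>|g|\<close> for \<open>f \<le> g\<close> cannot be the straight line, since the vertices
  \<open>f x\<close> and \<open>g y\<close> of a chain need not be comparable when \<open>y < x\<close>. Instead the topmost part of the
  barycentric mass, of total weight \<open>s\<close>, is sent along \<open>g\<close> and the rest along \<open>f\<close>; this is the
  linear homotopy on the standard triangulation of the prism over a simplex. The formulas refer to
  the support of \<open>t\<close> instead of a simplex containing it, so they agree on common faces by definition.
\<close>

definition mass_below :: "('x \<Rightarrow> 'x \<Rightarrow> bool) \<Rightarrow> 'x set \<Rightarrow> ('x \<Rightarrow> real) \<Rightarrow> 'x \<Rightarrow> real" where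
  "mass_below leq C t x = (\<Sum>y\<in>C. if leq y x then t y else 0)"

definition top_mass :: "('x \<Rightarrow> 'x \<Rightarrow> bool) \<Rightarrow> real \<Rightarrow> ('x \<Rightarrow> real) \<Rightarrow> 'x \<Rightarrow> real" where
  "top_mass leq s t x = max 0 (min (t x) (mass_below leq {y. t y \<noteq> 0} t x - (1 - s)))"

definition prism_map ::
    "('x \<Rightarrow> 'x \<Rightarrow> bool) \<Rightarrow> ('x \<Rightarrow> 'y) \<Rightarrow> ('x \<Rightarrow> 'y) \<Rightarrow> real \<Rightarrow> ('x \<Rightarrow> real) \<Rightarrow> ('y \<Rightarrow> real)" where
  "prism_map leq f g s t y =
     (\<Sum>x | t x \<noteq> 0 \<and> f x = y. t x - top_mass leq s t x) + (\<Sum>x | t x \<noteq> 0 \<and> g x = y. top_mass leq s t x)"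

lemma mass_below_on_simplex:
  assumes "finite C" "t \<in> geometric_simplex C"
  shows "mass_below leq {y. t y \<noteq> 0} t x = mass_below leq C t x"
  unfolding mass_below_def using assms support_subset[OF assms(2)]
  by (intro sum.mono_neutral_cong_left) auto

lemma top_mass_on_simplex:
  assumes "finite C" "t \<in> geometric_simplex C"
  shows "top_mass leq s t x = max 0 (min (t x) (mass_below leq C t x - (1 - s)))"
  by (simp add: top_mass_def mass_below_on_simplex[OF assms])

lemma prism_map_on_simplex:
  assumes "finite C" "t \<in> geometric_simplex C"
  shows "prism_map leq f g s t y = (\<Sum>x\<in>C. if f x = y then t x - top_mass leq s t x else 0)
    + (\<Sum>x\<in>C. if g x = y then top_mass leq s t x else 0)"
proof -
  have *: "(\<Sum>x | t x \<noteq> 0 \<and> h x = y. w x) = (\<Sum>x\<in>C. if h x = y then w x else 0)"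
    if "\<And>x. t x = 0 \<Longrightarrow> w x = 0" for h :: "'a \<Rightarrow> 'b" and w
    using assms support_subset[OF assms(2)] that
    by (intro sum.mono_neutral_cong_left) auto
  show ?thesis
    unfolding prism_map_def by (subst (1 2) *) (auto simp: top_mass_def)
qed

lemma sum_fibres:
  fixes w :: "'x \<Rightarrow> real"
  assumes "finite C" "finite D" "\<And>x. x \<in> C \<Longrightarrow> f x \<notin> D \<Longrightarrow> w x = 0"
  shows "(\<Sum>y\<in>D. \<Sum>x\<in>C. if f x = y then w x else 0) = (\<Sum>x\<in>C. w x)"
proof -
  have "(\<Sum>y\<in>D. \<Sum>x\<in>C. if f x = y then w x else 0) = (\<Sum>x\<in>C. \<Sum>y\<in>D. if f x = y then w x else 0)"
    by (rule sum.swap)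
  also have "\<dots> = (\<Sum>x\<in>C. w x)"
    using assms by (intro sum.cong) (auto simp: sum.delta)
  finally show ?thesis .
qed

lemma prism_map_in_simplex:
  assumes A: "is_poset A leq" and C: "C \<in> finite_chains A leq"
    and t: "t \<in> geometric_simplex C" and s: "s \<in> {0..1}"
  shows "\<exists>x\<in>C. prism_map leq f g s t \<in> geometric_simplex (f ` {y \<in> C. leq y x} \<union> g ` {y \<in> C. leq x y})"
proof -
  note fin = finite_chainsD(2)[OF C]
  note CA = finite_chainsD(1)[OF C]
  have t0: "0 \<le> t x" for x using t by (simp add: geometric_simplex_def)
  have t1: "sum t C = 1" using t by (simp add: geometric_simplex_def)
  let ?u = "top_mass leq s t"
  have u: "0 \<le> ?u x" "?u x \<le> t x" for x using t0 by (auto simp: top_mass_def)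
  define E where "E = {x \<in> C. 1 - s \<le> mass_below leq C t x}"
  obtain m where m: "m \<in> C" "\<forall>x\<in>C. leq x m" using finite_chains_has_greatest[OF A C] by blast
  have "mass_below leq C t m = sum t C"
    unfolding mass_below_def using m by (intro sum.cong) auto
  then have "mass_below leq C t m = 1" using t1 by simp
  then have "m \<in> E" using m s by (simp add: E_def)
  then have "E \<in> finite_chains A leq"
    by (intro finite_chains_nonempty_subset[OF C]) (auto simp: E_def)
  \<comment> \<open>The mass is split at the vertex \<open>x\<close> where the amount counted from below first reaches \<open>1 - s\<close>:
    vertices under \<open>x\<close> move only along \<open>f\<close>, those above \<open>x\<close> only along \<open>g\<close>.\<close>
  then obtain x where x: "x \<in> E" "\<forall>y\<in>E. leq x y"
    using finite_chains_has_least[OF A] by blast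
  have xC: "x \<in> C" using x by (simp add: E_def)
  have low: "?u y = 0" if "y \<in> C" "\<not> leq x y" for y
  proof -
    have "y \<notin> E" using x that by blast
    then have "mass_below leq C t y < 1 - s" using that by (simp add: E_def)
    then show ?thesis using t0[of y] by (simp add: top_mass_on_simplex[OF fin t])
  qed
  have high: "?u y = t y" if "y \<in> C" "\<not> leq y x" for y
  proof -
    have xy: "leq x y" using finite_chains_total[OF A C xC that(1)] that(2) by blast
    have "mass_below leq C t x + t y = (\<Sum>z\<in>C. (if leq z x then t z else 0) + (if z = y then t y else 0))"
      using that(1) fin by (simp add: mass_below_def sum.distrib)
    also have "\<dots> \<le> mass_below leq C t y"
      unfolding mass_below_def
    proof (rule sum_mono)
      fix z assume z: "z \<in> C"
      have "leq z y" if "leq z x" using poset_trans[OF A, of z x y] that xy z xC \<open>y \<in> C\<close> CA by blast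
      moreover have "leq y y" using poset_refl[OF A] \<open>y \<in> C\<close> CA by blast
      ultimately show "(if leq z x then t z else 0) + (if z = y then t y else 0) \<le> (if leq z y then t z else 0)"
        using t0[of z] \<open>\<not> leq y x\<close> by auto
    qed
    finally have "t y \<le> mass_below leq C t y - (1 - s)" using x by (simp add: E_def)
    then show ?thesis using t0[of y] by (simp add: top_mass_on_simplex[OF fin t])
  qed
  let ?D = "f ` {y \<in> C. leq y x} \<union> g ` {y \<in> C. leq x y}"
  have finD: "finite ?D" using fin by simp
  have Df: "?u y = t y" if "y \<in> C" "f y \<notin> ?D" for y using high[OF that(1)] that by blast
  have Dg: "?u y = 0" if "y \<in> C" "g y \<notin> ?D" for y using low[OF that(1)] that by blast
  have "sum (prism_map leq f g s t) ?D = (\<Sum>x\<in>C. t x - ?u x) + (\<Sum>x\<in>C. ?u x)"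
    unfolding prism_map_on_simplex[OF fin t] sum.distrib
    by (intro arg_cong2[where f = "(+)"] sum_fibres fin finD) (simp_all add: Df Dg del: Un_iff)
  also have "\<dots> = 1" using t1 by (simp add: sum_subtractf)
  finally have "sum (prism_map leq f g s t) ?D = 1" .
  moreover have "prism_map leq f g s t y = 0" if "y \<notin> ?D" for y
  proof -
    have "(\<Sum>x\<in>C. if f x = y then t x - ?u x else 0) = 0"
      using that by (intro sum.neutral) (auto simp: Df simp del: Un_iff)
    moreover have "(\<Sum>x\<in>C. if g x = y then ?u x else 0) = 0"
      using that by (intro sum.neutral) (auto simp: Dg simp del: Un_iff)
    ultimately show ?thesis unfolding prism_map_on_simplex[OF fin t] by simp
  qed
  moreover have "0 \<le> prism_map leq f g s t y" for y
    unfolding prism_map_def using u t0 by (intro add_nonneg_nonneg sum_nonneg) auto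
  ultimately have "prism_map leq f g s t \<in> geometric_simplex ?D" by (simp add: geometric_simplex_def)
  then show ?thesis using xC by blast
qed

lemma prism_map_ends:
  assumes A: "is_poset A leq" and C: "C \<in> finite_chains A leq" and t: "t \<in> geometric_simplex C"
  shows "prism_map leq f g 0 t = realization_map f t" "prism_map leq f g 1 t = realization_map g t"
proof -
  note fin = finite_chainsD(2)[OF C]
  have t0: "0 \<le> t x" for x using t by (simp add: geometric_simplex_def)
  have t1: "sum t C = 1" using t by (simp add: geometric_simplex_def)
  have mb: "mass_below leq C t x \<le> 1" for x
    unfolding mass_below_def t1[symmetric] using t0 by (intro sum_mono) auto
  have 0: "top_mass leq 0 t x = 0" for x
    using t0[of x] mb[of x] by (simp add: top_mass_on_simplex[OF fin t] min_def max_def)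
  have 1: "top_mass leq 1 t x = t x" for x
  proof (cases "x \<in> C")
    case True
    then have "leq x x" using poset_refl[OF A] finite_chainsD(1)[OF C] by blast
    then have "t x = (\<Sum>y\<in>{x}. if leq y x then t y else 0)" by simp
    also have "\<dots> \<le> mass_below leq C t x"
      unfolding mass_below_def using True fin t0 by (intro sum_mono2) auto
    finally show ?thesis using t0[of x] by (simp add: top_mass_on_simplex[OF fin t])
  qed (use t in \<open>simp add: geometric_simplex_def top_mass_def\<close>)
  show "prism_map leq f g 0 t = realization_map f t" "prism_map leq f g 1 t = realization_map g t"
    by (auto simp: fun_eq_iff prism_map_def realization_map_def 0 1)
qed

theorem order_homotopy:
  assumes A: "is_poset A leA" and B: "is_poset B leB"
    and f: "poset_map A leA B leB f" and g: "poset_map A leA B leB g"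
    and fg: "\<And>x. x \<in> A \<Longrightarrow> leB (f x) (g x)"
  shows "homotopic_with (\<lambda>_. True) (realization (finite_chains A leA)) (realization (finite_chains B leB))
      (realization_map f) (realization_map g)"
proof (subst homotopic_with)
  let ?H = "\<lambda>(s, t). prism_map leA f g s t"
  have "continuous_map (prod_topology (top_of_set {0..1::real}) (realization (finite_chains A leA)))
      (realization (finite_chains B leB)) ?H"
  proof (rule continuous_map_from_cylinder)
    fix C assume C: "C \<in> finite_chains A leA"
    note fin = finite_chainsD(2)[OF C]
    note CA = finite_chainsD(1)[OF C]
    let ?D = "\<lambda>x. f ` {y \<in> C. leA y x} \<union> g ` {y \<in> C. leA x y}"
    let ?Z = "{0..1::real} \<times> geometric_simplex C"
    \<comment> \<open>The vertices \<open>f y\<close> and \<open>g z\<close> of \<open>?D x\<close> are comparable because \<open>f y \<le> g y \<le> g z\<close> for \<open>y \<le> x \<le> z\<close>.\<close>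
    have "?D x \<in> finite_chains B leB" if x: "x \<in> C" for x
    proof -
      have ne: "leA x x" using x poset_refl[OF A] CA by blast
      have "?D x \<subseteq> B" using f g CA unfolding poset_map_def by blast
      moreover have "leB p q \<or> leB q p" if "p \<in> ?D x" "q \<in> ?D x" for p q
      proof -
        have mon: "leB (f y) (f z)" "leB (g y) (g z)" if "y \<in> C" "z \<in> C" "leA y z" for y z
          using f g that CA unfolding poset_map_def monotone_on_def by blast+
        have fgm: "leB (f y) (g z)" if "y \<in> C" "z \<in> C" "leA y x" "leA x z" for y z
        proof -
          have "leA y z" using poset_trans[OF A, of y x z] that x CA by blast
          then have "leB (g y) (g z)" using mon that by blast
          moreover have "leB (f y) (g y)" "f y \<in> B" "g y \<in> B" "g z \<in> B"
            using fg f g that CA unfolding poset_map_def by blast+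
          ultimately show ?thesis using poset_trans[OF B] by blast
        qed
        consider y z where "y \<in> C" "z \<in> C" "p = f y" "q = f z" | y z where "y \<in> C" "z \<in> C" "p = g y" "q = g z"
          | y z where "y \<in> C" "z \<in> C" "leA y x" "leA x z" "p = f y" "q = g z"
          | y z where "y \<in> C" "z \<in> C" "leA y x" "leA x z" "q = f y" "p = g z"
          using \<open>p \<in> ?D x\<close> \<open>q \<in> ?D x\<close> by blast
        then show ?thesis
          by cases (use mon fgm finite_chains_total[OF A C] in blast)+
      qed
      ultimately show ?thesis
        using fin x ne by (auto simp: finite_chains_def totalp_on_def)
    qed
    then have "?D ` C \<subseteq> finite_chains B leB" by blast
    moreover have "\<exists>E\<in>?D ` C. ?H z \<in> geometric_simplex E" if "z \<in> ?Z" for z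
      using prism_map_in_simplex[OF A C, of "snd z" "fst z" f g] that by (auto simp: case_prod_beta)
    moreover have "continuous_on ?Z ?H"
    proof (rule continuous_on_coordinatewise_then_product)
      fix y
      have proj: "continuous_on ?Z (\<lambda>z. snd z x)" for x
        using continuous_on_product_then_coordinatewise[OF continuous_on_snd[OF continuous_on_id]] .
      have "continuous_on ?Z (\<lambda>z. (\<Sum>x\<in>C. if f x = y then snd z x - max 0 (min (snd z x) (mass_below leA C (snd z) x - (1 - fst z))) else 0)
         + (\<Sum>x\<in>C. if g x = y then max 0 (min (snd z x) (mass_below leA C (snd z) x - (1 - fst z))) else 0))"
      proof -
        have "continuous_on ?Z (\<lambda>z. mass_below leA C (snd z) x)" for x
          unfolding mass_below_def
        proof (intro continuous_on_sum)
          show "continuous_on ?Z (\<lambda>z. if leA i x then snd z i else 0)" for i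
            using proj by (cases "leA i x") auto
        qed
        then have u: "continuous_on ?Z (\<lambda>z. max 0 (min (snd z x) (mass_below leA C (snd z) x - (1 - fst z))))" for x
          by (intro continuous_intros proj)
        have if_cont: "continuous_on ?Z (\<lambda>z. if P then w z else 0)" if "continuous_on ?Z w" for P and w :: "real \<times> ('a \<Rightarrow> real) \<Rightarrow> real"
          using that by (cases P) auto
        show ?thesis
          by (intro continuous_on_add continuous_on_sum if_cont continuous_on_diff proj u)
      qed
      then show "continuous_on ?Z (\<lambda>z. ?H z y)"
        by (rule continuous_on_eq)
          (auto simp: prism_map_on_simplex[OF fin] top_mass_on_simplex[OF fin] cong: if_cong)
    qed
    ultimately show "continuous_map (prod_topology (top_of_set {0..1::real}) (top_of_set (geometric_simplex C)))
      (realization (finite_chains B leB)) ?H"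
      using fin by (intro continuous_map_into_realization[of "?D ` C"]) auto
  qed
  then show "\<exists>h. continuous_map (prod_topology (top_of_set {0..1::real}) (realization (finite_chains A leA)))
         (realization (finite_chains B leB)) h \<and>
        (\<forall>x\<in>topspace (realization (finite_chains A leA)). h (0, x) = realization_map f x) \<and>
        (\<forall>x\<in>topspace (realization (finite_chains A leA)). h (1, x) = realization_map g x) \<and>
        (\<forall>t\<in>{0..1}. True)"
    by (intro exI[of _ ?H]) (auto simp: topspace_realization prism_map_ends[OF A])
qed simp

corollary continuous_realization_map:
  assumes "is_poset A leA" "is_poset B leB" "poset_map A leA B leB f"
  shows "continuous_map (realization (finite_chains A leA)) (realization (finite_chains B leB)) (realization_map f)"
proof -
  have "leB (f x) (f x)" if "x \<in> A" for x
    using assms that poset_refl[OF assms(2)] unfolding poset_map_def by blast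
  from order_homotopy[OF assms(1,2,3,3) this] show ?thesis
    using homotopic_with_imp_continuous_maps by blast
qed

section \<open>Contractible carriers\<close>

text \<open>
  A space \<open>Y x\<close> is attached to each vertex, growing along the order. Since only the
  greatest vertex of a simplex decides where the simplex has to go, a carried map can be built up one
  vertex at a time, and no extension over the boundary of a simplex has to be chosen.
\<close>

definition carried ::
    "'x set \<Rightarrow> ('x \<Rightarrow> 'x \<Rightarrow> bool) \<Rightarrow> ('x \<Rightarrow> 'p topology) \<Rightarrow> (('x \<Rightarrow> real) \<Rightarrow> 'p) \<Rightarrow> bool" where
  "carried A leq Y g \<longleftrightarrow> (\<forall>C\<in>finite_chains A leq. \<forall>m\<in>C. (\<forall>x\<in>C. leq x m) \<longrightarrow>
     continuous_map (top_of_set (geometric_simplex C)) (Y m) g)"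

definition greatest_of :: "('x \<Rightarrow> 'x \<Rightarrow> bool) \<Rightarrow> 'x set \<Rightarrow> 'x" where
  "greatest_of leq S = (THE m. m \<in> S \<and> (\<forall>x\<in>S. leq x m))"

lemma greatest_of_eq:
  assumes "is_poset A leq" "S \<subseteq> A" "m \<in> S" "\<And>x. x \<in> S \<Longrightarrow> leq x m"
  shows "greatest_of leq S = m"
  unfolding greatest_of_def
proof (rule the_equality)
  show "m \<in> S \<and> (\<forall>x\<in>S. leq x m)" using assms(3,4) by simp
  show "k = m" if "k \<in> S \<and> (\<forall>x\<in>S. leq x k)" for k
    using that assms(2-4) by (intro poset_antisym[OF assms(1)]) auto
qed

text \<open>
  Projection from the vertex \<open>m\<close> to the opposite face. At the vertex itself, division by zero makes
  it the zero function; the constructions below discard the projection in that case.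
\<close>

definition link_point :: "'x \<Rightarrow> ('x \<Rightarrow> real) \<Rightarrow> 'x \<Rightarrow> real" where
  "link_point m t x = (if x = m then 0 else t x / (1 - t m))"

text \<open>
  With \<open>h x\<close> a contraction of \<open>Y x\<close> (identity at time \<open>0\<close>, constant at time \<open>1\<close>), the value at
  \<open>(1 - \<lambda>) t' + \<lambda> m\<close>, where \<open>m\<close> is the greatest vertex, is obtained by moving the value at \<open>t'\<close> for
  the time \<open>\<lambda>\<close> along \<open>h m\<close>. The natural number is the number of vertices in the support, which drops
  by one in each step.
\<close>

primrec cone_rec :: "('x \<Rightarrow> 'x \<Rightarrow> bool) \<Rightarrow> 'x set \<Rightarrow> (('x \<Rightarrow> real) \<Rightarrow> 'p) \<Rightarrow> ('x \<Rightarrow> real \<times> 'p \<Rightarrow> 'p)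
    \<Rightarrow> nat \<Rightarrow> ('x \<Rightarrow> real) \<Rightarrow> 'p" where
  "cone_rec leq B a h 0 t = undefined"
| "cone_rec leq B a h (Suc n) t =
    (if {x. t x \<noteq> 0} \<subseteq> B then a t
     else h (greatest_of leq {x. t x \<noteq> 0}) (t (greatest_of leq {x. t x \<noteq> 0}),
       cone_rec leq B a h n (link_point (greatest_of leq {x. t x \<noteq> 0}) t)))"

definition cone_extension :: "('x \<Rightarrow> 'x \<Rightarrow> bool) \<Rightarrow> 'x set \<Rightarrow> (('x \<Rightarrow> real) \<Rightarrow> 'p)
    \<Rightarrow> ('x \<Rightarrow> real \<times> 'p \<Rightarrow> 'p) \<Rightarrow> ('x \<Rightarrow> real) \<Rightarrow> 'p" where
  "cone_extension leq B a h t = cone_rec leq B a h (card {x. t x \<noteq> 0}) t"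

lemma simplexD:
  assumes "t \<in> geometric_simplex C"
  shows "0 \<le> t x" "x \<notin> C \<Longrightarrow> t x = 0" "sum t C = 1"
  using assms by (auto simp: geometric_simplex_def)

lemma support_nonempty:
  assumes "t \<in> geometric_simplex C"
  shows "{x. t x \<noteq> 0} \<noteq> {}"
proof
  assume "{x. t x \<noteq> 0} = {}"
  then have "sum t C = 0" by (intro sum.neutral) auto
  then show False using simplexD(3)[OF assms] by simp
qed

lemma simplex_vertex_1:
  assumes "finite C" "t \<in> geometric_simplex C" "t m = 1" "x \<noteq> m"
  shows "t x = 0"
proof (rule ccontr)
  assume "t x \<noteq> 0"
  then have "x \<in> C" "m \<in> C" using assms simplexD(2)[OF assms(2)] by fastforce+
  then have "t x + t m \<le> sum t C"
    using assms(1,4) simplexD(1)[OF assms(2)] sum_mono2[of C "{x, m}" t] by simp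
  then show False
    using \<open>t x \<noteq> 0\<close> assms(3) simplexD(1,3)[OF assms(2)] by (smt (verit))
qed

lemma link_point_in_simplex:
  assumes "finite C" "t \<in> geometric_simplex C" "t m \<noteq> 1" "m \<in> C"
  shows "link_point m t \<in> geometric_simplex (C - {m})"
proof -
  have "t m \<le> 1" using geometric_simplex_le_1[OF assms(1,2)] .
  then have m: "t m < 1" using assms(3) by simp
  have "sum (link_point m t) (C - {m}) = (\<Sum>x\<in>C - {m}. t x / (1 - t m))"
    by (intro sum.cong) (auto simp: link_point_def)
  also have "\<dots> = (sum t C - t m) / (1 - t m)"
    using assms(1,4) by (simp add: sum_divide_distrib[symmetric] sum_diff1)
  also have "\<dots> = 1" using m simplexD(3)[OF assms(2)] by simp
  finally show ?thesis
    using m simplexD(1,2)[OF assms(2)] by (simp add: geometric_simplex_def link_point_def)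
qed

lemma cone_extension_eq:
  assumes A: "is_poset A leq" and C: "C \<in> finite_chains A leq" and t: "t \<in> geometric_simplex C"
    and m: "t m \<noteq> 0" "\<And>x. t x \<noteq> 0 \<Longrightarrow> leq x m"
  shows "cone_extension leq B a h t = (if {x. t x \<noteq> 0} \<subseteq> B then a t
     else h m (t m, cone_extension leq B a h (link_point m t)))"
proof -
  note fin = finite_chainsD(2)[OF C]
  have finS: "finite {x. t x \<noteq> 0}" using finite_subset[OF support_subset[OF t] fin] .
  have "{x. t x \<noteq> 0} \<subseteq> A" using support_subset[OF t] finite_chainsD(1)[OF C] by blast
  then have g: "greatest_of leq {x. t x \<noteq> 0} = m" using m by (intro greatest_of_eq[OF A]) auto
  have "{x. link_point m t x \<noteq> 0} = {x. t x \<noteq> 0} - {m}"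
  proof (cases "t m = 1")
    case True
    then show ?thesis using simplex_vertex_1[OF fin t] by (auto simp: link_point_def)
  qed (auto simp: link_point_def)
  then have card_link: "card {x. t x \<noteq> 0} = Suc (card {x. link_point m t x \<noteq> 0})"
    using finS m(1) card_Suc_Diff1[of "{x. t x \<noteq> 0}" m] by simp
  show ?thesis
    by (simp only: cone_extension_def card_link cone_rec.simps g)
qed

text \<open>
  Continuity is proved by induction on the number of vertices of a simplex. A simplex with
  greatest vertex \<open>m\<close> and opposite face \<open>F\<close> is the quotient of \<open>[0, 1] \<times> F\<close> that collapses the end at
  time \<open>1\<close>, and the contraction \<open>h m\<close> is constant at time \<open>1\<close>. Down-closedness of \<open>B\<close> guarantees that once
  the greatest vertex lies in \<open>B\<close>, the whole simplex does.
\<close>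

theorem carrier_extension:
  assumes A: "is_poset A leq"
    and B: "B \<subseteq> A" "\<And>x y. x \<in> A \<Longrightarrow> y \<in> B \<Longrightarrow> leq x y \<Longrightarrow> x \<in> B"
    and contr: "\<And>x. x \<in> A \<Longrightarrow> contractible_space (Y x)"
    and ne: "\<And>x. x \<in> A \<Longrightarrow> topspace (Y x) \<noteq> {}"
    and incl: "\<And>x y. x \<in> A \<Longrightarrow> y \<in> A \<Longrightarrow> leq x y \<Longrightarrow> continuous_map (Y x) (Y y) (\<lambda>p. p)"
    and a: "carried B leq Y a"
  obtains g where "carried A leq Y g"
    "\<And>C t. C \<in> finite_chains B leq \<Longrightarrow> t \<in> geometric_simplex C \<Longrightarrow> g t = a t"
proof -
  let ?I = "top_of_set {0..1::real}"
  have "\<exists>h c. continuous_map (prod_topology ?I (Y x)) (Y x) h \<and> (\<forall>p. h (0, p) = p) \<and>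
      (\<forall>p. h (1, p) = c)" if "x \<in> A" for x
    using contr[OF that] unfolding contractible_space_def homotopic_with_def id_def by blast
  then obtain h c where h: "\<And>x. x \<in> A \<Longrightarrow> continuous_map (prod_topology ?I (Y x)) (Y x) (h x)"
      "\<And>x p. x \<in> A \<Longrightarrow> h x (0, p) = p" "\<And>x p. x \<in> A \<Longrightarrow> h x (1, p) = c x"
    by metis
  define g where "g = cone_extension leq B a h"
  have g_base: "g t = a t" if C: "C \<in> finite_chains A leq" and t: "t \<in> geometric_simplex C"
    and sB: "{x. t x \<noteq> 0} \<subseteq> B" for C t
  proof -
    have "{x. t x \<noteq> 0} \<noteq> {}" by (rule support_nonempty[OF t])
    then have "{x. t x \<noteq> 0} \<in> finite_chains A leq"
      using finite_chains_nonempty_subset[OF C support_subset[OF t]] by blast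
    then obtain m where m: "t m \<noteq> 0" "\<And>x. t x \<noteq> 0 \<Longrightarrow> leq x m"
      using finite_chains_has_greatest[OF A] by blast
    have "g t = (if {x. t x \<noteq> 0} \<subseteq> B then a t else h m (t m, g (link_point m t)))"
      unfolding g_def using m by (rule cone_extension_eq[OF A C t])
    then show ?thesis using sB by simp
  qed
  have "continuous_map (top_of_set (geometric_simplex C)) (Y m) g"
    if "C \<in> finite_chains A leq" "m \<in> C" "\<And>x. x \<in> C \<Longrightarrow> leq x m" for C m
    using that
  proof (induction "card C" arbitrary: C m rule: less_induct)
    case less
    note C = \<open>C \<in> finite_chains A leq\<close>
    note fin = finite_chainsD(2)[OF C]
    note CA = finite_chainsD(1)[OF C]
    have mA: "m \<in> A" using CA \<open>m \<in> C\<close> by blast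
    show ?case
    proof (cases "m \<in> B")
      case True
      then have CB: "C \<subseteq> B" using B(2) less.prems(3) CA by blast
      then have "C \<in> finite_chains B leq" using C by (simp add: finite_chains_def)
      then have "continuous_map (top_of_set (geometric_simplex C)) (Y m) a"
        using a less.prems unfolding carried_def by blast
      then show ?thesis
        by (rule continuous_map_eq) (metis C CB g_base order.trans support_subset topspace_euclidean_subtopology)
    next
      case mB: False
      show ?thesis
      proof (cases "C - {m} = {}")
        case True
        obtain p where "p \<in> topspace (Y m)" using ne[OF mA] by blast
        then have "h m (1, p) \<in> topspace (Y m)"
          using continuous_map_image_subset_topspace[OF h(1)[OF mA]] by auto
        then have cY: "c m \<in> topspace (Y m)" using h(3)[OF mA] by simp
        have Cm: "C = {m}" using True \<open>m \<in> C\<close> by blast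
        have g_c: "g t = c m" if t: "t \<in> geometric_simplex C" for t
        proof -
          have tm: "t m = 1" using simplexD(3)[OF t] Cm by simp
          have x: "x = m" if "t x \<noteq> 0" for x using simplexD(2)[OF t] Cm that by blast
          have "leq m m" using poset_refl[OF A mA] .
          then have "g t = (if {x. t x \<noteq> 0} \<subseteq> B then a t else h m (t m, g (link_point m t)))"
            unfolding g_def using tm by (intro cone_extension_eq[OF A C t]) (auto dest: x)
          moreover have "\<not> {x. t x \<noteq> 0} \<subseteq> B"
            using tm mB subsetD[of "{x. t x \<noteq> 0}" B m] by auto
          ultimately have "g t = h m (t m, g (link_point m t))" by simp
          then show ?thesis using h(3)[OF mA] tm by simp
        qed
        have "continuous_map (top_of_set (geometric_simplex C)) (Y m) (\<lambda>_. c m)"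
          using cY by (simp only: continuous_map_const) simp
        then show ?thesis by (rule continuous_map_eq) (simp add: g_c)
      next
        case False
        let ?C = "C - {m}"
        let ?S = "top_of_set (geometric_simplex ?C)"
        \<comment> \<open>The collapsing map from the cylinder over the opposite face onto the simplex.\<close>
        define q where "q z = (\<lambda>x. (1 - fst z) * snd z x + (if x = m then fst z else 0))"
          for z :: "real \<times> ('a \<Rightarrow> real)"
        have C': "?C \<in> finite_chains A leq" using finite_chains_nonempty_subset[OF C _ False] by blast
        then obtain m' where m': "m' \<in> ?C" "\<forall>x\<in>?C. leq x m'" using finite_chains_has_greatest[OF A] by blast
        have m'A: "m' \<in> A" using m' CA by blast
        have "continuous_map ?S (Y m') g"
          using less.hyps[OF _ C' m'(1)] m'(2) fin \<open>m \<in> C\<close> by (meson card_Diff1_less)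
        then have "continuous_map ?S (Y m) ((\<lambda>p. p) \<circ> g)"
          using incl[OF m'A mA less.prems(3)] m'(1) by (intro continuous_map_compose) auto
        then have gS: "continuous_map ?S (Y m) g" by (simp add: o_def)
        have "continuous_map (prod_topology ?I ?S) (prod_topology ?I (Y m)) (\<lambda>z. (fst z, g (snd z)))"
          by (intro continuous_map_pairedI continuous_map_fst continuous_map_compose[OF continuous_map_snd gS, unfolded o_def])
        from continuous_map_compose[OF this h(1)[OF mA]]
        have cont: "continuous_map (prod_topology ?I ?S) (Y m) (\<lambda>z. h m (fst z, g (snd z)))"
          by (simp add: o_def)
        have quot: "quotient_map (prod_topology ?I ?S) (top_of_set (geometric_simplex C)) q"
        proof (rule T1_Spaces.continuous_imp_quotient_map)
          show "compact_space (prod_topology ?I ?S)"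
            using fin by (simp add: compact_space_subtopology compact_geometric_simplex compact_Times)
          show "Hausdorff_space (top_of_set (geometric_simplex C))" by (rule Hausdorff_geometric_simplex)
          have into: "q z \<in> geometric_simplex C" if z: "z \<in> {0..1} \<times> geometric_simplex ?C" for z
          proof -
            have t: "snd z \<in> geometric_simplex ?C" and s: "0 \<le> fst z" "fst z \<le> 1" using z by auto
            have "sum (snd z) C = sum (snd z) ?C"
              using simplexD(2)[OF t] fin by (intro sum.mono_neutral_right) auto
            then have "sum (q z) C = 1"
              using simplexD(3)[OF t] fin \<open>m \<in> C\<close>
              by (simp add: q_def sum.distrib sum_distrib_left[symmetric])
            then show ?thesis
              using s simplexD(1,2)[OF t] \<open>m \<in> C\<close> by (auto simp: geometric_simplex_def q_def)
          qed
          have "continuous_on ({0..1} \<times> geometric_simplex ?C) q"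
          proof (rule continuous_on_coordinatewise_then_product)
            fix x
            have proj: "continuous_on ({0..1::real} \<times> geometric_simplex ?C) (\<lambda>z. snd z x)"
              using continuous_on_product_then_coordinatewise[OF continuous_on_snd[OF continuous_on_id]] .
            have "continuous_on ({0..1::real} \<times> geometric_simplex ?C) (\<lambda>z. if x = m then fst z else 0)"
              by (cases "x = m") (simp_all add: continuous_on_fst)
            then show "continuous_on ({0..1} \<times> geometric_simplex ?C) (\<lambda>z. q z x)"
              unfolding q_def
              by (intro continuous_on_add continuous_on_mult continuous_on_diff continuous_on_const
                  continuous_on_fst continuous_on_id proj)
          qed
          then show "continuous_map (prod_topology ?I ?S) (top_of_set (geometric_simplex C)) q"
            using into by auto
          show "q ` topspace (prod_topology ?I ?S) = topspace (top_of_set (geometric_simplex C))"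
          proof
            show "q ` topspace (prod_topology ?I ?S) \<subseteq> topspace (top_of_set (geometric_simplex C))"
              using into by auto
            show "topspace (top_of_set (geometric_simplex C)) \<subseteq> q ` topspace (prod_topology ?I ?S)"
            proof
              fix t assume "t \<in> topspace (top_of_set (geometric_simplex C))"
              then have t: "t \<in> geometric_simplex C" by simp
              have tm: "t m \<in> {0..1}" using simplexD(1)[OF t] geometric_simplex_le_1[OF fin t] by simp
              show "t \<in> q ` topspace (prod_topology ?I ?S)"
              proof (cases "t m = 1")
                case True
                have "(\<lambda>x. if x = m' then 1 else 0) \<in> geometric_simplex ?C"
                  using m' fin by (auto simp: geometric_simplex_def)
                moreover have "t = q (1, \<lambda>x. if x = m' then 1 else 0)"
                  using simplex_vertex_1[OF fin t True] True by (auto simp: q_def fun_eq_iff)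
                ultimately show ?thesis by (intro image_eqI) auto
              next
                case False
                have "t = q (t m, link_point m t)"
                  using False by (auto simp: q_def link_point_def fun_eq_iff)
                then show ?thesis
                  using link_point_in_simplex[OF fin t False \<open>m \<in> C\<close>] tm by (intro image_eqI) auto
              qed
            qed
          qed
        qed
        have "h m (fst z, g (snd z)) = (g \<circ> q) z" if z: "z \<in> topspace (prod_topology ?I ?S)" for z
        proof -
          obtain s t where st: "z = (s, t)" "s \<in> {0..1}" "t \<in> geometric_simplex ?C"
            using z by auto
          have tm: "t m = 0" using simplexD(2)[OF st(3)] by simp
          have qm: "q z m = s" using tm by (simp add: q_def st)
          have qC: "q z \<in> geometric_simplex C"
            using quotient_imp_surjective_map[OF quot] z by (metis imageI topspace_euclidean_subtopology)
          show ?thesis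
          proof (cases "s = 0")
            case True
            have "q z = t" using True tm by (auto simp: q_def st fun_eq_iff)
            then show ?thesis using True h(2)[OF mA] by (simp add: st)
          next
            case False
            have le_m: "leq x m" if "q z x \<noteq> 0" for x
              using that simplexD(2)[OF qC, of x] less.prems(3) by blast
            have "g (q z) = (if {x. q z x \<noteq> 0} \<subseteq> B then a (q z) else h m (q z m, g (link_point m (q z))))"
              unfolding g_def using qm False le_m by (intro cone_extension_eq[OF A C qC]) auto
            moreover have "\<not> {x. q z x \<noteq> 0} \<subseteq> B"
              using qm False mB subsetD[of "{x. q z x \<noteq> 0}" B m] by auto
            ultimately have "g (q z) = h m (q z m, g (link_point m (q z)))" by simp
            moreover have "link_point m (q z) = t" if "s \<noteq> 1"
              using that tm by (auto simp: link_point_def qm fun_eq_iff) (simp add: q_def st)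
            ultimately show ?thesis
              using h(3)[OF mA] qm by (cases "s = 1") (auto simp: st(1))
          qed
        qed
        then have "continuous_map (prod_topology ?I ?S) (Y m) (g \<circ> q)"
          using cont by (rule continuous_map_eq[rotated])
        then show ?thesis using continuous_compose_quotient_map[OF quot] by blast
      qed
    qed
  qed
  then have "carried A leq Y g" unfolding carried_def by blast
  moreover have "g t = a t" if "C \<in> finite_chains B leq" "t \<in> geometric_simplex C" for C t
    using g_base[of C t] that B(1) finite_chains_mono[OF B(1)] support_subset[OF that(2)] finite_chainsD(1)[OF that(1)]
    by blast
  ultimately show ?thesis using that by blast
qed

lemma continuous_map_carried:
  assumes A: "is_poset A leq" and g: "carried A leq Y g"
    and incl: "\<And>x. x \<in> A \<Longrightarrow> continuous_map (Y x) X (\<lambda>p. p)"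
  shows "continuous_map (realization (finite_chains A leq)) X g"
proof (rule continuous_map_from_realization)
  fix C assume C: "C \<in> finite_chains A leq"
  then obtain m where m: "m \<in> C" "\<forall>x\<in>C. leq x m" using finite_chains_has_greatest[OF A] by blast
  then have "continuous_map (top_of_set (geometric_simplex C)) X ((\<lambda>p. p) \<circ> g)"
    using g C incl finite_chainsD(1)[OF C]
    by (intro continuous_map_compose[of _ "Y m"]) (auto simp: carried_def)
  then show "continuous_map (top_of_set (geometric_simplex C)) X g" by (simp add: o_def)
qed

lemma realization_map_simplex:
  assumes fin: "finite C"
  shows "continuous_map (top_of_set (geometric_simplex C)) (top_of_set (geometric_simplex (f ` C)))
    (realization_map f)"
proof -
  have "realization_map f t \<in> geometric_simplex (f ` C)" if t: "t \<in> geometric_simplex C" for t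
  proof -
    have "sum (realization_map f t) (f ` C) = sum t C"
      unfolding realization_map_on_simplex[OF fin t] using fin by (intro sum_fibres) auto
    moreover have "realization_map f t y = 0" if "y \<notin> f ` C" for y
      unfolding realization_map_on_simplex[OF fin t] using that by (intro sum.neutral) auto
    moreover have "0 \<le> realization_map f t y" for y
      unfolding realization_map_def using simplexD(1)[OF t] by (intro sum_nonneg) auto
    ultimately show ?thesis using simplexD(3)[OF t] by (simp add: geometric_simplex_def)
  qed
  moreover have "continuous_on (geometric_simplex C) (realization_map f)"
  proof (rule continuous_on_coordinatewise_then_product)
    fix y
    have if_cont: "continuous_on (geometric_simplex C) (\<lambda>t. if f x = y then t x else 0)" for x
    proof -
      have "continuous_on (geometric_simplex C) (\<lambda>t. t x)"
        using continuous_on_product_then_coordinatewise[OF continuous_on_id] .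
      then show ?thesis by (cases "f x = y") simp_all
    qed
    have "continuous_on (geometric_simplex C) (\<lambda>t. \<Sum>x\<in>C. if f x = y then t x else 0)"
      by (rule continuous_on_sum) (rule if_cont)
    then show "continuous_on (geometric_simplex C) (\<lambda>t. realization_map f t y)"
      by (rule continuous_on_eq) (simp add: realization_map_on_simplex[OF fin])
  qed
  ultimately show ?thesis by auto
qed

text \<open>
  Two copies of the prism, glued along their common top, let both ends of a homotopy be prescribed:
  levels \<open>0\<close> and \<open>2\<close> together form a down-closed set.
\<close>

definition zigzag_le :: "('x \<Rightarrow> 'x \<Rightarrow> bool) \<Rightarrow> 'x \<times> nat \<Rightarrow> 'x \<times> nat \<Rightarrow> bool" where
  "zigzag_le leq p q \<longleftrightarrow> leq (fst p) (fst q) \<and> (snd p = snd q \<or> snd q = 1)"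

lemma is_poset_zigzag:
  assumes A: "is_poset A leq"
  shows "is_poset (A \<times> {0, 1, 2}) (zigzag_le leq)"
  unfolding is_poset_def
proof (intro conjI)
  show "reflp_on (A \<times> {0, 1, 2}) (zigzag_le leq)"
    using poset_refl[OF A] by (intro reflp_onI) (auto simp: zigzag_le_def)
  show "antisymp_on (A \<times> {0, 1, 2}) (zigzag_le leq)"
  proof (rule antisymp_onI)
    fix p q assume pq: "p \<in> A \<times> {0, 1, 2::nat}" "q \<in> A \<times> {0, 1, 2::nat}" "zigzag_le leq p q" "zigzag_le leq q p"
    then have "fst p = fst q" using poset_antisym[OF A, of "fst p" "fst q"] by (auto simp: zigzag_le_def)
    moreover have "snd p = snd q" using pq(3,4) by (auto simp: zigzag_le_def)
    ultimately show "p = q" by (simp add: prod_eq_iff)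
  qed
  show "transp_on (A \<times> {0, 1, 2}) (zigzag_le leq)"
  proof (rule transp_onI)
    fix p q r assume "p \<in> A \<times> {0, 1, 2::nat}" "q \<in> A \<times> {0, 1, 2::nat}" "r \<in> A \<times> {0, 1, 2::nat}"
      "zigzag_le leq p q" "zigzag_le leq q r"
    then show "zigzag_le leq p r"
      using poset_trans[OF A, of "fst p" "fst q" "fst r"] by (auto simp: zigzag_le_def)
  qed
qed

lemma realization_map_level:
  "realization_map (\<lambda>x. (x, i)) t = (\<lambda>(x, j). if j = i then t x else 0)"
proof
  fix p :: "'a \<times> 'b"
  obtain x j where p: "p = (x, j)" by (cases p)
  have "{y. t y \<noteq> 0 \<and> (y, i) = (x, j)} = (if j = i \<and> t x \<noteq> 0 then {x} else {})" by auto
  then show "realization_map (\<lambda>x. (x, i)) t p = (\<lambda>(x, j). if j = i then t x else 0) p"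
    by (simp add: realization_map_def p)
qed

text \<open>
  The two maps are prescribed on the levels \<open>0\<close> and \<open>2\<close> of the double prism and extended by
  \<open>carrier_extension\<close>; the inclusions of the levels \<open>0\<close>, \<open>1\<close>, \<open>2\<close> are connected by order homotopies.
\<close>

theorem carried_maps_homotopic:
  assumes A: "is_poset A leq"
    and contr: "\<And>x. x \<in> A \<Longrightarrow> contractible_space (Y x)"
    and ne: "\<And>x. x \<in> A \<Longrightarrow> topspace (Y x) \<noteq> {}"
    and incl: "\<And>x y. x \<in> A \<Longrightarrow> y \<in> A \<Longrightarrow> leq x y \<Longrightarrow> continuous_map (Y x) (Y y) (\<lambda>p. p)"
    and inclX: "\<And>x. x \<in> A \<Longrightarrow> continuous_map (Y x) X (\<lambda>p. p)"
    and a: "carried A leq Y a" and b: "carried A leq Y b"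
  shows "homotopic_with (\<lambda>_. True) (realization (finite_chains A leq)) X a b"
proof -
  let ?Z = "A \<times> {0, 1, 2::nat}" and ?B = "A \<times> {0, 2::nat}" and ?le = "zigzag_le leq"
  let ?Y = "\<lambda>p. Y (fst p)"
  define e where "e u = (if \<exists>x. u (x, 0) \<noteq> 0 then a (\<lambda>x. u (x, 0)) else b (\<lambda>x. u (x, 2)))"
    for u :: "'a \<times> nat \<Rightarrow> real"
  note Z = is_poset_zigzag[OF A]
  have lev: "poset_map A leq ?Z ?le (\<lambda>x. (x, i))" if "i \<in> {0, 1, 2}" for i
    using that by (auto simp: poset_map_def monotone_on_def zigzag_le_def)
  have e_carried: "carried ?B ?le ?Y e"
    unfolding carried_def
  proof (intro ballI impI)
    fix D p assume D: "D \<in> finite_chains ?B ?le" and p: "p \<in> D" "\<forall>q\<in>D. ?le q p"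
    define C where "C = fst ` D"
    obtain m i where mi: "p = (m, i)" "i = 0 \<or> i = 2" using p(1) finite_chainsD(1)[OF D] by auto
    have Di: "snd q = i" if "q \<in> D" for q
      using that p(2) mi unfolding zigzag_le_def by force
    then have DC: "D = C \<times> {i}" unfolding C_def by force
    have "leq x y \<or> leq y x" if "x \<in> C" "y \<in> C" "x \<noteq> y" for x y
      using finite_chainsD(4)[OF D, of "(x, i)" "(y, i)"] that by (auto simp: DC zigzag_le_def)
    then have C: "C \<in> finite_chains A leq"
      using finite_chainsD(1-3)[OF D] by (auto simp: C_def finite_chains_def totalp_on_def)
    have mC: "m \<in> C" "\<forall>x\<in>C. leq x m" using p mi by (auto simp: DC zigzag_le_def)
    define r where "r u = (\<lambda>x. u (x, i))" for u :: "'a \<times> nat \<Rightarrow> real"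
    have r_simplex: "r u \<in> geometric_simplex C" if u: "u \<in> geometric_simplex D" for u
    proof -
      have "sum (r u) C = sum u D"
        using sum.cartesian_product[of "\<lambda>x j. u (x, j)" "{i}" C] by (simp add: DC r_def)
      then show ?thesis using simplexD[OF u] by (auto simp: geometric_simplex_def r_def DC)
    qed
    have "continuous_on (geometric_simplex D) r"
      unfolding r_def
      by (intro continuous_on_coordinatewise_then_product continuous_on_product_then_coordinatewise[OF continuous_on_id])
    then have r: "continuous_map (top_of_set (geometric_simplex D)) (top_of_set (geometric_simplex C)) r"
      using r_simplex by auto
    show "continuous_map (top_of_set (geometric_simplex D)) (?Y p) e"
    proof (cases "i = 0")
      case True
      have "continuous_map (top_of_set (geometric_simplex D)) (Y m) (a \<circ> r)"
        using a C mC by (intro continuous_map_compose[OF r]) (auto simp: carried_def)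
      moreover have "(a \<circ> r) u = e u" if "u \<in> geometric_simplex D" for u
        using support_nonempty[OF r_simplex[OF that]] by (auto simp: e_def r_def True)
      ultimately show ?thesis using mi(1) by (metis continuous_map_eq fst_conv topspace_euclidean_subtopology)
    next
      case False
      have "continuous_map (top_of_set (geometric_simplex D)) (Y m) (b \<circ> r)"
        using b C mC by (intro continuous_map_compose[OF r]) (auto simp: carried_def)
      moreover have "(b \<circ> r) u = e u" if "u \<in> geometric_simplex D" for u
        using simplexD(2)[OF that] False mi(2) by (auto simp: e_def r_def DC)
      ultimately show ?thesis using mi(1) by (metis continuous_map_eq fst_conv topspace_euclidean_subtopology)
    qed
  qed
  obtain g where g: "carried ?Z ?le ?Y g"
    and ge: "\<And>C u. C \<in> finite_chains ?B ?le \<Longrightarrow> u \<in> geometric_simplex C \<Longrightarrow> g u = e u"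
  proof (rule carrier_extension[OF Z _ _ _ _ _ e_carried])
    show "?B \<subseteq> ?Z" by auto
    show "p \<in> ?B" if "p \<in> ?Z" "q \<in> ?B" "?le p q" for p q
      using that by (auto simp: zigzag_le_def)
    show "contractible_space (?Y p)" if "p \<in> ?Z" for p using that by (intro contr) auto
    show "topspace (?Y p) \<noteq> {}" if "p \<in> ?Z" for p using that by (intro ne) auto
    show "continuous_map (?Y p) (?Y q) (\<lambda>p. p)" if "p \<in> ?Z" "q \<in> ?Z" "?le p q" for p q
      using that by (intro incl) (auto simp: zigzag_le_def)
  qed (rule that)
  have gX: "continuous_map (realization (finite_chains ?Z ?le)) X g"
    by (rule continuous_map_carried[OF Z g]) (use inclX in auto)
  have "homotopic_with (\<lambda>_. True) (realization (finite_chains A leq)) (realization (finite_chains ?Z ?le))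
      (realization_map (\<lambda>x. (x, i))) (realization_map (\<lambda>x. (x, 1)))" if "i \<in> {0, 1, 2}" for i
    using that poset_refl[OF A] by (intro order_homotopy A Z lev) (auto simp: zigzag_le_def)
  then have "homotopic_with (\<lambda>_. True) (realization (finite_chains A leq)) (realization (finite_chains ?Z ?le))
      (realization_map (\<lambda>x. (x, 0))) (realization_map (\<lambda>x. (x, 2)))"
    by (meson homotopic_with_symD homotopic_with_trans insertCI)
  then have hom: "homotopic_with (\<lambda>_. True) (realization (finite_chains A leq)) X
      (g \<circ> realization_map (\<lambda>x. (x, 0))) (g \<circ> realization_map (\<lambda>x. (x, 2)))"
    by (rule homotopic_with_compose_continuous_map_left[OF _ gX]) simp
  have level: "g (realization_map (\<lambda>x. (x, i)) t) = e (realization_map (\<lambda>x. (x, i)) t)"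
    if "i \<in> {0, 2}" "C \<in> finite_chains A leq" "t \<in> geometric_simplex C" for i C t
  proof (rule ge)
    have "poset_map A leq ?B ?le (\<lambda>x. (x, i))"
      using that by (auto simp: poset_map_def monotone_on_def zigzag_le_def)
    then show "(\<lambda>x. (x, i)) ` C \<in> finite_chains ?B ?le"
      using finite_chains_image[OF A] that(2) by blast
    show "realization_map (\<lambda>x. (x, i)) t \<in> geometric_simplex ((\<lambda>x. (x, i)) ` C)"
      using continuous_map_image_subset_topspace[OF realization_map_simplex[OF finite_chainsD(2)[OF that(2)], of "\<lambda>x. (x, i)"]]
        that(3) by auto
  qed
  show ?thesis
  proof (rule homotopic_with_eq[OF hom])
    fix t assume "t \<in> topspace (realization (finite_chains A leq))"
    then obtain C where C: "C \<in> finite_chains A leq" "t \<in> geometric_simplex C"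
      by (auto simp: topspace_realization)
    show "a t = (g \<circ> realization_map (\<lambda>x. (x, 0))) t"
      using level[of 0, OF _ C] support_nonempty[OF C(2)] by (simp add: realization_map_level e_def)
    show "b t = (g \<circ> realization_map (\<lambda>x. (x, 2))) t"
      using level[of 2, OF _ C] by (simp add: realization_map_level e_def)
  qed simp
qed

section \<open>Quillen's fibre lemma\<close>

lemma continuous_map_subcomplex:
  assumes "K \<subseteq> L"
  shows "continuous_map (realization K) (realization L) (\<lambda>t. t)"
  by (intro continuous_map_from_realization continuous_map_simplex_inclusion) (use assms in blast)

lemma topspace_realization_nonempty:
  assumes "x \<in> A"
  shows "topspace (realization (finite_chains A leq)) \<noteq> {}"
proof -
  have "{x} \<in> finite_chains A leq" using assms by (simp add: finite_chains_def)
  moreover have "(\<lambda>y. if y = x then 1 else 0) \<in> geometric_simplex {x}" by (simp add: geometric_simplex_def)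
  ultimately show ?thesis by (auto simp: topspace_realization)
qed

lemma realization_map_id: "realization_map (\<lambda>x. x) t = t"
proof
  fix y
  have "{x. t x \<noteq> 0 \<and> x = y} = (if t y \<noteq> 0 then {y} else {})" by auto
  then show "realization_map (\<lambda>x. x) t y = t y" by (simp add: realization_map_def)
qed

lemma realization_map_const:
  assumes "t \<in> topspace (realization (finite_chains A leq))"
  shows "realization_map (\<lambda>_. m) t = (\<lambda>y. if y = m then 1 else 0)"
proof
  fix y
  obtain C where C: "C \<in> finite_chains A leq" "t \<in> geometric_simplex C"
    using assms by (auto simp: topspace_realization)
  show "realization_map (\<lambda>_. m) t y = (if y = m then 1 else 0)"
    using simplexD(3)[OF C(2)] by (simp add: realization_map_on_simplex[OF finite_chainsD(2)[OF C(1)] C(2)])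
qed

lemma poset_map_ident: "poset_map A leq A leq (\<lambda>x. x)"
  by (simp add: poset_map_def monotone_on_def)

lemma poset_map_const: "is_poset A leq \<Longrightarrow> m \<in> A \<Longrightarrow> poset_map A leq A leq (\<lambda>_. m)"
  by (simp add: poset_map_def monotone_on_def poset_refl)

lemma contractible_realization:
  assumes "homotopic_with (\<lambda>_. True) (realization (finite_chains A leq)) (realization (finite_chains A leq))
      (realization_map (\<lambda>x. x)) (realization_map (\<lambda>_. m))"
  shows "contractible_space (realization (finite_chains A leq))"
  unfolding contractible_space_def
  by (rule exI, rule homotopic_with_eq[OF assms])
    (simp_all add: realization_map_id realization_map_const)

lemma contractible_with_greatest:
  assumes A: "is_poset A leq" and m: "m \<in> A" "\<And>x. x \<in> A \<Longrightarrow> leq x m"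
  shows "contractible_space (realization (finite_chains A leq))"
  by (rule contractible_realization[of _ _ m], rule order_homotopy)
    (use A m in \<open>simp_all add: poset_map_ident poset_map_const\<close>)

text \<open>
  A homotopy inverse \<open>g\<close> is any map that sends a simplex with greatest vertex \<open>z\<close> into the realized
  fibre over \<open>z\<close>. Then \<open>g \<circ> |f|\<close> and the identity are both carried by the fibres over \<open>f x\<close>, and
  \<open>|f| \<circ> g\<close> and the identity are both carried by the cones \<open>{w. w \<le> z}\<close>.
\<close>

theorem quillen_fibre_lemma:
  assumes A: "is_poset A leA" and B: "is_poset B leB" and f: "poset_map A leA B leB f"
    and ne: "\<And>z. z \<in> B \<Longrightarrow> {x \<in> A. leB (f x) z} \<noteq> {}"
    and contr: "\<And>z. z \<in> B \<Longrightarrow> contractible_space (realization (finite_chains {x \<in> A. leB (f x) z} leA))"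
  shows "poset_homotopy_equivalence A leA B leB f"
proof -
  let ?F = "\<lambda>z. {x \<in> A. leB (f x) z}" and ?D = "\<lambda>z. {w \<in> B. leB w z}"
  let ?Y = "\<lambda>z. realization (finite_chains (?F z) leA)"
  let ?W = "\<lambda>z. realization (finite_chains (?D z) leB)"
  let ?X = "realization (finite_chains A leA)" and ?Q = "realization (finite_chains B leB)"
  have fB: "f x \<in> B" if "x \<in> A" for x using f that by (auto simp: poset_map_def)
  have f_mono: "leB (f x) (f y)" if "x \<in> A" "y \<in> A" "leA x y" for x y
    using f that by (auto simp: poset_map_def monotone_on_def)
  have Y_ne: "topspace (?Y z) \<noteq> {}" if "z \<in> B" for z
  proof -
    obtain x where "x \<in> ?F z" using ne[OF \<open>z \<in> B\<close>] by blast
    then show ?thesis by (rule topspace_realization_nonempty)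
  qed
  have W_ne: "topspace (?W z) \<noteq> {}" if "z \<in> B" for z
    by (rule topspace_realization_nonempty[of z]) (simp add: poset_refl[OF B that] that)
  have F_mono: "?F z \<subseteq> ?F w" if "z \<in> B" "w \<in> B" "leB z w" for z w
    using poset_trans[OF B _ that(1,2) _ that(3)] fB by blast
  have D_mono: "?D z \<subseteq> ?D w" if "z \<in> B" "w \<in> B" "leB z w" for z w
    using poset_trans[OF B _ that(1,2) _ that(3)] by blast
  have Y_incl: "continuous_map (?Y z) (?Y w) (\<lambda>p. p)" if "z \<in> B" "w \<in> B" "leB z w" for z w
    by (intro continuous_map_subcomplex finite_chains_mono F_mono that)
  have W_incl: "continuous_map (?W z) (?W w) (\<lambda>p. p)" if "z \<in> B" "w \<in> B" "leB z w" for z w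
    by (intro continuous_map_subcomplex finite_chains_mono D_mono that)
  have YX: "continuous_map (?Y z) ?X (\<lambda>p. p)" for z
    by (intro continuous_map_subcomplex finite_chains_mono) auto
  have WQ: "continuous_map (?W z) ?Q (\<lambda>p. p)" for z
    by (intro continuous_map_subcomplex finite_chains_mono) auto
  have W_contr: "contractible_space (?W z)" if "z \<in> B" for z
    by (rule contractible_with_greatest[of _ _ z])
      (use that poset_refl[OF B that] is_poset_subset_carrier[OF B] in auto)
  obtain g where g: "carried B leB ?Y g"
  proof (rule carrier_extension[OF B, of "{}" ?Y "\<lambda>_. undefined"])
    show "carried {} leB ?Y (\<lambda>_. undefined)" by (auto simp: carried_def finite_chains_def)
  qed (use contr Y_ne Y_incl that in auto)
  have g_cont: "continuous_map ?Q ?X g" by (rule continuous_map_carried[OF B g YX])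
  have f_cont: "continuous_map ?X ?Q (realization_map f)" by (rule continuous_realization_map[OF A B f])
  have top_image: "f m \<in> f ` C \<and> (\<forall>y\<in>f ` C. leB y (f m))"
    if "C \<in> finite_chains A leA" "m \<in> C" "\<forall>x\<in>C. leA x m" for C m
    using f_mono that finite_chainsD(1)[OF that(1)] by blast
  have "homotopic_with (\<lambda>_. True) ?X ?X (g \<circ> realization_map f) id"
  proof (rule carried_maps_homotopic[OF A, of "\<lambda>x. ?Y (f x)"])
    show "carried A leA (\<lambda>x. ?Y (f x)) (g \<circ> realization_map f)"
      unfolding carried_def
    proof (intro ballI impI)
      fix C m assume C: "C \<in> finite_chains A leA" "m \<in> C" "\<forall>x\<in>C. leA x m"
      have "continuous_map (top_of_set (geometric_simplex (f ` C))) (?Y (f m)) g"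
        using g finite_chains_image[OF A f C(1)] top_image[OF C] unfolding carried_def by blast
      with realization_map_simplex[OF finite_chainsD(2)[OF C(1)]]
      show "continuous_map (top_of_set (geometric_simplex C)) (?Y (f m)) (g \<circ> realization_map f)"
        by (rule continuous_map_compose)
    qed
    show "carried A leA (\<lambda>x. ?Y (f x)) id"
      unfolding carried_def id_def
    proof (intro ballI impI continuous_map_simplex_inclusion)
      fix C m assume C: "C \<in> finite_chains A leA" "m \<in> C" "\<forall>x\<in>C. leA x m"
      have "C \<subseteq> ?F (f m)" using top_image[OF C] finite_chainsD(1)[OF C(1)] by blast
      then show "C \<in> finite_chains (?F (f m)) leA" using C(1) by (simp add: finite_chains_def)
    qed
  qed (use fB f_mono contr Y_ne Y_incl YX in auto)
  moreover have "homotopic_with (\<lambda>_. True) ?Q ?Q (realization_map f \<circ> g) id"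
  proof (rule carried_maps_homotopic[OF B, of ?W])
    show "carried B leB ?W (realization_map f \<circ> g)"
      unfolding carried_def
    proof (intro ballI impI)
      fix C m assume C: "C \<in> finite_chains B leB" "m \<in> C" "\<forall>x\<in>C. leB x m"
      have "continuous_map (top_of_set (geometric_simplex C)) (?Y m) g"
        using g C unfolding carried_def by blast
      moreover have "continuous_map (?Y m) (?W m) (realization_map f)"
      proof (rule continuous_realization_map)
        show "is_poset (?F m) leA" by (rule is_poset_subset_carrier[OF A]) auto
        show "is_poset (?D m) leB" by (rule is_poset_subset_carrier[OF B]) auto
        show "poset_map (?F m) leA (?D m) leB f"
          using fB f_mono by (auto simp: poset_map_def monotone_on_def)
      qed
      ultimately show "continuous_map (top_of_set (geometric_simplex C)) (?W m) (realization_map f \<circ> g)"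
        by (rule continuous_map_compose)
    qed
    show "carried B leB ?W id"
      unfolding carried_def id_def
    proof (intro ballI impI continuous_map_simplex_inclusion)
      fix C m assume C: "C \<in> finite_chains B leB" "m \<in> C" "\<forall>x\<in>C. leB x m"
      have "C \<subseteq> ?D m" using C finite_chainsD(1)[OF C(1)] by blast
      then show "C \<in> finite_chains (?D m) leB" using C(1) by (simp add: finite_chains_def)
    qed
  qed (use W_contr W_ne W_incl WQ in auto)
  ultimately show ?thesis
    unfolding poset_homotopy_equivalence_def homotopy_equivalence_map_def
    using f f_cont g_cont by blast
qed

text \<open>
  The map that sends a chain to its greatest element is a homotopy equivalence: its fibre over \<open>z\<close> consists
  of the chains \<open>C\<close> below \<open>z\<close>, and is contracted by \<open>C \<subseteq> insert z C \<supseteq> {z}\<close>.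
\<close>

lemma contractible_subdivision:
  assumes R: "is_poset R leq" and contr: "contractible_space (realization (finite_chains R leq))"
  shows "contractible_space (realization (finite_chains (finite_chains R leq) (\<subseteq>)))"
proof -
  let ?S = "finite_chains R leq" and ?g = "greatest_of leq"
  have g: "?g C \<in> C" "\<And>x. x \<in> C \<Longrightarrow> leq x (?g C)" if C: "C \<in> ?S" for C
  proof -
    obtain m where m: "m \<in> C" "\<And>x. x \<in> C \<Longrightarrow> leq x m" using finite_chains_has_greatest[OF R C] by blast
    then have "?g C = m" using greatest_of_eq[OF R finite_chainsD(1)[OF C]] by blast
    then show "?g C \<in> C" "\<And>x. x \<in> C \<Longrightarrow> leq x (?g C)" using m by auto
  qed
  have gR: "?g C \<in> R" if "C \<in> ?S" for C using g(1)[OF that] finite_chainsD(1)[OF that] by blast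
  have "poset_homotopy_equivalence ?S (\<subseteq>) R leq ?g"
  proof (rule quillen_fibre_lemma[OF is_poset_subset R])
    show "poset_map ?S (\<subseteq>) R leq ?g"
      unfolding poset_map_def monotone_on_def using g gR by blast
    fix z assume z: "z \<in> R"
    let ?F = "{C \<in> ?S. leq (?g C) z}"
    have zS: "{z} \<in> ?S" using z by (simp add: finite_chains_def)
    then have zF: "{z} \<in> ?F" using g(1)[OF zS] poset_refl[OF R z] by simp
    then show "?F \<noteq> {}" by blast
    have le_z: "leq x z" if "C \<in> ?F" "x \<in> C" for x C
      using that g gR z finite_chainsD(1) poset_trans[OF R, of x "?g C" z] by blast
    have ins: "insert z C \<in> ?F" if C: "C \<in> ?F" for C
    proof -
      have "insert z C \<in> ?S"
        unfolding finite_chains_def totalp_on_def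
      proof (intro CollectI conjI ballI impI)
        have CS: "C \<in> ?S" using C by simp
        show "insert z C \<subseteq> R" "finite (insert z C)" "insert z C \<noteq> {}"
          using z finite_chainsD(1,2)[OF CS] by simp_all
        fix x y assume "x \<in> insert z C" "y \<in> insert z C" "x \<noteq> y"
        then show "leq x y \<or> leq y x"
          using le_z[OF C] finite_chainsD(4)[OF CS, of x y] by blast
      qed
      moreover from this have "?g (insert z C) \<in> insert z C" by (rule g(1))
      then have "leq (?g (insert z C)) z" using le_z[OF C] poset_refl[OF R z] by (metis insertE)
      ultimately show ?thesis by blast
    qed
    have P: "is_poset ?F (\<subseteq>)" by (rule is_poset_subset)
    have pm: "poset_map ?F (\<subseteq>) ?F (\<subseteq>) (insert z)"
      using ins by (auto simp: poset_map_def monotone_on_def)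
    have up: "homotopic_with (\<lambda>_. True) (realization (finite_chains ?F (\<subseteq>))) (realization (finite_chains ?F (\<subseteq>)))
        (realization_map (\<lambda>x. x)) (realization_map (insert z))"
      by (rule order_homotopy[OF P P poset_map_ident pm]) blast
    have down: "homotopic_with (\<lambda>_. True) (realization (finite_chains ?F (\<subseteq>))) (realization (finite_chains ?F (\<subseteq>)))
        (realization_map (\<lambda>_. {z})) (realization_map (insert z))"
      by (rule order_homotopy[OF P P poset_map_const[OF P zF] pm]) blast
    show "contractible_space (realization (finite_chains ?F (\<subseteq>)))"
      by (rule contractible_realization[OF homotopic_with_trans[OF up homotopic_with_symD[OF down]]])
  qed
  then have "realization (finite_chains ?S (\<subseteq>)) homotopy_equivalent_space realization (finite_chains R leq)"
    unfolding poset_homotopy_equivalence_def homotopy_equivalence_map_def homotopy_equivalent_space_def by blast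
  then show ?thesis using contr homotopy_equivalent_space_contractibility by blast
qed

section \<open>Direct sums and common bases\<close>

text \<open>
  The zero subspace is removed because the members of a partial decomposition are non-zero.
\<close>

definition cut_by :: "'b::zero set set \<Rightarrow> 'b set \<Rightarrow> 'b set set" where
  "cut_by d W = (\<lambda>T. W \<inter> T) ` d - {{0}}"

text \<open>
  For a full decomposition \<open>d\<close> this says that \<open>W\<close> is the direct sum of the intersections \<open>W \<inter> T\<close>; it
  turns the existence of a common basis into a condition on each subspace separately.
\<close>

definition splits_along :: "('a::field \<Rightarrow> 'b::ab_group_add \<Rightarrow> 'b) \<Rightarrow> 'b set \<Rightarrow> 'b set set \<Rightarrow> bool" where
  "splits_along smul W d \<longleftrightarrow> W \<subseteq> module.span smul (\<Union>T\<in>d. W \<inter> T)"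

context vector_space
begin

text \<open>
  The sums of elements of the members always form the span, so only injectivity has to be tested, and
  by linearity it is tested at zero.
\<close>

lemma internal_direct_sum_iff:
  assumes fin: "finite d" and sub: "\<And>S. S \<in> d \<Longrightarrow> subspace S"
  shows "internal_direct_sum scale d \<longleftrightarrow>
    (\<forall>v. (\<forall>S\<in>d. v S \<in> S) \<longrightarrow> (\<Sum>S\<in>d. v S) = 0 \<longrightarrow> (\<forall>S\<in>d. v S = 0))"
    (is "?L \<longleftrightarrow> ?R")
proof
  assume L: ?L
  show ?R
  proof (intro allI impI ballI)
    fix v S assume v: "\<forall>S\<in>d. v S \<in> S" "(\<Sum>S\<in>d. v S) = 0" and S: "S \<in> d"
    have "inj_on (\<lambda>v. \<Sum>S\<in>d. v S) (\<Pi>\<^sub>E S\<in>d. S)"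
      using L by (simp add: internal_direct_sum_def bij_betw_def)
    moreover have "(\<Sum>S\<in>d. restrict v d S) = (\<Sum>S\<in>d. restrict (\<lambda>_. 0) d S)" using v(2) by simp
    moreover have "restrict v d \<in> (\<Pi>\<^sub>E S\<in>d. S)" using v(1) by auto
    moreover have "restrict (\<lambda>_. 0) d \<in> (\<Pi>\<^sub>E S\<in>d. S)" using sub by (auto intro: subspace_0)
    ultimately have "restrict v d = restrict (\<lambda>_. 0) d" by (rule inj_onD)
    then have "restrict v d S = restrict (\<lambda>_. 0) d S" by simp
    then show "v S = 0" using S by simp
  qed
next
  assume R: ?R
  let ?sum = "\<lambda>v. \<Sum>S\<in>d. v S" and ?P = "\<Pi>\<^sub>E S\<in>d. S"
  have "inj_on ?sum ?P"
  proof (rule inj_onI)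
    fix v w assume v: "v \<in> ?P" and w: "w \<in> ?P" and eq: "?sum v = ?sum w"
    have "\<forall>S\<in>d. v S - w S \<in> S" using v w sub by (auto intro!: subspace_diff dest: PiE_mem)
    moreover have "(\<Sum>S\<in>d. v S - w S) = 0" using eq by (simp add: sum_subtractf)
    ultimately have "\<forall>S\<in>d. v S - w S = 0" using R[rule_format, of "\<lambda>S. v S - w S"] by blast
    then show "v = w" using v w by (intro PiE_ext[of v d "\<lambda>S. S" w]) auto
  qed
  moreover have "?sum ` ?P = span (\<Union>d)"
  proof
    show "?sum ` ?P \<subseteq> span (\<Union>d)"
    proof
      fix x assume "x \<in> ?sum ` ?P"
      then obtain v where v: "v \<in> ?P" "x = ?sum v" by blast
      have "v S \<in> span (\<Union>d)" if "S \<in> d" for S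
        using v(1) that by (intro span_base) (auto dest: PiE_mem)
      then show "x \<in> span (\<Union>d)" unfolding v(2) by (rule span_sum)
    qed
    have "subspace (?sum ` ?P)"
    proof (rule subspaceI)
      have "restrict (\<lambda>_. 0) d \<in> ?P" using sub by (auto intro: subspace_0)
      moreover have "0 = ?sum (restrict (\<lambda>_. 0) d)" by simp
      ultimately show "0 \<in> ?sum ` ?P" by - (erule rev_image_eqI, assumption)
    next
      fix x y assume "x \<in> ?sum ` ?P" "y \<in> ?sum ` ?P"
      then obtain v w where vw: "v \<in> ?P" "w \<in> ?P" "x = ?sum v" "y = ?sum w" by blast
      have "restrict (\<lambda>S. v S + w S) d \<in> ?P"
        using vw(1,2) sub by (auto intro!: subspace_add dest: PiE_mem)
      moreover have "x + y = ?sum (restrict (\<lambda>S. v S + w S) d)" using vw(3,4) by (simp add: sum.distrib)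
      ultimately show "x + y \<in> ?sum ` ?P" by - (erule rev_image_eqI, assumption)
    next
      fix c x assume "x \<in> ?sum ` ?P"
      then obtain v where v: "v \<in> ?P" "x = ?sum v" by blast
      have "restrict (\<lambda>S. scale c (v S)) d \<in> ?P"
        using v(1) sub by (auto intro!: subspace_scale dest: PiE_mem)
      moreover have "scale c x = ?sum (restrict (\<lambda>S. scale c (v S)) d)" using v(2) by (simp add: scale_sum_right)
      ultimately show "scale c x \<in> ?sum ` ?P" by - (erule rev_image_eqI, assumption)
    qed
    moreover have "\<Union>d \<subseteq> ?sum ` ?P"
    proof
      fix x assume "x \<in> \<Union>d"
      then obtain S where S: "S \<in> d" "x \<in> S" by blast
      let ?v = "restrict (\<lambda>T. if T = S then x else 0) d"
      have "(if T = S then x else 0) \<in> T" if "T \<in> d" for T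
        using S(2) subspace_0[OF sub[OF that]] by simp
      then have "?v \<in> ?P" unfolding restrict_PiE_iff by blast
      moreover have "x = ?sum ?v" using S fin by simp
      ultimately show "x \<in> ?sum ` ?P" by - (erule rev_image_eqI, assumption)
    qed
    ultimately show "span (\<Union>d) \<subseteq> ?sum ` ?P" by (rule span_minimal[rotated])
  qed
  ultimately show ?L by (simp add: internal_direct_sum_def bij_betw_def)
qed

lemma PD_iff:
  "d \<in> PD scale \<longleftrightarrow> finite d \<and> d \<noteq> {} \<and> d \<subseteq> proper_subspaces scale \<and>
    (\<forall>v. (\<forall>S\<in>d. v S \<in> S) \<longrightarrow> (\<Sum>S\<in>d. v S) = 0 \<longrightarrow> (\<forall>S\<in>d. v S = 0))"
proof -
  have sum_iff: "internal_direct_sum scale d \<longleftrightarrow>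
      (\<forall>v. (\<forall>S\<in>d. v S \<in> S) \<longrightarrow> (\<Sum>S\<in>d. v S) = 0 \<longrightarrow> (\<forall>S\<in>d. v S = 0))"
    if "finite d" "d \<subseteq> proper_subspaces scale"
    using that by (intro internal_direct_sum_iff) (auto simp: proper_subspaces_def)
  show ?thesis
    unfolding PD_def mem_Collect_eq by (intro conj_cong refl sum_iff)
qed

lemmas PD_finite = PD_D(1)[OF vector_space_axioms]
  and PD_subspace = PD_D(2)[OF vector_space_axioms]
  and PD_nonzero = PD_D(3)[OF vector_space_axioms]
  and PD_members_disjoint = PD_disjoint[OF vector_space_axioms]

lemma PD_sum_zero:
  assumes "d \<in> PD scale" "\<And>S. S \<in> d \<Longrightarrow> v S \<in> S" "(\<Sum>S\<in>d. v S) = 0" "S \<in> d"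
  shows "v S = 0"
  using assms unfolding PD_iff by blast

lemma subspace_nonzero_element:
  assumes "subspace S" "S \<noteq> {0}"
  obtains x where "x \<in> S" "x \<noteq> 0"
  using assms subspace_0 by blast

lemma singleton_PD: "W \<in> proper_subspaces scale \<Longrightarrow> {W} \<in> PD scale"
  by (simp add: PD_iff)

lemma cut_by_inj:
  assumes d: "d \<in> PD scale" and W: "subspace W"
    and ST: "S \<in> d" "T \<in> d" "W \<inter> S = W \<inter> T" "W \<inter> S \<noteq> {0}"
  shows "S = T"
proof -
  have "subspace (W \<inter> S)" using W PD_subspace[OF d ST(1)] by (rule subspace_inter)
  then obtain x where "x \<in> W \<inter> S" "x \<noteq> 0" using ST(4) subspace_nonzero_element by blast
  then show ?thesis using PD_members_disjoint[OF d ST(1,2), of x] ST(3) by blast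
qed

text \<open>
  A vanishing sum of elements of the sets \<open>W \<inter> T\<close> is a vanishing sum of elements of the sets \<open>T\<close>; here
  each non-zero intersection comes from only one \<open>T\<close>.
\<close>

lemma cut_by_PD:
  assumes d: "d \<in> PD scale" and W: "subspace W" and ne: "cut_by d W \<noteq> {}"
  shows "cut_by d W \<in> PD scale"
  unfolding PD_iff
proof (intro conjI allI impI ballI)
  show "finite (cut_by d W)" using PD_finite[OF d] by (simp add: cut_by_def)
  show "cut_by d W \<noteq> {}" by (rule ne)
  show "cut_by d W \<subseteq> proper_subspaces scale"
  proof
    fix S assume "S \<in> cut_by d W"
    then obtain T where T: "T \<in> d" "S = W \<inter> T" "S \<noteq> {0}" by (auto simp: cut_by_def)
    have "T \<noteq> UNIV" using d T(1) by (auto simp: PD_def proper_subspaces_def)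
    then show "S \<in> proper_subspaces scale"
      using T W PD_subspace[OF d T(1)] by (auto simp: proper_subspaces_def subspace_inter)
  qed
  fix v S assume v: "\<forall>S\<in>cut_by d W. v S \<in> S" "(\<Sum>S\<in>cut_by d W. v S) = 0" and S: "S \<in> cut_by d W"
  define w where "w T = (if W \<inter> T = {0} then 0 else v (W \<inter> T))" for T
  let ?d = "{T \<in> d. W \<inter> T \<noteq> {0}}"
  have cut: "cut_by d W = (\<lambda>T. W \<inter> T) ` ?d" by (auto simp: cut_by_def)
  have "inj_on (\<lambda>T. W \<inter> T) ?d"
    using cut_by_inj[OF d W] by (intro inj_onI) simp
  then have "(\<Sum>S\<in>cut_by d W. v S) = (\<Sum>T\<in>?d. v (W \<inter> T))"
    unfolding cut by (simp add: sum.reindex)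
  also have "\<dots> = (\<Sum>T\<in>d. w T)"
    using PD_finite[OF d] by (intro sum.mono_neutral_cong_left) (auto simp: w_def)
  finally have "(\<Sum>T\<in>d. w T) = 0" using v(2) by simp
  moreover have "w T \<in> T" if "T \<in> d" for T
    using v(1) that PD_subspace[OF d that] by (auto simp: w_def cut subspace_0)
  ultimately have w0: "w T = 0" if "T \<in> d" for T using PD_sum_zero[OF d _ _ that] by blast
  obtain T where "T \<in> d" "W \<inter> T \<noteq> {0}" "S = W \<inter> T" using S cut by blast
  then show "v S = 0" using w0[of T] by (simp add: w_def)
qed

lemma independent_Union_PD:
  assumes d: "d \<in> PD scale" and b: "\<And>T. T \<in> d \<Longrightarrow> independent (b T)" "\<And>T. T \<in> d \<Longrightarrow> b T \<subseteq> T"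
  shows "independent (\<Union>T\<in>d. b T)"
  unfolding independent_explicit_module
proof (intro allI impI)
  fix t u v assume t: "finite t" "t \<subseteq> (\<Union>T\<in>d. b T)" "(\<Sum>v\<in>t. scale (u v) v) = 0" and v: "v \<in> t"
  have "\<forall>x\<in>t. \<exists>T\<in>d. x \<in> b T" using t(2) by blast
  then obtain c where c: "\<And>x. x \<in> t \<Longrightarrow> c x \<in> d" "\<And>x. x \<in> t \<Longrightarrow> x \<in> b (c x)" by metis
  have c_mem: "x \<in> c x" if "x \<in> t" for x using b(2)[OF c(1)[OF that]] c(2)[OF that] by blast
  define y where "y T = (\<Sum>x\<in>{x \<in> t. c x = T}. scale (u x) x)" for T
  have "(\<Sum>T\<in>d. y T) = (\<Sum>x\<in>t. scale (u x) x)"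
    unfolding y_def using c(1) by (intro sum.group t(1) PD_finite[OF d]) auto
  then have "(\<Sum>T\<in>d. y T) = 0" using t(3) by simp
  moreover have "y T \<in> T" if "T \<in> d" for T
    unfolding y_def using c_mem that
    by (intro subspace_sum subspace_scale PD_subspace[OF d]) auto
  ultimately have "y (c v) = 0" using PD_sum_zero[OF d] c(1)[OF v] by blast
  moreover have "{x \<in> t. c x = c v} \<subseteq> b (c v)"
    by (metis (mono_tags, lifting) c(2) mem_Collect_eq subsetI)
  moreover have "finite {x \<in> t. c x = c v}" using t(1) by simp
  ultimately show "u v = 0"
    using b(1)[OF c(1)[OF v]] v unfolding independent_explicit_module y_def by blast
qed

text \<open>
  A basis adapted to the smaller members of the flag is extended to a basis of the largest one.
\<close>

lemma flag_basis:
  assumes "finite \<W>" "\<And>W. W \<in> \<W> \<Longrightarrow> subspace W" "\<And>W W'. W \<in> \<W> \<Longrightarrow> W' \<in> \<W> \<Longrightarrow> W \<subseteq> W' \<or> W' \<subseteq> W"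
  shows "\<exists>B. independent B \<and> B \<subseteq> \<Union>\<W> \<and> (\<forall>W\<in>\<W>. W \<subseteq> span (B \<inter> W))"
  using assms
proof (induction "card \<W>" arbitrary: \<W>)
  case 0
  then have "\<W> = {}" by simp
  then show ?case by (intro exI[of _ "{}"]) (simp add: independent_empty)
next
  case (Suc n)
  then have ne: "\<W> \<noteq> {}" by auto
  then have "\<W> \<in> finite_chains UNIV (\<subseteq>)"
    using Suc.prems by (auto simp: finite_chains_def totalp_on_def)
  from finite_chains_has_greatest[OF is_poset_subset this]
  obtain M where M: "M \<in> \<W>" "\<forall>W\<in>\<W>. W \<subseteq> M" by blast
  let ?W = "\<W> - {M}"
  have "n = card ?W" using Suc.hyps(2) M(1) by simp
  then obtain B' where B': "independent B'" "B' \<subseteq> \<Union>?W" "\<forall>W\<in>?W. W \<subseteq> span (B' \<inter> W)"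
    using Suc.hyps(1)[of ?W] Suc.prems by auto
  have "B' \<subseteq> M" using B'(2) M(2) by blast
  then obtain B where B: "B' \<subseteq> B" "B \<subseteq> M" "independent B" "M \<subseteq> span B"
    using maximal_independent_subset_extend B'(1) by blast
  have "W \<subseteq> span (B \<inter> W)" if "W \<in> \<W>" for W
  proof (cases "W = M")
    case True
    have "B \<inter> M = B" using B(2) by blast
    then show ?thesis using B(4) True by simp
  next
    case False
    then have "W \<subseteq> span (B' \<inter> W)" using B'(3) that by simp
    also have "\<dots> \<subseteq> span (B \<inter> W)" using B(1) by (intro span_mono) blast
    finally show ?thesis .
  qed
  moreover have "B \<subseteq> \<Union>\<W>" using B(2) M(1) by blast
  ultimately show ?case using B(3) by blast
qed

text \<open>
  Every vector of a common basis \<open>B\<close> lies in some member of \<open>d\<close>, since those vectors of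
  \<open>B\<close> that lie in one already span \<open>V\<close>. So \<open>W\<close>, being spanned by \<open>B \<inter> W\<close>, is spanned by the sets \<open>W \<inter> T\<close>.
\<close>

lemma common_basis_imp_splits:
  assumes d: "d \<in> FD scale" and cb: "has_common_basis scale (\<sigma> \<union> d)" and W: "W \<in> \<sigma>"
  shows "splits_along scale W d"
proof -
  obtain B where B: "is_basis_of scale B UNIV" "\<And>W. W \<in> \<sigma> \<union> d \<Longrightarrow> is_basis_of scale (B \<inter> W) W"
    using cb by (auto simp: has_common_basis_def)
  have ind: "independent B" using B(1) by (simp add: is_basis_of_def)
  have "\<Union>d \<subseteq> span (B \<inter> \<Union>d)"
  proof
    fix x assume "x \<in> \<Union>d"
    then obtain T where T: "T \<in> d" "x \<in> T" by blast
    then have "x \<in> span (B \<inter> T)" using B(2)[of T] by (auto simp: is_basis_of_def)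
    moreover have "span (B \<inter> T) \<subseteq> span (B \<inter> \<Union>d)" using T(1) by (intro span_mono) blast
    ultimately show "x \<in> span (B \<inter> \<Union>d)" by blast
  qed
  then have "span (\<Union>d) \<subseteq> span (B \<inter> \<Union>d)" by (intro span_minimal) auto
  then have full: "span (B \<inter> \<Union>d) = UNIV" using d by (auto simp: FD_def)
  have "B \<subseteq> \<Union>d"
  proof
    fix b assume b: "b \<in> B"
    show "b \<in> \<Union>d"
    proof (rule ccontr)
      assume "b \<notin> \<Union>d"
      then have "span (B \<inter> \<Union>d) \<subseteq> span (B - {b})" by (intro span_mono) blast
      then have "b \<in> span (B - {b})" using full by blast
      then show False using ind b by (auto simp: dependent_def)
    qed
  qed
  then have "B \<inter> W \<subseteq> (\<Union>T\<in>d. W \<inter> T)" by blast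
  then have "span (B \<inter> W) \<subseteq> span (\<Union>T\<in>d. W \<inter> T)" by (rule span_mono)
  then show ?thesis using B(2)[of W] W by (simp add: is_basis_of_def splits_along_def)
qed

text \<open>
  Inside each member \<open>T\<close> of \<open>d\<close> the subspaces \<open>W \<inter> T\<close> form a flag, because \<open>\<sigma>\<close> is a chain. Bases of the
  members that are adapted to these flags are joined together.
\<close>

lemma splits_imp_common_basis:
  assumes d: "d \<in> FD scale" and fin: "finite \<sigma>" and sub: "\<And>W. W \<in> \<sigma> \<Longrightarrow> subspace W"
    and chain: "\<And>W W'. W \<in> \<sigma> \<Longrightarrow> W' \<in> \<sigma> \<Longrightarrow> W \<subseteq> W' \<or> W' \<subseteq> W"
    and split: "\<And>W. W \<in> \<sigma> \<Longrightarrow> splits_along scale W d"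
  shows "has_common_basis scale (\<sigma> \<union> d)"
proof -
  have dPD: "d \<in> PD scale" and full: "span (\<Union>d) = UNIV" using d by (auto simp: FD_def)
  have "\<exists>B. independent B \<and> B \<subseteq> T \<and> T \<subseteq> span (B \<inter> T) \<and> (\<forall>W\<in>\<sigma>. W \<inter> T \<subseteq> span (B \<inter> (W \<inter> T)))"
    if T: "T \<in> d" for T
  proof -
    \<comment> \<open>Including \<open>T = UNIV \<inter> T\<close> makes the basis span all of \<open>T\<close>.\<close>
    let ?W = "insert T ((\<lambda>W. W \<inter> T) ` \<sigma>)"
    have "\<exists>B. independent B \<and> B \<subseteq> \<Union>?W \<and> (\<forall>W\<in>?W. W \<subseteq> span (B \<inter> W))"
    proof (rule flag_basis)
      show "finite ?W" using fin by simp
      show "subspace W" if "W \<in> ?W" for W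
        using that sub PD_subspace[OF dPD T] by (auto intro: subspace_inter)
      show "W \<subseteq> W' \<or> W' \<subseteq> W" if WW: "W \<in> ?W" "W' \<in> ?W" for W W'
      proof -
        have "\<exists>U\<in>insert UNIV \<sigma>. X = U \<inter> T" if "X \<in> ?W" for X using that by auto
        then obtain U U' where U: "U \<in> insert UNIV \<sigma>" "U' \<in> insert UNIV \<sigma>" "W = U \<inter> T" "W' = U' \<inter> T"
          using WW by meson
        have "U \<subseteq> U' \<or> U' \<subseteq> U" using chain[of U U'] U(1,2) by auto
        then show ?thesis unfolding U(3,4) by (meson Int_mono order_refl)
      qed
    qed
    then obtain B where B: "independent B \<and> B \<subseteq> \<Union>?W \<and> (\<forall>W\<in>?W. W \<subseteq> span (B \<inter> W))"
      by (rule exE)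
    moreover have "\<Union>?W = T" by auto
    moreover have "W \<inter> T \<subseteq> span (B \<inter> (W \<inter> T))" if "W \<in> \<sigma>" for W
      using B that by simp
    ultimately show ?thesis by (intro exI[of _ B]) simp
  qed
  then have "\<forall>T\<in>d. \<exists>B. independent B \<and> B \<subseteq> T \<and> T \<subseteq> span (B \<inter> T) \<and> (\<forall>W\<in>\<sigma>. W \<inter> T \<subseteq> span (B \<inter> (W \<inter> T)))"
    by simp
  from bchoice[OF this] obtain b where b_all: "\<forall>T\<in>d. independent (b T) \<and> b T \<subseteq> T \<and>
      T \<subseteq> span (b T \<inter> T) \<and> (\<forall>W\<in>\<sigma>. W \<inter> T \<subseteq> span (b T \<inter> (W \<inter> T)))"
    by (rule exE)
  have b: "independent (b T)" "b T \<subseteq> T" "T \<subseteq> span (b T \<inter> T)"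
      "W \<in> \<sigma> \<Longrightarrow> W \<inter> T \<subseteq> span (b T \<inter> (W \<inter> T))" if "T \<in> d" for T W
    using bspec[OF b_all that] by simp_all
  define B where "B = (\<Union>T\<in>d. b T)"
  have ind: "independent B" unfolding B_def by (rule independent_Union_PD[OF dPD b(1,2)])
  have basis: "is_basis_of scale (B \<inter> W) W" if "subspace W" "W \<subseteq> span (B \<inter> W)" for W
    unfolding is_basis_of_def
  proof
    show "independent (B \<inter> W)" using ind by (rule independent_mono) blast
    show "span (B \<inter> W) = W" using that by (intro equalityI span_minimal) auto
  qed
  have in_d: "T \<subseteq> span (B \<inter> T)" if "T \<in> d" for T
  proof -
    have "span (b T \<inter> T) \<subseteq> span (B \<inter> T)" using that by (intro span_mono) (auto simp: B_def)
    then show ?thesis using b(3)[OF that] by blast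
  qed
  have in_\<sigma>: "W \<subseteq> span (B \<inter> W)" if W: "W \<in> \<sigma>" for W
  proof -
    have "(\<Union>T\<in>d. W \<inter> T) \<subseteq> span (B \<inter> W)"
    proof
      fix x assume "x \<in> (\<Union>T\<in>d. W \<inter> T)"
      then obtain T where T: "T \<in> d" "x \<in> W \<inter> T" by blast
      then have "x \<in> span (b T \<inter> (W \<inter> T))" using b(4)[OF T(1) W] by blast
      moreover have "span (b T \<inter> (W \<inter> T)) \<subseteq> span (B \<inter> W)"
        using T(1) by (intro span_mono) (auto simp: B_def)
      ultimately show "x \<in> span (B \<inter> W)" by blast
    qed
    then have "span (\<Union>T\<in>d. W \<inter> T) \<subseteq> span (B \<inter> W)" by (intro span_minimal) auto
    then show ?thesis using split[OF W] by (auto simp: splits_along_def)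
  qed
  have "span (\<Union>d) \<subseteq> span B"
  proof (rule span_minimal)
    show "\<Union>d \<subseteq> span B"
    proof
      fix x assume "x \<in> \<Union>d"
      then obtain T where T: "T \<in> d" "x \<in> T" by blast
      moreover have "span (B \<inter> T) \<subseteq> span B" by (intro span_mono) blast
      ultimately show "x \<in> span B" using in_d[OF T(1)] by blast
    qed
  qed auto
  then have "is_basis_of scale B UNIV" using ind full by (auto simp: is_basis_of_def)
  moreover have "is_basis_of scale (B \<inter> W) W" if "W \<in> \<sigma> \<union> d" for W
    using that
  proof
    assume "W \<in> \<sigma>" then show ?thesis by (intro basis sub in_\<sigma>)
  next
    assume "W \<in> d" then show ?thesis by (intro basis PD_subspace[OF dPD] in_d)
  qed
  ultimately show ?thesis unfolding has_common_basis_def by blast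
qed

lemma GL_D:
  assumes "g \<in> carrier (GL scale)"
  shows "inj g" "surj g" "g ` span S = span (g ` S)" "subspace S \<Longrightarrow> subspace (g ` S)" "g 0 = 0"
    "g (\<Sum>i\<in>I. f i) = (\<Sum>i\<in>I. g (f i))"
proof -
  interpret g: Vector_Spaces.linear scale scale g using assms by (simp add: GL_def)
  show "inj g" "surj g" using assms by (auto simp: GL_def bij_def)
  show "g ` span S = span (g ` S)" by (simp add: g.span_image)
  show "subspace S \<Longrightarrow> subspace (g ` S)" by (rule g.subspace_image)
  show "g 0 = 0" "g (\<Sum>i\<in>I. f i) = (\<Sum>i\<in>I. g (f i))" by (simp_all add: g.zero g.sum)
qed

lemma GL_image_UNIV: "g \<in> carrier (GL scale) \<Longrightarrow> g ` S = UNIV \<longleftrightarrow> S = UNIV"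
  using GL_D(1,2)[of g] by (metis inj_image_eq_iff)

lemma GL_image_zero: "g \<in> carrier (GL scale) \<Longrightarrow> g ` S = {0} \<longleftrightarrow> S = {0}"
  using GL_D(1,5)[of g] by (metis image_empty image_insert inj_image_eq_iff)

lemma GL_proper_subspaces:
  "g \<in> carrier (GL scale) \<Longrightarrow> S \<in> proper_subspaces scale \<Longrightarrow> g ` S \<in> proper_subspaces scale"
  by (simp add: proper_subspaces_def GL_D(4) GL_image_UNIV GL_image_zero)

lemma inj_image_image: "inj g \<Longrightarrow> inj ((`) g)"
  by (metis injI inj_image_eq_iff)

lemma GL_PD:
  assumes g: "g \<in> carrier (GL scale)" and d: "d \<in> PD scale"
  shows "(`) g ` d \<in> PD scale"
  unfolding PD_iff
proof (intro conjI allI impI ballI)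
  show "finite ((`) g ` d)" using PD_finite[OF d] by simp
  show "(`) g ` d \<noteq> {}" "(`) g ` d \<subseteq> proper_subspaces scale"
    using d GL_proper_subspaces[OF g] by (auto simp: PD_def)
  fix v S assume v: "\<forall>S\<in>(`) g ` d. v S \<in> S" "(\<Sum>S\<in>(`) g ` d. v S) = 0" and S: "S \<in> (`) g ` d"
  have "\<forall>T\<in>d. \<exists>x\<in>T. g x = v (g ` T)" using v(1) by (metis imageE imageI)
  then obtain u where u: "\<And>T. T \<in> d \<Longrightarrow> u T \<in> T" "\<And>T. T \<in> d \<Longrightarrow> g (u T) = v (g ` T)" by metis
  have "inj_on ((`) g) d" using inj_image_image[OF GL_D(1)[OF g]] by (rule inj_on_subset) simp
  then have "(\<Sum>S\<in>(`) g ` d. v S) = (\<Sum>T\<in>d. v (g ` T))" by (simp add: sum.reindex)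
  also have "\<dots> = g (\<Sum>T\<in>d. u T)" using u(2) by (simp add: GL_D(6)[OF g])
  finally have "g (\<Sum>T\<in>d. u T) = g 0" using v(2) GL_D(5)[OF g] by simp
  then have sum0: "(\<Sum>T\<in>d. u T) = 0" using GL_D(1)[OF g] by (simp add: inj_eq)
  obtain T where T: "T \<in> d" "S = g ` T" using S by blast
  have "u T = 0" using PD_sum_zero[OF d u(1) sum0 T(1)] .
  then show "v S = 0" using u(2)[OF T(1)] T(2) GL_D(5)[OF g] by simp
qed

lemma GL_cut_by:
  assumes g: "g \<in> carrier (GL scale)"
  shows "(`) g ` cut_by d W = cut_by ((`) g ` d) (g ` W)"
proof -
  have inter: "g ` (W \<inter> T) = g ` W \<inter> g ` T" for T using GL_D(1)[OF g] by (rule image_Int)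
  have zero: "g ` {0} = {0}" using GL_D(5)[OF g] by simp
  have "(`) g ` cut_by d W = (`) g ` (\<lambda>T. W \<inter> T) ` d - (`) g ` {{0}}"
    unfolding cut_by_def using inj_image_image[OF GL_D(1)[OF g]] by (rule image_set_diff)
  then show ?thesis by (simp add: cut_by_def image_image inter GL_D(5)[OF g])
qed

end

section \<open>Fixed points of posets of chains\<close>

text \<open>
  Let \<open>m\<close> be the least element that is moved, and \<open>f y = m\<close>. Everything below \<open>m\<close> is fixed, so \<open>y\<close> is
  not below \<open>m\<close>; hence \<open>m \<le> y\<close> and \<open>f m \<le> f y = m\<close>, so that \<open>f m\<close> is fixed, and injectivity gives \<open>f m = m\<close>.
\<close>

lemma chain_automorphism_trivial:
  assumes A: "is_poset A leq" and C: "C \<in> finite_chains A leq" and fC: "f ` C = C"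
    and mono: "\<And>x y. x \<in> C \<Longrightarrow> y \<in> C \<Longrightarrow> leq x y \<Longrightarrow> leq (f x) (f y)"
    and x: "x \<in> C"
  shows "f x = x"
proof (rule ccontr)
  assume "f x \<noteq> x"
  note CA = finite_chainsD(1)[OF C]
  let ?D = "{y \<in> C. f y \<noteq> y}"
  have inj: "inj_on f C" using finite_chainsD(2)[OF C] fC by (simp add: eq_card_imp_inj_on)
  have "?D \<in> finite_chains A leq"
    using x \<open>f x \<noteq> x\<close> by (intro finite_chains_nonempty_subset[OF C]) auto
  from finite_chains_has_least[OF A this] obtain m where m: "m \<in> C" "f m \<noteq> m" "\<And>y. y \<in> ?D \<Longrightarrow> leq m y"
    by blast
  have below: "f y = y" if "y \<in> C" "leq y m" "y \<noteq> m" for y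
  proof (rule ccontr)
    assume "f y \<noteq> y"
    then have "leq m y" using m(3) that(1) by blast
    then show False using poset_antisym[OF A, of y m] that m(1) CA by blast
  qed
  obtain y where y: "y \<in> C" "f y = m" using fC m(1) by (metis imageE)
  have fm: "f m \<in> C" using fC m(1) by blast
  have "y \<noteq> m" using y m(2) by blast
  consider "leq y m" | "leq m y" using finite_chains_total[OF A C y(1) m(1)] by blast
  then show False
  proof cases
    case 1
    then show False using below[OF y(1)] \<open>y \<noteq> m\<close> y(2) by simp
  next
    case 2
    then have "leq (f m) m" using mono[OF m(1) y(1)] y(2) by simp
    then have "f (f m) = f m" using below[OF fm] m(2) by simp
    then show False using inj_onD[OF inj _ fm m(1)] m(2) by blast
  qed
qed

lemma fixed_chains:
  assumes A: "is_poset A leq"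
    and act: "\<And>h x y. h \<in> H \<Longrightarrow> x \<in> A \<Longrightarrow> y \<in> A \<Longrightarrow> leq x y \<Longrightarrow> leq (act h x) (act h y)"
  shows "fixed_points H (\<lambda>h C. act h ` C) (finite_chains A leq) = finite_chains (fixed_points H act A) leq"
proof (rule Set.set_eqI)
  fix C
  show "C \<in> fixed_points H (\<lambda>h C. act h ` C) (finite_chains A leq)
      \<longleftrightarrow> C \<in> finite_chains (fixed_points H act A) leq"
  proof
    assume "C \<in> fixed_points H (\<lambda>h C. act h ` C) (finite_chains A leq)"
    then have C: "C \<in> finite_chains A leq" and HC: "\<And>h. h \<in> H \<Longrightarrow> act h ` C = C"
      by (simp_all add: fixed_points_def)
    have "act h x = x" if "h \<in> H" "x \<in> C" for h x
      using that finite_chainsD(1)[OF C]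
      by (intro chain_automorphism_trivial[OF A C HC] act) auto
    then have "C \<subseteq> fixed_points H act A"
      using finite_chainsD(1)[OF C] by (auto simp: fixed_points_def)
    then show "C \<in> finite_chains (fixed_points H act A) leq"
      using C by (simp add: finite_chains_def)
  next
    assume C: "C \<in> finite_chains (fixed_points H act A) leq"
    have fixed: "act h x = x" if "h \<in> H" "x \<in> C" for h x
      using finite_chainsD(1)[OF C] that by (auto simp: fixed_points_def)
    have "act h ` C = C" if "h \<in> H" for h
      using fixed[OF that] by simp
    moreover have "fixed_points H act A \<subseteq> A" by (auto simp: fixed_points_def)
    ultimately show "C \<in> fixed_points H (\<lambda>h C. act h ` C) (finite_chains A leq)"
      using C finite_chains_mono[of "fixed_points H act A" A leq] by (auto simp: fixed_points_def)
  qed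
qed

section \<open>The comparison map on posets of decompositions\<close>

text \<open>
  What the argument uses of a decomposition is its set of parts, the order, the decomposition \<open>single W\<close>
  with one part, and the decomposition \<open>cut d W\<close> whose parts are the non-zero intersections of \<open>W\<close> with
  the parts of \<open>d\<close>. The essential axioms are two adjunction-like properties: \<open>s \<le> single W\<close> when all
  parts of \<open>s\<close> lie in \<open>W\<close>, and \<open>s \<le> cut d W\<close> when moreover \<open>s \<le> d\<close>.
\<close>

locale decomposition_poset = vector_space scale
  for scale :: "'a::field \<Rightarrow> 'b::ab_group_add \<Rightarrow> 'b" +
  fixes parts :: "'d \<Rightarrow> 'b set set" and P :: "'d set" and leq :: "'d \<Rightarrow> 'd \<Rightarrow> bool"
    and act :: "('b \<Rightarrow> 'b) \<Rightarrow> 'd \<Rightarrow> 'd"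
    and single :: "'b set \<Rightarrow> 'd" and cut :: "'d \<Rightarrow> 'b set \<Rightarrow> 'd"
  assumes poset_P: "is_poset P leq"
    and poset_glued: "is_poset (X_Delta scale <+> {s \<in> P. parts s \<in> FD scale}) (glued_le scale parts leq)"
    and parts_PD: "s \<in> P \<Longrightarrow> parts s \<in> PD scale"
    and leq_parts: "s \<in> P \<Longrightarrow> t \<in> P \<Longrightarrow> leq s t \<Longrightarrow> pd_le (parts s) (parts t)"
    and single_in: "W \<in> proper_subspaces scale \<Longrightarrow> single W \<in> P"
    and parts_single: "parts (single W) = {W}"
    and leq_single: "s \<in> P \<Longrightarrow> (\<And>S. S \<in> parts s \<Longrightarrow> S \<subseteq> W) \<Longrightarrow> leq s (single W)"
    and parts_cut: "parts (cut d W) = cut_by (parts d) W"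
    and cut_in: "d \<in> P \<Longrightarrow> subspace W \<Longrightarrow> cut_by (parts d) W \<noteq> {} \<Longrightarrow> cut d W \<in> P"
    and cut_leq: "leq (cut d W) d"
    and leq_cut: "s \<in> P \<Longrightarrow> d \<in> P \<Longrightarrow> leq s d \<Longrightarrow> (\<And>S. S \<in> parts s \<Longrightarrow> S \<subseteq> W) \<Longrightarrow> leq s (cut d W)"
    and act_in: "g \<in> carrier (GL scale) \<Longrightarrow> s \<in> P \<Longrightarrow> act g s \<in> P"
    and parts_act: "parts (act g s) = (`) g ` parts s"
    and act_mono: "g \<in> carrier (GL scale) \<Longrightarrow> leq s t \<Longrightarrow> leq (act g s) (act g t)"
    and act_single: "act g (single W) = single (g ` W)"
    and act_cut: "g \<in> carrier (GL scale) \<Longrightarrow> act g (cut d W) = cut (act g d) (g ` W)"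
begin

abbreviation sp :: "'d \<Rightarrow> 'b set" where
  "sp s \<equiv> span (\<Union>(parts s))"

abbreviation glued :: "('b set set + 'd) set" where
  "glued \<equiv> X_Delta scale <+> {s \<in> P. parts s \<in> FD scale}"

abbreviation act_glued :: "('b \<Rightarrow> 'b) \<Rightarrow> 'b set set + 'd \<Rightarrow> 'b set set + 'd" where
  "act_glued g \<equiv> map_sum (\<lambda>\<sigma>. (\<lambda>S. g ` S) ` \<sigma>) (act g)"

lemma FD_iff: "s \<in> P \<Longrightarrow> parts s \<in> FD scale \<longleftrightarrow> sp s = UNIV"
  using parts_PD by (simp add: FD_def)

lemma part_le_sp: "S \<in> parts s \<Longrightarrow> S \<subseteq> sp s"
  by (meson Union_upper order_trans span_superset)

lemma sp_nonzero:
  assumes s: "s \<in> P" shows "sp s \<noteq> {0}"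
proof -
  obtain S where S: "S \<in> parts s" using parts_PD[OF s] by (auto simp: PD_def)
  then obtain x where "x \<in> S" "x \<noteq> 0"
    using subspace_nonzero_element PD_subspace[OF parts_PD[OF s]] PD_nonzero[OF parts_PD[OF s]] by metis
  then show ?thesis using part_le_sp[OF S] by blast
qed

lemma sp_proper: "s \<in> P \<Longrightarrow> sp s \<noteq> UNIV \<Longrightarrow> sp s \<in> proper_subspaces scale"
  using sp_nonzero by (simp add: proper_subspaces_def)

lemma sp_mono:
  assumes "s \<in> P" "t \<in> P" "leq s t"
  shows "sp s \<subseteq> sp t"
proof -
  have "\<Union>(parts s) \<subseteq> \<Union>(parts t)" using leq_parts[OF assms] unfolding pd_le_def by blast
  then show ?thesis by (rule span_mono)
qed

lemma leq_splits:
  assumes "s \<in> P" "d \<in> P" "leq s d"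
  shows "splits_along scale (sp s) (parts d)"
  unfolding splits_along_def
proof (rule span_mono, rule subsetI)
  fix x assume "x \<in> \<Union>(parts s)"
  then obtain S where S: "S \<in> parts s" "x \<in> S" by blast
  then obtain T where T: "T \<in> parts d" "S \<subseteq> T" using leq_parts[OF assms] unfolding pd_le_def by blast
  then show "x \<in> (\<Union>T\<in>parts d. sp s \<inter> T)" using S part_le_sp[OF S(1)] by blast
qed

lemma sp_single: "W \<in> proper_subspaces scale \<Longrightarrow> sp (single W) = W"
  by (simp add: parts_single proper_subspaces_def span_eq_iff)

lemma sp_cut:
  assumes W: "subspace W" and split: "splits_along scale W (parts d)"
  shows "sp (cut d W) = W"
proof
  have "\<Union>(parts (cut d W)) \<subseteq> W" by (auto simp: parts_cut cut_by_def)
  then show "sp (cut d W) \<subseteq> W" using W by (rule span_minimal)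
  have "(\<Union>T\<in>parts d. W \<inter> T) \<subseteq> sp (cut d W)"
  proof
    fix x assume "x \<in> (\<Union>T\<in>parts d. W \<inter> T)"
    then obtain T where T: "T \<in> parts d" "x \<in> W \<inter> T" by blast
    show "x \<in> sp (cut d W)"
    proof (cases "W \<inter> T = {0}")
      case True
      then have "x = 0" using T(2) by blast
      then show ?thesis by (simp add: span_zero)
    next
      case False
      then have "W \<inter> T \<in> parts (cut d W)" using T(1) by (simp add: parts_cut cut_by_def)
      then show ?thesis using part_le_sp T(2) by blast
    qed
  qed
  then have "span (\<Union>T\<in>parts d. W \<inter> T) \<subseteq> sp (cut d W)" by (intro span_minimal) auto
  then show "W \<subseteq> sp (cut d W)" using split by (auto simp: splits_along_def)
qed

lemma cut_in_P:
  assumes "d \<in> P" "subspace W" "W \<noteq> {0}" "splits_along scale W (parts d)"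
  shows "cut d W \<in> P"
proof (rule cut_in[OF assms(1,2)])
  show "cut_by (parts d) W \<noteq> {}"
  proof
    assume "cut_by (parts d) W = {}"
    then have "sp (cut d W) = {0}" by (simp add: parts_cut span_empty)
    then show False using sp_cut[OF assms(2,4)] assms(3) by simp
  qed
qed

lemma sp_act: "g \<in> carrier (GL scale) \<Longrightarrow> sp (act g s) = g ` sp s"
  by (simp add: parts_act GL_D(3) image_Union)

subsection \<open>The comparison map\<close>

lemma phi_of_proper:
  assumes "\<And>s. s \<in> \<sigma> \<Longrightarrow> sp s \<noteq> UNIV"
  shows "phi scale parts leq \<sigma> = Inl (sp ` \<sigma>)"
proof -
  have "{s \<in> \<sigma>. sp s = UNIV} = {}" "{s \<in> \<sigma>. sp s \<noteq> UNIV} = \<sigma>" using assms by auto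
  then show ?thesis by (simp add: phi_def Let_def)
qed

text \<open>
  Everything above a full decomposition is full, so the greatest full member of a chain is the greatest
  of all its members.
\<close>

lemma phi_of_full:
  assumes \<sigma>: "\<sigma> \<in> finite_chains P leq" and s: "s \<in> \<sigma>" "sp s = UNIV"
  obtains m where "m \<in> \<sigma>" "sp m = UNIV" "\<And>t. t \<in> \<sigma> \<Longrightarrow> leq t m" "phi scale parts leq \<sigma> = Inr m"
proof -
  note \<sigma>P = finite_chainsD(1)[OF \<sigma>]
  obtain m where m: "m \<in> \<sigma>" "\<And>t. t \<in> \<sigma> \<Longrightarrow> leq t m"
    using finite_chains_has_greatest[OF poset_P \<sigma>] by blast
  have "sp s \<subseteq> sp m" using m s(1) \<sigma>P by (intro sp_mono) auto
  then have full: "sp m = UNIV" using s(2) by blast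
  let ?F = "{t \<in> \<sigma>. sp t = UNIV}"
  have "greatest_of leq ?F = m"
    by (rule greatest_of_eq[OF poset_P]) (use \<sigma>P m full in auto)
  moreover have "?F \<noteq> {}" using s by blast
  ultimately have "phi scale parts leq \<sigma> = Inr m" by (simp add: phi_def Let_def greatest_of_def)
  then show ?thesis using that m full by blast
qed

lemma sp_chain:
  assumes \<sigma>: "\<sigma> \<in> finite_chains P leq"
  shows "s \<in> \<sigma> \<Longrightarrow> t \<in> \<sigma> \<Longrightarrow> sp s \<subseteq> sp t \<or> sp t \<subseteq> sp s"
  using finite_chains_total[OF poset_P \<sigma>] finite_chainsD(1)[OF \<sigma>] sp_mono by blast

lemma phi_in_glued:
  assumes \<sigma>: "\<sigma> \<in> finite_chains P leq"
  shows "phi scale parts leq \<sigma> \<in> glued"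
proof (cases "\<exists>s\<in>\<sigma>. sp s = UNIV")
  case True
  then obtain m where "m \<in> \<sigma>" "sp m = UNIV" "phi scale parts leq \<sigma> = Inr m"
    using phi_of_full[OF \<sigma>] by metis
  then show ?thesis using finite_chainsD(1)[OF \<sigma>] FD_iff by auto
next
  case False
  then have "sp ` \<sigma> \<in> X_Delta scale"
    using finite_chainsD(1-3)[OF \<sigma>] sp_proper sp_chain[OF \<sigma>]
    by (auto simp: X_Delta_def finite_chains_def totalp_on_def)
  then show ?thesis using False phi_of_proper[of \<sigma>] by auto
qed

text \<open>
  The decompositions \<open>s\<close> that may occur in a chain whose image under \<open>\<phi>\<close> is at most \<open>z\<close>.
\<close>

definition under :: "'b set set + 'd \<Rightarrow> 'd set" where
  "under z = (case z of Inl \<tau> \<Rightarrow> {s. sp s \<in> \<tau>}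
     | Inr d \<Rightarrow> {s. if sp s = UNIV then leq s d else splits_along scale (sp s) (parts d)})"

text \<open>
  If \<open>z\<close> is a full decomposition \<open>d\<close> and \<open>\<sigma>\<close> has a full member, then \<open>\<phi> \<sigma> \<le> d\<close> says that all of
  \<open>\<sigma>\<close> lies below \<open>d\<close>, and then all spans split along \<open>d\<close>. If \<open>\<sigma>\<close> has no full member, it says
  that the chain of spans has a common basis with \<open>d\<close>, which is tested on each span separately.
\<close>

lemma phi_le_iff:
  assumes \<sigma>: "\<sigma> \<in> finite_chains P leq" and z: "z \<in> glued"
  shows "glued_le scale parts leq (phi scale parts leq \<sigma>) z \<longleftrightarrow> \<sigma> \<subseteq> under z"
proof (cases "\<exists>s\<in>\<sigma>. sp s = UNIV")
  case True
  note \<sigma>P = finite_chainsD(1)[OF \<sigma>]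
  obtain m where m: "m \<in> \<sigma>" "sp m = UNIV" "\<And>t. t \<in> \<sigma> \<Longrightarrow> leq t m" "phi scale parts leq \<sigma> = Inr m"
    using True phi_of_full[OF \<sigma>] by metis
  show ?thesis
  proof (cases z)
    case (Inl \<tau>)
    then have "UNIV \<notin> \<tau>" using z by (auto simp: X_Delta_def finite_chains_def proper_subspaces_def)
    then show ?thesis using m Inl by (auto simp: under_def)
  next
    case (Inr d)
    then have dP: "d \<in> P" using z by auto
    have "\<sigma> \<subseteq> under z" if "leq m d"
    proof
      fix s assume s: "s \<in> \<sigma>"
      then have "leq s d" using poset_trans[OF poset_P, of s m d] \<sigma>P m dP that by blast
      then show "s \<in> under z" using leq_splits[of s d] s \<sigma>P dP Inr by (auto simp: under_def)
    qed
    moreover have "leq m d" if "\<sigma> \<subseteq> under z" using subsetD[OF that m(1)] m(2) Inr by (simp add: under_def)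
    ultimately show ?thesis using m(4) Inr by auto
  qed
next
  case False
  note \<sigma>P = finite_chainsD(1)[OF \<sigma>]
  have phi: "phi scale parts leq \<sigma> = Inl (sp ` \<sigma>)" using False phi_of_proper[of \<sigma>] by blast
  show ?thesis
  proof (cases z)
    case (Inl \<tau>)
    then show ?thesis using phi by (auto simp: under_def)
  next
    case (Inr d)
    then have d: "parts d \<in> FD scale" using z by auto
    have "has_common_basis scale (sp ` \<sigma> \<union> parts d) \<longleftrightarrow> (\<forall>s\<in>\<sigma>. splits_along scale (sp s) (parts d))"
    proof
      assume "has_common_basis scale (sp ` \<sigma> \<union> parts d)"
      then show "\<forall>s\<in>\<sigma>. splits_along scale (sp s) (parts d)"
        using common_basis_imp_splits[OF d] by blast
    next
      assume split: "\<forall>s\<in>\<sigma>. splits_along scale (sp s) (parts d)"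
      show "has_common_basis scale (sp ` \<sigma> \<union> parts d)"
        by (rule splits_imp_common_basis[OF d])
          (use split sp_chain[OF \<sigma>] finite_chainsD(2)[OF \<sigma>] in auto)
    qed
    then show ?thesis using phi Inr False by (auto simp: under_def)
  qed
qed

lemma phi_poset_map:
  "poset_map (finite_chains P leq) (\<subseteq>) glued (glued_le scale parts leq) (phi scale parts leq)"
  unfolding poset_map_def monotone_on_def
proof (intro conjI allI impI Pi_I ballI)
  fix \<sigma> assume "\<sigma> \<in> finite_chains P leq"
  then show "phi scale parts leq \<sigma> \<in> glued" by (rule phi_in_glued)
next
  fix \<sigma> \<tau> assume \<sigma>: "\<sigma> \<in> finite_chains P leq" and \<tau>: "\<tau> \<in> finite_chains P leq" and "\<sigma> \<subseteq> \<tau>"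
  have z: "phi scale parts leq \<tau> \<in> glued" using phi_in_glued[OF \<tau>] .
  have "\<tau> \<subseteq> under (phi scale parts leq \<tau>)" using phi_le_iff[OF \<tau> z] poset_refl[OF poset_glued z] by blast
  then show "glued_le scale parts leq (phi scale parts leq \<sigma>) (phi scale parts leq \<tau>)"
    using phi_le_iff[OF \<sigma> z] \<open>\<sigma> \<subseteq> \<tau>\<close> by blast
qed

lemma act_chain:
  assumes g: "g \<in> carrier (GL scale)" and \<sigma>: "\<sigma> \<in> finite_chains P leq"
  shows "act g ` \<sigma> \<in> finite_chains P leq"
  by (rule finite_chains_image[OF poset_P _ \<sigma>])
    (use act_in[OF g] act_mono[OF g] in \<open>auto simp: poset_map_def monotone_on_def\<close>)

lemma phi_equivariant:
  "equivariant_on (carrier (GL scale)) (\<lambda>g \<sigma>. act g ` \<sigma>) act_glued (finite_chains P leq) (phi scale parts leq)"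
  unfolding equivariant_on_def
proof (intro ballI)
  fix g \<sigma> assume g: "g \<in> carrier (GL scale)" and \<sigma>: "\<sigma> \<in> finite_chains P leq"
  note g\<sigma> = act_chain[OF g \<sigma>]
  show "phi scale parts leq (act g ` \<sigma>) = act_glued g (phi scale parts leq \<sigma>)"
  proof (cases "\<exists>s\<in>\<sigma>. sp s = UNIV")
    case True
    obtain m where m: "m \<in> \<sigma>" "sp m = UNIV" "\<And>t. t \<in> \<sigma> \<Longrightarrow> leq t m" "phi scale parts leq \<sigma> = Inr m"
      using True phi_of_full[OF \<sigma>] by metis
    have gm: "act g m \<in> act g ` \<sigma>" "sp (act g m) = UNIV"
      using m(1,2) sp_act[OF g] GL_image_UNIV[OF g] by auto
    obtain k where k: "k \<in> act g ` \<sigma>" "\<And>t. t \<in> act g ` \<sigma> \<Longrightarrow> leq t k" "phi scale parts leq (act g ` \<sigma>) = Inr k"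
      using phi_of_full[OF g\<sigma> gm] by metis
    have "leq k (act g m)" using k(1) m(3) act_mono[OF g] by blast
    then have "k = act g m"
      using poset_antisym[OF poset_P] k(1,2) gm(1) finite_chainsD(1)[OF g\<sigma>] by blast
    then show ?thesis using k(3) m(4) by simp
  next
    case False
    then have "sp t \<noteq> UNIV" if "t \<in> act g ` \<sigma>" for t
      using that sp_act[OF g] GL_image_UNIV[OF g] by auto
    then have "phi scale parts leq (act g ` \<sigma>) = Inl (sp ` act g ` \<sigma>)" by (rule phi_of_proper)
    moreover have "phi scale parts leq \<sigma> = Inl (sp ` \<sigma>)" using False phi_of_proper[of \<sigma>] by blast
    ultimately show ?thesis by (simp add: image_image sp_act[OF g])
  qed
qed

subsection \<open>Contractibility of the fibres\<close>

context
  fixes H :: "('b \<Rightarrow> 'b) set"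
  assumes H: "H \<subseteq> carrier (GL scale)"
begin

abbreviation PH :: "'d set" where
  "PH \<equiv> fixed_points H act P"

lemma PH_D: "s \<in> PH \<Longrightarrow> s \<in> P" "s \<in> PH \<Longrightarrow> h \<in> H \<Longrightarrow> act h s = s"
  by (auto simp: fixed_points_def)

lemma sp_fixed: "s \<in> PH \<Longrightarrow> h \<in> H \<Longrightarrow> h ` sp s = sp s"
  using H PH_D(2) sp_act by (metis subsetD)

lemma single_fixed:
  assumes "W \<in> proper_subspaces scale" "\<And>h. h \<in> H \<Longrightarrow> h ` W = W"
  shows "single W \<in> PH"
  using assms single_in act_single by (auto simp: fixed_points_def)

lemma poset_PH_subset: "is_poset (PH \<inter> R) leq"
  by (rule is_poset_subset_carrier[OF poset_P]) (auto simp: fixed_points_def)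

lemma contractible_under_chain:
  assumes \<tau>: "\<tau> \<in> X_Delta scale" and fixed: "\<And>h W. h \<in> H \<Longrightarrow> W \<in> \<tau> \<Longrightarrow> h ` W = W"
  shows "PH \<inter> under (Inl \<tau>) \<noteq> {}"
    and "contractible_space (realization (finite_chains (PH \<inter> under (Inl \<tau>)) leq))"
proof -
  have \<tau>': "\<tau> \<in> finite_chains (proper_subspaces scale) (\<subseteq>)" using \<tau> by (simp add: X_Delta_def)
  obtain M where M: "M \<in> \<tau>" "\<And>W. W \<in> \<tau> \<Longrightarrow> W \<subseteq> M"
    using finite_chains_has_greatest[OF is_poset_subset \<tau>'] by blast
  have MX: "M \<in> proper_subspaces scale" using M(1) finite_chainsD(1)[OF \<tau>'] by blast
  have m: "single M \<in> PH \<inter> under (Inl \<tau>)"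
    using single_fixed[OF MX fixed[OF _ M(1)]] sp_single[OF MX] M(1) by (simp add: under_def)
  then show "PH \<inter> under (Inl \<tau>) \<noteq> {}" by blast
  show "contractible_space (realization (finite_chains (PH \<inter> under (Inl \<tau>)) leq))"
  proof (rule contractible_with_greatest[OF poset_PH_subset m])
    fix s assume s: "s \<in> PH \<inter> under (Inl \<tau>)"
    then have "sp s \<subseteq> M" using M(2) by (simp add: under_def)
    then show "leq s (single M)" using s PH_D(1) part_le_sp by (intro leq_single) blast+
  qed
qed

text \<open>
  The map \<open>r s = cut d (sp s)\<close> moves everything below \<open>d\<close> without changing the span. It satisfies \<open>s \<le> r s\<close> only for
  \<open>s \<le> d\<close>; the remaining \<open>s\<close> are not full, and \<open>single (sp s)\<close> dominates both \<open>s\<close> and \<open>r s\<close>. The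
  map \<open>G\<close> combines the two cases. It is monotone since the elements below \<open>d\<close> form a down-closed set.
\<close>

lemma contractible_under_decomposition:
  assumes d: "d \<in> PH" and full: "sp d = UNIV"
  shows "PH \<inter> under (Inr d) \<noteq> {}"
    and "contractible_space (realization (finite_chains (PH \<inter> under (Inr d)) leq))"
proof -
  let ?R = "PH \<inter> under (Inr d)"
  note dP = PH_D(1)[OF d]
  have dR: "d \<in> ?R" using d full poset_refl[OF poset_P dP] by (simp add: under_def)
  then show "?R \<noteq> {}" by blast
  define r where "r s = cut d (sp s)" for s
  define G where "G s = (if leq s d then r s else single (sp s))" for s
  have split: "splits_along scale (sp s) (parts d)" if "s \<in> ?R" for s
  proof (cases "leq s d")
    case True
    then show ?thesis using leq_splits[OF PH_D(1) dP] that by blast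
  next
    case False
    then show ?thesis using that by (simp add: under_def split: if_splits)
  qed
  have sp_r: "sp (r s) = sp s" if "s \<in> ?R" for s
    unfolding r_def by (rule sp_cut[OF subspace_span split[OF that]])
  have r_le_d: "leq (r s) d" for s unfolding r_def by (rule cut_leq)
  have rP: "r s \<in> P" if "s \<in> ?R" for s
    unfolding r_def using that PH_D(1) by (intro cut_in_P dP subspace_span sp_nonzero split) auto
  have rR: "r s \<in> ?R" if s: "s \<in> ?R" for s
  proof -
    have "act h (r s) = r s" if h: "h \<in> H" for h
    proof -
      have "act h (r s) = cut (act h d) (h ` sp s)" unfolding r_def using H h by (intro act_cut) blast
      then show ?thesis using PH_D(2)[OF d h] sp_fixed[OF _ h, of s] s by (simp add: r_def)
    qed
    then have "r s \<in> PH" using rP[OF s] by (simp add: fixed_points_def)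
    then show ?thesis using r_le_d split[OF s] sp_r[OF s] by (simp add: under_def)
  qed
  have not_full: "sp s \<noteq> UNIV" if "s \<in> ?R" "\<not> leq s d" for s
    using that by (auto simp: under_def)
  have GR: "G s \<in> ?R" if s: "s \<in> ?R" for s
  proof (cases "leq s d")
    case True
    then show ?thesis using rR[OF s] by (simp add: G_def)
  next
    case False
    have proper: "sp s \<in> proper_subspaces scale"
      using sp_proper[OF PH_D(1) not_full[OF s False]] s by blast
    have "single (sp s) \<in> PH" using single_fixed[OF proper] sp_fixed s by blast
    then show ?thesis
      using False sp_single[OF proper] not_full[OF s False] split[OF s] by (simp add: G_def under_def)
  qed
  have parts_r: "S \<subseteq> sp t" if "s \<in> ?R" "t \<in> ?R" "leq s t" "S \<in> parts (r s)" for s t S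
    using part_le_sp[OF that(4)] sp_r[OF that(1)] sp_mono[OF PH_D(1) PH_D(1) that(3)] that(1,2) by blast
  have parts_s: "S \<subseteq> sp t" if "s \<in> ?R" "t \<in> ?R" "leq s t" "S \<in> parts s" for s t S
    using part_le_sp[OF that(4)] sp_mono[OF PH_D(1) PH_D(1) that(3)] that(1,2) by blast
  have refl: "leq s s" if "s \<in> ?R" for s using poset_refl[OF poset_P PH_D(1)] that by blast
  have r_mono: "leq (r s) (r t)" if "s \<in> ?R" "t \<in> ?R" "leq s t" for s t
  proof -
    have "leq (r s) (cut d (sp t))" by (rule leq_cut[OF rP[OF that(1)] dP r_le_d parts_r[OF that]])
    then show ?thesis by (simp add: r_def)
  qed
  have G_mono: "leq (G s) (G t)" if st: "s \<in> ?R" "t \<in> ?R" "leq s t" for s t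
  proof (cases "leq t d")
    case True
    then have "leq s d" using poset_trans[OF poset_P, of s t d] st dP PH_D(1) by blast
    then show ?thesis using True r_mono[OF st] by (simp add: G_def)
  next
    case tF: False
    show ?thesis
    proof (cases "leq s d")
      case True
      then show ?thesis using tF leq_single[OF rP[OF st(1)] parts_r[OF st]] by (simp add: G_def)
    next
      case False
      have proper: "sp s \<in> proper_subspaces scale"
        using sp_proper[OF PH_D(1) not_full[OF st(1) False]] st(1) by blast
      have "leq (single (sp s)) (single (sp t))"
        using sp_mono[OF PH_D(1) PH_D(1) st(3)] st(1,2)
        by (intro leq_single single_in[OF proper]) (auto simp: parts_single)
      then show ?thesis using False tF by (simp add: G_def)
    qed
  qed
  have s_le_G: "leq s (G s)" if s: "s \<in> ?R" for s
  proof (cases "leq s d")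
    case True
    then have "leq s (cut d (sp s))"
      using leq_cut[OF PH_D(1) dP True part_le_sp] s by blast
    then show ?thesis using True by (simp add: G_def r_def)
  next
    case False
    have "leq s (single (sp s))" using leq_single[OF PH_D(1) part_le_sp] s by blast
    then show ?thesis using False by (simp add: G_def)
  qed
  have r_le_G: "leq (r s) (G s)" if s: "s \<in> ?R" for s
  proof (cases "leq s d")
    case True
    then show ?thesis using refl[OF rR[OF s]] by (simp add: G_def)
  next
    case False
    then show ?thesis using leq_single[OF rP[OF s] parts_r[OF s s refl[OF s]]] by (simp add: G_def)
  qed
  note R = poset_PH_subset[of "under (Inr d)"]
  have pm: "poset_map ?R leq ?R leq G" "poset_map ?R leq ?R leq r"
    using GR G_mono rR r_mono by (simp_all add: poset_map_def monotone_on_def)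
  have 1: "homotopic_with (\<lambda>_. True) (realization (finite_chains ?R leq)) (realization (finite_chains ?R leq))
      (realization_map (\<lambda>x. x)) (realization_map G)"
    by (rule order_homotopy[OF R R poset_map_ident pm(1) s_le_G])
  have 2: "homotopic_with (\<lambda>_. True) (realization (finite_chains ?R leq)) (realization (finite_chains ?R leq))
      (realization_map r) (realization_map G)"
    by (rule order_homotopy[OF R R pm(2) pm(1) r_le_G])
  have 3: "homotopic_with (\<lambda>_. True) (realization (finite_chains ?R leq)) (realization (finite_chains ?R leq))
      (realization_map r) (realization_map (\<lambda>_. d))"
    by (rule order_homotopy[OF R R pm(2) poset_map_const[OF R dR] r_le_d])
  show "contractible_space (realization (finite_chains ?R leq))"
    by (rule contractible_realization[OF homotopic_with_trans[OF 1 homotopic_with_trans[OF homotopic_with_symD[OF 2] 3]]])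
qed

text \<open>
  The fibres of \<open>\<phi>\<close> are posets of chains of the posets contracted above, so they are contractible by
  subdivision.
\<close>

theorem phi_homotopy_equivalence:
  "poset_homotopy_equivalence (fixed_points H (\<lambda>g \<sigma>. act g ` \<sigma>) (finite_chains P leq)) (\<subseteq>)
    (fixed_points H act_glued glued) (glued_le scale parts leq) (phi scale parts leq)"
proof -
  let ?A = "fixed_points H (\<lambda>g \<sigma>. act g ` \<sigma>) (finite_chains P leq)"
  let ?B = "fixed_points H act_glued glued" and ?le = "glued_le scale parts leq"
  have A: "?A = finite_chains PH leq"
    by (rule fixed_chains[OF poset_P]) (use H act_mono in blast)
  have chain_P: "\<sigma> \<in> finite_chains P leq" if "\<sigma> \<in> ?A" for \<sigma>
    using that by (simp add: fixed_points_def)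
  have B: "is_poset ?B ?le"
    by (rule is_poset_subset_carrier[OF poset_glued]) (auto simp: fixed_points_def)
  have BD: "z \<in> glued" "\<And>h. h \<in> H \<Longrightarrow> act_glued h z = z" if "z \<in> ?B" for z
    using that by (auto simp: fixed_points_def)
  have under_good: "PH \<inter> under z \<noteq> {}"
    "contractible_space (realization (finite_chains (PH \<inter> under z) leq))" if z: "z \<in> ?B" for z
  proof -
    have "PH \<inter> under z \<noteq> {} \<and> contractible_space (realization (finite_chains (PH \<inter> under z) leq))"
    proof (cases z)
      case (Inl \<tau>)
      have \<tau>: "\<tau> \<in> X_Delta scale" using BD(1)[OF z] Inl by auto
      have "h ` W = W" if "h \<in> H" "W \<in> \<tau>" for h W
      proof (rule chain_automorphism_trivial[OF is_poset_subset _ _ _ that(2)])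
        show "\<tau> \<in> finite_chains (proper_subspaces scale) (\<subseteq>)" using \<tau> by (simp add: X_Delta_def)
        show "(`) h ` \<tau> = \<tau>" using BD(2)[OF z that(1)] Inl by simp
      qed (rule image_mono)
      then show ?thesis using contractible_under_chain[OF \<tau>] Inl by blast
    next
      case (Inr d)
      have "d \<in> PH" using BD[OF z] Inr by (auto simp: fixed_points_def)
      moreover have "sp d = UNIV" using BD(1)[OF z] Inr FD_iff by auto
      ultimately show ?thesis using contractible_under_decomposition Inr by blast
    qed
    then show "PH \<inter> under z \<noteq> {}" "contractible_space (realization (finite_chains (PH \<inter> under z) leq))"
      by blast+
  qed
  have fibre: "{\<sigma> \<in> ?A. ?le (phi scale parts leq \<sigma>) z} = finite_chains (PH \<inter> under z) leq" if z: "z \<in> ?B" for z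
  proof -
    have "{\<sigma> \<in> ?A. ?le (phi scale parts leq \<sigma>) z} = {\<sigma> \<in> ?A. \<sigma> \<subseteq> under z}"
      using phi_le_iff[OF chain_P BD(1)[OF z]] by blast
    also have "\<dots> = finite_chains (PH \<inter> under z) leq"
      unfolding A by (auto simp: finite_chains_def)
    finally show ?thesis .
  qed
  show ?thesis
  proof (rule quillen_fibre_lemma[OF is_poset_subset B])
    have "phi scale parts leq \<sigma> \<in> ?B" if "\<sigma> \<in> ?A" for \<sigma>
    proof -
      have "act_glued h (phi scale parts leq \<sigma>) = phi scale parts leq \<sigma>" if "h \<in> H" for h
      proof -
        have "phi scale parts leq (act h ` \<sigma>) = act_glued h (phi scale parts leq \<sigma>)"
          using phi_equivariant chain_P[OF \<open>\<sigma> \<in> ?A\<close>] H that unfolding equivariant_on_def by blast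
        moreover have "act h ` \<sigma> = \<sigma>" using \<open>\<sigma> \<in> ?A\<close> that by (simp add: fixed_points_def)
        ultimately show ?thesis by simp
      qed
      then show ?thesis using phi_in_glued[OF chain_P[OF that]] by (simp add: fixed_points_def)
    qed
    then show "poset_map ?A (\<subseteq>) ?B ?le (phi scale parts leq)"
      using phi_poset_map chain_P unfolding poset_map_def monotone_on_def by blast
    fix z assume z: "z \<in> ?B"
    obtain s where "s \<in> PH \<inter> under z" using under_good(1)[OF z] by blast
    then have "{s} \<in> finite_chains (PH \<inter> under z) leq" by (simp add: finite_chains_def)
    then show "{\<sigma> \<in> ?A. ?le (phi scale parts leq \<sigma>) z} \<noteq> {}" unfolding fibre[OF z] by blast
    show "contractible_space (realization (finite_chains {\<sigma> \<in> ?A. ?le (phi scale parts leq \<sigma>) z} (\<subseteq>)))"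
      unfolding fibre[OF z] by (rule contractible_subdivision[OF poset_PH_subset under_good(2)[OF z]])
  qed
qed

end

end

section \<open>Unordered and ordered decompositions\<close>

lemma (in vector_space) subset_cut_part:
  assumes "s \<in> PD scale" "S \<in> s" "S \<subseteq> W" "S \<subseteq> T"
  shows "S \<subseteq> W \<inter> T" "W \<inter> T \<noteq> {0}"
proof -
  obtain x where "x \<in> S" "x \<noteq> 0"
    using subspace_nonzero_element PD_subspace[OF assms(1,2)] PD_nonzero[OF assms(1,2)] by metis
  then show "S \<subseteq> W \<inter> T" "W \<inter> T \<noteq> {0}" using assms(3,4) by blast+
qed

lemma (in vector_space) decomposition_poset_PD:
  "decomposition_poset scale id (PD scale) pd_le act_PD (\<lambda>W. {W}) cut_by"
proof unfold_locales
  show "is_poset (PD scale) pd_le" by (rule is_poset_PD[OF vector_space_axioms])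
  have "{s \<in> PD scale. id s \<in> FD scale} = FD scale" by (auto simp: FD_def)
  then show "is_poset (X_Delta scale <+> {s \<in> PD scale. id s \<in> FD scale}) (glued_le scale id pd_le)"
    using is_poset_PD_Delta[OF vector_space_axioms] by (simp add: PD_Delta_def pd_delta_le_def)
  show "pd_le (cut_by d W) d" for d :: "'b set set" and W by (auto simp: pd_le_def cut_by_def)
  show "pd_le s (cut_by d W)"
    if s: "s \<in> PD scale" and "pd_le s d" and W: "\<And>S. S \<in> id s \<Longrightarrow> S \<subseteq> W" for s d W
    unfolding pd_le_def
  proof
    fix S assume S: "S \<in> s"
    then obtain T where T: "T \<in> d" "S \<subseteq> T" using \<open>pd_le s d\<close> unfolding pd_le_def by blast
    have "S \<subseteq> W" using W S by simp
    note cut = subset_cut_part[OF s S this T(2)]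
    have "W \<inter> T \<in> cut_by d W" using T(1) cut(2) by (simp add: cut_by_def)
    with cut(1) show "\<exists>T\<in>cut_by d W. S \<subseteq> T" by (rule bexI)
  qed
  show "act_PD g (cut_by d W) = cut_by (act_PD g d) (g ` W)" if "g \<in> carrier (GL scale)" for g d W
    using GL_cut_by[OF that] by (simp add: act_PD_def)
  show "act_PD g s \<in> PD scale" if "g \<in> carrier (GL scale)" "s \<in> PD scale" for g s
    using GL_PD[OF that] by (simp add: act_PD_def)
  show "pd_le (act_PD g s) (act_PD g t)" if "pd_le s t" for g :: "'b \<Rightarrow> 'b" and s t
    using that unfolding pd_le_def act_PD_def by (metis (no_types, lifting) image_iff image_mono)
qed (auto simp: singleton_PD cut_by_PD pd_le_def act_PD_def)

text \<open>
  The pairs of positions in the order on tuples are hidden behind this predicate because it obeys a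
  recursion along the list, which makes it compatible with filtering.
\<close>

definition weakly_before :: "'x list \<Rightarrow> ('x \<Rightarrow> bool) \<Rightarrow> ('x \<Rightarrow> bool) \<Rightarrow> bool" where
  "weakly_before w A B \<longleftrightarrow> (\<exists>p l. p \<le> l \<and> l < length w \<and> A (w ! p) \<and> B (w ! l))"

lemma weakly_before_Nil: "\<not> weakly_before [] A B"
  by (simp add: weakly_before_def)

lemma weakly_before_Cons:
  "weakly_before (x # xs) A B \<longleftrightarrow> (A x \<and> (\<exists>y\<in>set (x # xs). B y)) \<or> weakly_before xs A B"
proof
  assume "weakly_before (x # xs) A B"
  then obtain p l where pl: "p \<le> l" "l < length (x # xs)" "A ((x # xs) ! p)" "B ((x # xs) ! l)"
    by (auto simp: weakly_before_def)
  show "(A x \<and> (\<exists>y\<in>set (x # xs). B y)) \<or> weakly_before xs A B"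
  proof (cases p)
    case 0
    then have "A x" using pl(3) by simp
    moreover have "(x # xs) ! l \<in> set (x # xs)" using pl(2) by (rule nth_mem)
    ultimately show ?thesis using pl(4) by blast
  next
    case (Suc q)
    then obtain k where "l = Suc k" using pl(1) by (cases l) auto
    then have "q \<le> k \<and> k < length xs \<and> A (xs ! q) \<and> B (xs ! k)" using pl Suc by simp
    then show ?thesis unfolding weakly_before_def by blast
  qed
next
  assume "(A x \<and> (\<exists>y\<in>set (x # xs). B y)) \<or> weakly_before xs A B"
  then show "weakly_before (x # xs) A B"
  proof
    assume "A x \<and> (\<exists>y\<in>set (x # xs). B y)"
    then obtain l where "l < length (x # xs)" "B ((x # xs) ! l)" "A x" by (metis in_set_conv_nth)
    then show ?thesis unfolding weakly_before_def by (intro exI[of _ 0] exI[of _ l]) simp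
  next
    assume "weakly_before xs A B"
    then obtain p l where "p \<le> l" "l < length xs" "A (xs ! p)" "B (xs ! l)"
      by (auto simp: weakly_before_def)
    then show ?thesis unfolding weakly_before_def by (intro exI[of _ "Suc p"] exI[of _ "Suc l"]) simp
  qed
qed

lemma weakly_before_filter_map:
  "weakly_before (filter Q (map f w)) A B
    \<longleftrightarrow> weakly_before w (\<lambda>x. Q (f x) \<and> A (f x)) (\<lambda>x. Q (f x) \<and> B (f x))"
  by (induction w) (auto simp: weakly_before_Nil weakly_before_Cons)

lemma weakly_before_mono:
  assumes "weakly_before w A B" "\<And>x. A x \<Longrightarrow> A' x" "\<And>x. B x \<Longrightarrow> B' x"
  shows "weakly_before w A' B'"
  using assms unfolding weakly_before_def by blast

lemma opd_le_iff:
  "opd_le s w \<longleftrightarrow> (\<forall>i j. i \<le> j \<and> j < length s \<longrightarrow> weakly_before w (\<lambda>T. s ! i \<subseteq> T) (\<lambda>T. s ! j \<subseteq> T))"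
  by (simp add: opd_le_def weakly_before_def)

definition cut_list :: "'b::zero set list \<Rightarrow> 'b set \<Rightarrow> 'b set list" where
  "cut_list d W = filter (\<lambda>S. S \<noteq> {0}) (map (\<lambda>T. W \<inter> T) d)"

lemma set_cut_list: "set (cut_list d W) = cut_by (set d) W"
  by (auto simp: cut_list_def cut_by_def)

lemma (in vector_space) decomposition_poset_OPD:
  "decomposition_poset scale set (OPD scale) opd_le act_OPD (\<lambda>W. [W]) cut_list"
proof unfold_locales
  show "is_poset (OPD scale) opd_le" by (rule is_poset_OPD[OF vector_space_axioms])
  have "{s \<in> OPD scale. set s \<in> FD scale} = OFD scale" by (simp add: OFD_def)
  then show "is_poset (X_Delta scale <+> {s \<in> OPD scale. set s \<in> FD scale}) (glued_le scale set opd_le)"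
    using is_poset_OPD_Delta[OF vector_space_axioms] by (simp add: OPD_Delta_def opd_delta_le_def)
  show "pd_le (set s) (set t)" if "opd_le s t" for s t :: "'b set list"
    by (rule opd_le_imp_pd_le[OF vector_space_axioms that])
  show "opd_le s [W]" if "\<And>S. S \<in> set s \<Longrightarrow> S \<subseteq> W" for s and W :: "'b set"
    unfolding opd_le_def
  proof (intro allI impI)
    fix i j assume ij: "i \<le> j \<and> j < length s"
    then have "s ! i \<subseteq> W" "s ! j \<subseteq> W" using that by simp_all
    then show "\<exists>p l. p \<le> l \<and> l < length [W] \<and> s ! i \<subseteq> [W] ! p \<and> s ! j \<subseteq> [W] ! l"
      by (intro exI[of _ 0]) simp
  qed
  show "cut_list d W \<in> OPD scale"
    if "d \<in> OPD scale" "subspace W" "cut_by (set d) W \<noteq> {}" for d W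
  proof -
    have d: "distinct d" "set d \<in> PD scale" using that(1) by (simp_all add: OPD_def)
    have "inj_on (\<lambda>T. W \<inter> T) (set (filter (\<lambda>T. W \<inter> T \<noteq> {0}) d))"
      using cut_by_inj[OF d(2) that(2)] by (intro inj_onI) simp
    then have "distinct (cut_list d W)"
      using d(1) by (simp add: cut_list_def filter_map distinct_map o_def)
    then show ?thesis using cut_by_PD[OF d(2) that(2,3)] by (simp add: OPD_def set_cut_list)
  qed
  show "opd_le (cut_list d W) d" for d :: "'b set list" and W
    unfolding opd_le_iff
  proof (intro allI impI)
    fix i j assume "i \<le> j \<and> j < length (cut_list d W)"
    then have "weakly_before (cut_list d W) (\<lambda>T. cut_list d W ! i \<subseteq> T) (\<lambda>T. cut_list d W ! j \<subseteq> T)"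
      unfolding weakly_before_def by blast
    then have "weakly_before d (\<lambda>T. W \<inter> T \<noteq> {0} \<and> cut_list d W ! i \<subseteq> W \<inter> T)
        (\<lambda>T. W \<inter> T \<noteq> {0} \<and> cut_list d W ! j \<subseteq> W \<inter> T)"
      by (subst (asm) (1) cut_list_def) (simp only: weakly_before_filter_map)
    then show "weakly_before d (\<lambda>T. cut_list d W ! i \<subseteq> T) (\<lambda>T. cut_list d W ! j \<subseteq> T)"
      by (rule weakly_before_mono) blast+
  qed
  show "opd_le s (cut_list d W)"
    if s: "s \<in> OPD scale" and le: "opd_le s d" and W: "\<And>S. S \<in> set s \<Longrightarrow> S \<subseteq> W" for s d W
    unfolding opd_le_iff
  proof (intro allI impI)
    fix i j assume ij: "i \<le> j \<and> j < length s"
    have sPD: "set s \<in> PD scale" using s by (simp add: OPD_def)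
    have mem: "s ! i \<in> set s" "s ! j \<in> set s" using ij by simp_all
    have "weakly_before d (\<lambda>T. s ! i \<subseteq> T) (\<lambda>T. s ! j \<subseteq> T)"
      using le ij unfolding opd_le_iff by blast
    then have "weakly_before d (\<lambda>T. W \<inter> T \<noteq> {0} \<and> s ! i \<subseteq> W \<inter> T) (\<lambda>T. W \<inter> T \<noteq> {0} \<and> s ! j \<subseteq> W \<inter> T)"
    proof (rule weakly_before_mono)
      show "W \<inter> T \<noteq> {0} \<and> s ! i \<subseteq> W \<inter> T" if "s ! i \<subseteq> T" for T
        using subset_cut_part[OF sPD mem(1) W[OF mem(1)] that] by (intro conjI)
      show "W \<inter> T \<noteq> {0} \<and> s ! j \<subseteq> W \<inter> T" if "s ! j \<subseteq> T" for T
        using subset_cut_part[OF sPD mem(2) W[OF mem(2)] that] by (intro conjI)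
    qed
    then show "weakly_before (cut_list d W) (\<lambda>T. s ! i \<subseteq> T) (\<lambda>T. s ! j \<subseteq> T)"
      unfolding cut_list_def by (simp only: weakly_before_filter_map)
  qed
  show "act_OPD g s \<in> OPD scale" if "g \<in> carrier (GL scale)" "s \<in> OPD scale" for g s
  proof -
    have "inj_on ((`) g) (set s)"
      using inj_image_image[OF GL_D(1)[OF that(1)]] by (rule inj_on_subset) simp
    then show ?thesis using that(2) GL_PD[OF that(1)] by (simp add: OPD_def act_OPD_def distinct_map)
  qed
  show "opd_le (act_OPD g s) (act_OPD g t)" if "opd_le s t" for g :: "'b \<Rightarrow> 'b" and s t
    unfolding opd_le_def
  proof (intro allI impI)
    fix i j assume ij: "i \<le> j \<and> j < length (act_OPD g s)"
    then have ij': "i \<le> j" "j < length s" by (simp_all add: act_OPD_def)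
    then obtain p l where pl: "p \<le> l" "l < length t" "s ! i \<subseteq> t ! p" "s ! j \<subseteq> t ! l"
      using \<open>opd_le s t\<close> unfolding opd_le_def by blast
    have "g ` (s ! i) \<subseteq> g ` (t ! p)" "g ` (s ! j) \<subseteq> g ` (t ! l)" using pl(3,4) by (auto intro: image_mono)
    then show "\<exists>p l. p \<le> l \<and> l < length (act_OPD g t) \<and> act_OPD g s ! i \<subseteq> act_OPD g t ! p
        \<and> act_OPD g s ! j \<subseteq> act_OPD g t ! l"
      using pl(1,2) ij' by (intro exI[of _ p] exI[of _ l]) (simp add: act_OPD_def)
  qed
  show "act_OPD g (cut_list d W) = cut_list (act_OPD g d) (g ` W)" if g: "g \<in> carrier (GL scale)" for g d W
  proof -
    have "g ` (W \<inter> T) = g ` W \<inter> g ` T" for T using GL_D(1)[OF g] by (rule image_Int)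
    then show ?thesis
      unfolding cut_list_def act_OPD_def using GL_image_zero[OF g]
      by (induction d) (simp_all, metis)
  qed
qed (auto simp: OPD_def singleton_PD set_cut_list act_OPD_def)

theorem theorem3p8:
  fixes smul :: "'a::field \<Rightarrow> 'b::ab_group_add \<Rightarrow> 'b"
    and Basis :: "'b set" and n :: nat
  assumes "finite_dimensional_vector_space smul Basis"
    and "vector_space.dim smul UNIV = n"
  shows
    "poset_map (finite_chains (OPD smul) opd_le) (\<subseteq>) (OPD_Delta smul) (opd_delta_le smul) (phi_OPD smul)
     \<and> equivariant_on (carrier (GL smul)) act_OPD_chain act_OPD_Delta
         (finite_chains (OPD smul) opd_le) (phi_OPD smul)
     \<and> (\<forall>H. subgroup H (GL smul) \<longrightarrow>
          poset_homotopy_equivalence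
            (fixed_points H act_OPD_chain (finite_chains (OPD smul) opd_le)) (\<subseteq>)
            (fixed_points H act_OPD_Delta (OPD_Delta smul)) (opd_delta_le smul)
            (phi_OPD smul))
     \<and> poset_map (finite_chains (PD smul) pd_le) (\<subseteq>) (PD_Delta smul) (pd_delta_le smul) (phi_PD smul)
     \<and> equivariant_on (carrier (GL smul)) act_PD_chain act_PD_Delta
         (finite_chains (PD smul) pd_le) (phi_PD smul)
     \<and> (\<forall>H. subgroup H (GL smul) \<longrightarrow>
          poset_homotopy_equivalence
            (fixed_points H act_PD_chain (finite_chains (PD smul) pd_le)) (\<subseteq>)
            (fixed_points H act_PD_Delta (PD_Delta smul)) (pd_delta_le smul)
            (phi_PD smul))"
proof -
  interpret finite_dimensional_vector_space smul Basis by fact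
  interpret ordered: decomposition_poset smul set "OPD smul" opd_le act_OPD "\<lambda>W. [W]" cut_list
    by (rule decomposition_poset_OPD)
  interpret unordered: decomposition_poset smul id "PD smul" pd_le act_PD "\<lambda>W. {W}" cut_by
    by (rule decomposition_poset_PD)
  have O: "ordered.glued = OPD_Delta smul" "(\<lambda>g. (`) (act_OPD g)) = act_OPD_chain"
      "ordered.act_glued = act_OPD_Delta"
    by (simp_all add: OPD_Delta_def OFD_def fun_eq_iff act_OPD_chain_def act_OPD_Delta_def)
  have FD: "{s \<in> PD smul. id s \<in> FD smul} = FD smul" by (auto simp: FD_def)
  have U: "unordered.glued = PD_Delta smul" "(\<lambda>g. (`) (act_PD g)) = act_PD_chain"
      "unordered.act_glued = act_PD_Delta"
    unfolding FD by (simp_all add: PD_Delta_def fun_eq_iff act_PD_chain_def act_PD_Delta_def)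
  have H: "H \<subseteq> carrier (GL smul)" if "subgroup H (GL smul)" for H
    using that by (rule subgroup.subset)
  show ?thesis
    unfolding phi_OPD_def phi_PD_def opd_delta_le_def pd_delta_le_def
    using ordered.phi_poset_map ordered.phi_equivariant ordered.phi_homotopy_equivalence[OF H]
      unordered.phi_poset_map unordered.phi_equivariant unordered.phi_homotopy_equivalence[OF H]
    unfolding O U by simp
qed

end
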